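(* Let $M$ be the complement of an affine hyperplane arrangement of fiber-type in $\mathbb{A}^\ell$, defined over a field $k$ of characteristic $0$. Then the de Rham cohomology of the reduced bar construction on $M$ is trivial: $$H^0_{\mathrm{DR}}(B(M))\cong k\qquad\text{and}\qquad H^i_{\mathrm{DR}}(B(M))=0\quad\text{for all }i\ge1.$$
   Context: Fiber-type: let $M\subset\mathbb{A}^\ell$ be an arrangement complement. For a linear projection $\mathbb{A}^\ell\to\mathbb{A}^{\ell-1}$ with one-dimensional kernel, with vertical coordinate $y$, call a hyperplane vertical if it is a union of fibres of the projection, horizontal otherwise; let $M'\subset\mathbb{A}^{\ell-1}$ be the complement of the images of the vertical hyperplanes. Write the distinct horizontal hyperplanes as $y=f_i$ with $f_i$ affine-linear functions on $\mathbb{A}^{\ell-1}$. The induced map $M\to M'$ is a (linear) fibration if and only if $1/(f_i-f_j)\in\mathcal{O}_{M'}$ for all $i\ne j$; the fibres are then affine lines with a constant number of points removed. $M$ is of fiber-type if it can be expressed as an iterated sequence of such linear fibrations with one-dimensional fibres $M\to M_1\to M_2\to\cdots\to M_{\ell-1}$, with $M_{i}\subset\mathbb{A}^{\ell-i}$ and $M_{\ell-1}$ of dimension one. Bar construction: for $M=\mathbb{A}^\ell_k\backslash\bigcup_{i=1}^NH_i$, let $\alpha_i$ be a degree-one polynomial defining $H_i$, $\mathcal{O}_M=k[x_1,\ldots,x_\ell,\alpha_1^{-1},\ldots,\alpha_N^{-1}]$, $\omega_i=d\log\alpha_i$, and $\Omega^j(\mathcal{O}_M)$ the algebraic $j$-forms.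 Put $V_0=k$, $V_1=\bigoplus_ik\,\omega_i$, and for $m\ge2$ let $V_m$ be the space of elements $\sum_Ic_I[\omega_{i_1}|\cdots|\omega_{i_m}]\in V_1^{\otimes m}$, $c_I\in k$, with $\sum_Ic_I\,\omega_{i_1}\otimes\cdots\otimes(\omega_{i_j}\wedge\omega_{i_{j+1}})\otimes\cdots\otimes\omega_{i_m}=0$ for all $1\le j<m$. Then $B(M)=\mathcal{O}_M\otimes_k\bigoplus_{m\ge0}V_m$, $\Omega^jB(M)=\Omega^j(\mathcal{O}_M)\otimes_k\bigoplus_{m\ge0}V_m$, with differential $$d\sum_I\phi_I\otimes[\omega_{i_1}|\cdots|\omega_{i_m}]=\sum_Id\phi_I\otimes[\omega_{i_1}|\cdots|\omega_{i_m}]+\sum_I(-1)^{\deg\phi_I}\phi_I\wedge\omega_{i_1}\otimes[\omega_{i_2}|\cdots|\omega_{i_m}],$$ and $H^i_{\mathrm{DR}}(B(M))$ is the $i$-th cohomology of this complex. *)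

theory Defs
  imports
    Complex_Main
    "HOL-Library.Poly_Mapping"
    "HOL-Library.Function_Algebras"
    "HOL-Computational_Algebra.Fraction_Field"
begin

section \<open>Polynomials, rational functions and partial derivatives\<close>

text \<open>Polynomials over \<open>k\<close> in the variables \<open>x\<^sub>0, x\<^sub>1, \<dots>\<close>; the coordinates
  of \<open>\<bbbA>\<^sup>n\<close> are \<open>x\<^sub>0, \<dots>, x\<^bsub>n-1\<^esub>\<close>. Every coordinate ring below is a subring of the
  fraction field of this polynomial ring.\<close>

type_synonym 'k mpoly = "(nat \<Rightarrow>\<^sub>0 nat) \<Rightarrow>\<^sub>0 'k"
type_synonym 'k ratfun = "'k mpoly fract"

definition Const :: "'k::field_char_0 \<Rightarrow> 'k mpoly" where
  "Const c = Poly_Mapping.single 0 c"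

definition Var :: "nat \<Rightarrow> 'k::field_char_0 mpoly" where
  "Var i = Poly_Mapping.single (Poly_Mapping.single i 1) 1"

definition eval_mpoly :: "(nat \<Rightarrow> 'k::field_char_0) \<Rightarrow> 'k mpoly \<Rightarrow> 'k" where
  "eval_mpoly x p =
     (\<Sum>m\<in>Poly_Mapping.keys p. Poly_Mapping.lookup p m *
        (\<Prod>i\<in>Poly_Mapping.keys m. x i ^ Poly_Mapping.lookup m i))"

definition pderiv_mpoly :: "nat \<Rightarrow> 'k::field_char_0 mpoly \<Rightarrow> 'k mpoly" where
  "pderiv_mpoly i p =
     (\<Sum>m\<in>Poly_Mapping.keys p. Poly_Mapping.single (m - Poly_Mapping.single i 1)
                     (of_nat (Poly_Mapping.lookup m i) * Poly_Mapping.lookup p m))"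

lemma pderiv_mpoly_superset:
  assumes "finite A" "Poly_Mapping.keys p \<subseteq> A"
  shows "pderiv_mpoly i p =
     (\<Sum>m\<in>A. Poly_Mapping.single (m - Poly_Mapping.single i 1)
                (of_nat (Poly_Mapping.lookup m i) * Poly_Mapping.lookup p m))"
  unfolding pderiv_mpoly_def
  by (rule sum.mono_neutral_left) (use assms in \<open>auto simp: in_keys_iff\<close>)

lemma pderiv_mpoly_add: "pderiv_mpoly i (p + q) = pderiv_mpoly i p + pderiv_mpoly i q"
proof -
  have "pderiv_mpoly i r =
     (\<Sum>m\<in>Poly_Mapping.keys p \<union> Poly_Mapping.keys q.
        Poly_Mapping.single (m - Poly_Mapping.single i 1)
        (of_nat (Poly_Mapping.lookup m i) * Poly_Mapping.lookup r m))"
    if "r = p \<or> r = q \<or> r = p + q" for r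
    by (rule pderiv_mpoly_superset) (use that Poly_Mapping.keys_add[of p q] in auto)
  then show ?thesis
    by (simp add: lookup_add algebra_simps single_add sum.distrib)
qed

lemma pderiv_mpoly_0 [simp]: "pderiv_mpoly i 0 = 0"
  by (simp add: pderiv_mpoly_def)

lemma pderiv_mpoly_sum: "pderiv_mpoly i (sum f A) = (\<Sum>a\<in>A. pderiv_mpoly i (f a))"
  by (induction A rule: infinite_finite_induct) (auto simp: pderiv_mpoly_add)

lemma pderiv_mpoly_single:
  "pderiv_mpoly i (Poly_Mapping.single m c) =
     Poly_Mapping.single (m - Poly_Mapping.single i 1) (of_nat (Poly_Mapping.lookup m i) * c)"
  by (subst pderiv_mpoly_superset[of "{m}"]) auto

lemma mpoly_sum_single:
  "(\<Sum>m\<in>Poly_Mapping.keys p. Poly_Mapping.single m (Poly_Mapping.lookup p m)) = p"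
proof (rule poly_mapping_eqI)
  fix n
  show "Poly_Mapping.lookup (\<Sum>m\<in>Poly_Mapping.keys p.
          Poly_Mapping.single m (Poly_Mapping.lookup p m)) n = Poly_Mapping.lookup p n"
    by (auto simp: lookup_sum lookup_single when_def in_keys_iff)
qed

lemma monom_shift:
  fixes m n :: "nat \<Rightarrow>\<^sub>0 nat"
  assumes "Poly_Mapping.lookup m i \<noteq> 0"
  shows "m - Poly_Mapping.single i 1 + n = m + n - Poly_Mapping.single i 1"
  by (rule poly_mapping_eqI) (use assms in \<open>auto simp: lookup_add lookup_minus lookup_single when_def\<close>)

lemma pderiv_mpoly_mult_single:
  fixes a b :: "'k::field_char_0"
  shows "pderiv_mpoly i (Poly_Mapping.single m a * Poly_Mapping.single n b) =
     pderiv_mpoly i (Poly_Mapping.single m a) * Poly_Mapping.single n b +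
     Poly_Mapping.single m a * pderiv_mpoly i (Poly_Mapping.single n b)"
proof -
  let ?e = "Poly_Mapping.single i (1::nat)"
  have 1: "Poly_Mapping.single (m - ?e + n) (of_nat (Poly_Mapping.lookup m i) * a * b) =
           Poly_Mapping.single (m + n - ?e) (of_nat (Poly_Mapping.lookup m i) * a * b)"
  proof (cases "Poly_Mapping.lookup m i = 0")
    case False
    then show ?thesis by (simp only: monom_shift[OF False])
  qed simp
  have 2: "Poly_Mapping.single (m + (n - ?e)) (a * (of_nat (Poly_Mapping.lookup n i) * b)) =
           Poly_Mapping.single (m + n - ?e) (a * (of_nat (Poly_Mapping.lookup n i) * b))"
  proof (cases "Poly_Mapping.lookup n i = 0")
    case False
    have "m + (n - ?e) = m + n - ?e"
      using monom_shift[OF False, of m] by (simp only: add.commute)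
    then show ?thesis by (simp only:)
  qed simp
  show ?thesis
    unfolding mult_single pderiv_mpoly_single 1 2
    by (simp add: single_add[symmetric] lookup_add algebra_simps)
qed

lemma pderiv_mpoly_mult:
  "pderiv_mpoly i (p * q) = pderiv_mpoly i p * q + p * pderiv_mpoly i q"
proof -
  let ?s = "\<lambda>p m. Poly_Mapping.single m (Poly_Mapping.lookup p m)"
  have "pderiv_mpoly i ((\<Sum>m\<in>Poly_Mapping.keys p. ?s p m) * (\<Sum>n\<in>Poly_Mapping.keys q. ?s q n)) =
     pderiv_mpoly i (\<Sum>m\<in>Poly_Mapping.keys p. ?s p m) * (\<Sum>n\<in>Poly_Mapping.keys q. ?s q n) +
     (\<Sum>m\<in>Poly_Mapping.keys p. ?s p m) * pderiv_mpoly i (\<Sum>n\<in>Poly_Mapping.keys q. ?s q n)"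
    by (simp add: sum_product pderiv_mpoly_sum pderiv_mpoly_mult_single sum.distrib)
  then show ?thesis
    by (simp only: mpoly_sum_single)
qed

lift_definition pderiv_rat :: "nat \<Rightarrow> 'k::field_char_0 ratfun \<Rightarrow> 'k ratfun"
  is "\<lambda>i q. (pderiv_mpoly i (fst q) * snd q - fst q * pderiv_mpoly i (snd q), snd q * snd q)"
proof -
  fix i and q r :: "'k mpoly \<times> 'k mpoly"
  assume "fractrel q r"
  moreover obtain a b where q: "q = (a, b)" by force
  moreover obtain c d where r: "r = (c, d)" by force
  ultimately have nz: "b \<noteq> 0" "d \<noteq> 0" and eq: "a * d = c * b" by auto
  have "pderiv_mpoly i (a * d) = pderiv_mpoly i (c * b)"
    by (simp only: eq)
  then have deq: "pderiv_mpoly i a * d + a * pderiv_mpoly i d =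
                  pderiv_mpoly i c * b + c * pderiv_mpoly i b"
    by (simp only: pderiv_mpoly_mult)
  have "(pderiv_mpoly i a * b - a * pderiv_mpoly i b) * (d * d) =
        (pderiv_mpoly i c * d - c * pderiv_mpoly i d) * (b * b)"
    using eq deq by algebra
  then show "fractrel
      (pderiv_mpoly i (fst q) * snd q - fst q * pderiv_mpoly i (snd q), snd q * snd q)
      (pderiv_mpoly i (fst r) * snd r - fst r * pderiv_mpoly i (snd r), snd r * snd r)"
    using nz by (simp add: q r)
qed

definition poly_rat :: "'k::field_char_0 mpoly \<Rightarrow> 'k ratfun" where
  "poly_rat p = Fract p 1"

definition const_rat :: "'k::field_char_0 \<Rightarrow> 'k ratfun" where
  "const_rat c = poly_rat (Const c)"


section \<open>Hyperplane arrangements and their coordinate rings\<close>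

text \<open>Since \<open>k\<close> is infinite, a hyperplane is determined by its set of \<open>k\<close>-points. A point of
  \<open>k\<^sup>n\<close> is a sequence vanishing from index \<open>n\<close> on.\<close>

definition affine_space :: "nat \<Rightarrow> (nat \<Rightarrow> 'k::field_char_0) set" where
  "affine_space n = {x. \<forall>i\<ge>n. x i = 0}"

definition affine_linear :: "nat \<Rightarrow> 'k::field_char_0 mpoly \<Rightarrow> bool" where
  "affine_linear n p \<longleftrightarrow> (\<exists>a c. p = Const c + (\<Sum>i<n. Const (a i) * Var i))"

definition degree_one :: "nat \<Rightarrow> 'k::field_char_0 mpoly \<Rightarrow> bool" where
  "degree_one n p \<longleftrightarrow>
     (\<exists>a c. p = Const c + (\<Sum>i<n. Const (a i) * Var i) \<and> (\<exists>i<n. a i \<noteq> 0))"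

definition zero_set :: "nat \<Rightarrow> 'k::field_char_0 mpoly \<Rightarrow> (nat \<Rightarrow> 'k) set" where
  "zero_set n p = {x \<in> affine_space n. eval_mpoly x p = 0}"

definition arrangement :: "nat \<Rightarrow> (nat \<Rightarrow> 'k::field_char_0) set set \<Rightarrow> bool" where
  "arrangement n \<A> \<longleftrightarrow> finite \<A> \<and> (\<forall>H\<in>\<A>. \<exists>\<alpha>. degree_one n \<alpha> \<and> H = zero_set n \<alpha>)"

text \<open>\<open>coord_ring n S\<close> is \<open>k[x\<^sub>0, \<dots>, x\<^bsub>n-1\<^esub>, s\<^sup>-\<^sup>1 (s \<in> S)]\<close>.\<close>

inductive_set coord_ring :: "nat \<Rightarrow> 'k::field_char_0 mpoly set \<Rightarrow> 'k ratfun set"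
  for n :: nat and S :: "'k mpoly set" where
  const: "const_rat c \<in> coord_ring n S"
| var: "i < n \<Longrightarrow> poly_rat (Var i) \<in> coord_ring n S"
| inv: "s \<in> S \<Longrightarrow> inverse (poly_rat s) \<in> coord_ring n S"
| add: "f \<in> coord_ring n S \<Longrightarrow> g \<in> coord_ring n S \<Longrightarrow> f + g \<in> coord_ring n S"
| mult: "f \<in> coord_ring n S \<Longrightarrow> g \<in> coord_ring n S \<Longrightarrow> f * g \<in> coord_ring n S"

definition complement_ring :: "nat \<Rightarrow> (nat \<Rightarrow> 'k::field_char_0) set set \<Rightarrow> 'k ratfun set" where
  "complement_ring n \<A> = coord_ring n {\<alpha>. degree_one n \<alpha> \<and> zero_set n \<alpha> \<in> \<A>}"


section \<open>Fiber-type arrangements\<close>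

definition linear_on_space ::
    "nat \<Rightarrow> ((nat \<Rightarrow> 'k::field_char_0) \<Rightarrow> 'b::ab_group_add) \<Rightarrow> ('k \<Rightarrow> 'b \<Rightarrow> 'b) \<Rightarrow> bool" where
  "linear_on_space n T sc \<longleftrightarrow>
     (\<forall>x\<in>affine_space n. \<forall>y\<in>affine_space n. T (x + y) = T x + T y) \<and>
     (\<forall>c. \<forall>x\<in>affine_space n. T (\<lambda>i. c * x i) = sc c (T x))"

text \<open>A linear projection \<open>\<pi> : k\<^sup>n\<^sup>+\<^sup>1 \<rightarrow> k\<^sup>n\<close> together with a linear form \<open>y\<close> such that
  \<open>(\<pi>, y)\<close> is a linear coordinate system. The bijectivity says that \<open>\<pi>\<close> is onto, hence has
  one-dimensional kernel, and that \<open>y\<close> restricts to a coordinate on the kernel.\<close>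

definition linear_projection ::
    "nat \<Rightarrow> ((nat \<Rightarrow> 'k::field_char_0) \<Rightarrow> (nat \<Rightarrow> 'k)) \<Rightarrow> ((nat \<Rightarrow> 'k) \<Rightarrow> 'k) \<Rightarrow> bool" where
  "linear_projection n \<pi> y \<longleftrightarrow>
     linear_on_space (Suc n) \<pi> (\<lambda>c z i. c * z i) \<and>
     linear_on_space (Suc n) y (\<lambda>c z. c * z) \<and>
     bij_betw (\<lambda>x. (\<pi> x, y x)) (affine_space (Suc n)) (affine_space n \<times> UNIV)"

definition vertical ::
    "nat \<Rightarrow> ((nat \<Rightarrow> 'k::field_char_0) \<Rightarrow> (nat \<Rightarrow> 'k)) \<Rightarrow> (nat \<Rightarrow> 'k) set \<Rightarrow> bool" where
  "vertical n \<pi> H \<longleftrightarrow> (\<exists>B\<subseteq>affine_space n. H = (\<Union>b\<in>B. {x \<in> affine_space (Suc n). \<pi> x = b}))"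

definition vertical_images ::
    "nat \<Rightarrow> ((nat \<Rightarrow> 'k::field_char_0) \<Rightarrow> (nat \<Rightarrow> 'k)) \<Rightarrow> (nat \<Rightarrow> 'k) set set \<Rightarrow> (nat \<Rightarrow> 'k) set set"
  where
  "vertical_images n \<pi> \<A> = (\<lambda>H. \<pi> ` H) ` {H \<in> \<A>. vertical n \<pi> H}"

text \<open>The horizontal hyperplanes are \<open>y = f\<^sub>H\<close>, and the projection \<open>M \<rightarrow> M'\<close> is a linear
  fibration iff \<open>1/(f\<^sub>H - f\<^bsub>H'\<^esub>)\<close> is regular on \<open>M'\<close> for \<open>H \<noteq> H'\<close>. Distinct
  horizontal hyperplanes have \<open>f\<^sub>H \<noteq> f\<^bsub>H'\<^esub>\<close>, so no inverse of zero is taken.\<close>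

definition linear_fibration ::
    "nat \<Rightarrow> ((nat \<Rightarrow> 'k::field_char_0) \<Rightarrow> (nat \<Rightarrow> 'k)) \<Rightarrow> ((nat \<Rightarrow> 'k) \<Rightarrow> 'k) \<Rightarrow>
     (nat \<Rightarrow> 'k) set set \<Rightarrow> bool" where
  "linear_fibration n \<pi> y \<A> \<longleftrightarrow> linear_projection n \<pi> y \<and>
     (\<exists>f. (\<forall>H\<in>{H \<in> \<A>. \<not> vertical n \<pi> H}. affine_linear n (f H) \<and>
             H = {x \<in> affine_space (Suc n). y x = eval_mpoly (\<pi> x) (f H)}) \<and>
          (\<forall>H\<in>{H \<in> \<A>. \<not> vertical n \<pi> H}. \<forall>H'\<in>{H \<in> \<A>. \<not> vertical n \<pi> H}. H \<noteq> H' \<longrightarrow>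
             inverse (poly_rat (f H - f H')) \<in> complement_ring n (vertical_images n \<pi> \<A>)))"

inductive fiber_type :: "nat \<Rightarrow> (nat \<Rightarrow> 'k::field_char_0) set set \<Rightarrow> bool" where
  line: "arrangement 1 \<A> \<Longrightarrow> fiber_type 1 \<A>"
| step: "arrangement (Suc n) \<A> \<Longrightarrow> linear_fibration n \<pi> y \<A> \<Longrightarrow>
         fiber_type n (vertical_images n \<pi> \<A>) \<Longrightarrow> fiber_type (Suc n) \<A>"


section \<open>Algebraic differential forms\<close>

text \<open>A form is given by its coefficients: \<open>\<eta>\<close> stands for the sum of the \<open>\<eta> S dx\<^sub>S\<close>,
  where \<open>dx\<^sub>S = dx\<^bsub>s1\<^esub> \<and> \<dots> \<and> dx\<^bsub>sj\<^esub>\<close> for \<open>S = {s1 < \<dots> < sj}\<close>. The forms on the complement of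
  an arrangement are free over the coordinate ring on the \<open>dx\<^sub>S\<close>.\<close>

type_synonym 'k form = "nat set \<Rightarrow> 'k ratfun"

definition forms :: "nat \<Rightarrow> 'k::field_char_0 mpoly set \<Rightarrow> nat \<Rightarrow> 'k form set" where
  "forms n S j =
     {\<eta>. \<forall>T. \<eta> T \<in> coord_ring n S \<and> (\<eta> T \<noteq> 0 \<longrightarrow> T \<subseteq> {..<n} \<and> card T = j)}"

definition fun_form :: "'k::field_char_0 ratfun \<Rightarrow> 'k form" where
  "fun_form f = (\<lambda>T. if T = {} then f else 0)"

definition form_scale :: "'k::field_char_0 ratfun \<Rightarrow> 'k form \<Rightarrow> 'k form" where
  "form_scale f \<eta> = (\<lambda>T. f * \<eta> T)"

definition wedge :: "'k::field_char_0 form \<Rightarrow> 'k form \<Rightarrow> 'k form" where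
  "wedge \<eta> \<theta> = (\<lambda>T. \<Sum>I\<in>Pow T.
     (-1) ^ card {(i, j). i \<in> I \<and> j \<in> T - I \<and> j < i} * \<eta> I * \<theta> (T - I))"

definition ext_deriv :: "'k::field_char_0 form \<Rightarrow> 'k form" where
  "ext_deriv \<eta> = (\<lambda>T. \<Sum>i\<in>T. (-1) ^ card {j \<in> T. j < i} * pderiv_rat i (\<eta> (T - {i})))"

definition dlog :: "'k::field_char_0 mpoly \<Rightarrow> 'k form" where
  "dlog \<alpha> = form_scale (inverse (poly_rat \<alpha>)) (ext_deriv (fun_form (poly_rat \<alpha>)))"


section \<open>The reduced bar construction\<close>

text \<open>\<open>V\<^sub>1\<close> has basis the \<open>\<omega>\<^sub>i = dlog \<alpha>\<^sub>i\<close> (\<open>i < N\<close>), so an element of the \<open>m\<close>-fold tensor power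
  is a \<open>k\<close>-valued function on words of length \<open>m\<close> in the indices \<open>i < N\<close>. Likewise a tensor in
  \<open>V\<^sub>1\<^sup>\<otimes>\<^sup>p \<otimes> \<Omega>\<^sup>2 \<otimes> V\<^sub>1\<^sup>\<otimes>\<^sup>q\<close> is a family of 2-forms indexed by pairs \<open>(u, v)\<close> of words of lengths
  \<open>p\<close>, \<open>q\<close>, and vanishes iff every member does.\<close>

definition bar_words :: "nat \<Rightarrow> (nat \<Rightarrow> 'k::field_char_0 mpoly) \<Rightarrow> nat \<Rightarrow> (nat list \<Rightarrow> 'k) set" where
  "bar_words N \<alpha> m =
     {c. (\<forall>w. c w \<noteq> 0 \<longrightarrow> length w = m \<and> set w \<subseteq> {..<N}) \<and>
         (\<forall>u v. length u + 2 + length v = m \<longrightarrow>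
            (\<Sum>a<N. \<Sum>b<N. form_scale (const_rat (c (u @ [a, b] @ v)))
                                (wedge (dlog (\<alpha> a)) (dlog (\<alpha> b)))) = 0)}"

text \<open>\<open>V\<close> being a subspace of the space with basis the words, \<open>\<Omega>\<^sup>j \<otimes>\<^sub>k V\<close> embeds
  into the functions from words to forms, as the span of the pure tensors.\<close>

type_synonym 'k bar = "nat list \<Rightarrow> 'k form"

definition pure_tensor :: "'k::field_char_0 form \<Rightarrow> (nat list \<Rightarrow> 'k) \<Rightarrow> 'k bar" where
  "pure_tensor \<phi> c = (\<lambda>w. form_scale (const_rat (c w)) \<phi>)"

definition bar_forms ::
    "nat \<Rightarrow> nat \<Rightarrow> (nat \<Rightarrow> 'k::field_char_0 mpoly) \<Rightarrow> nat \<Rightarrow> 'k bar set" where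
  "bar_forms n N \<alpha> j =
     {\<Sum>r<R. pure_tensor (\<phi> r) (c r) | (R::nat) \<phi> c.
        \<forall>r<R. \<phi> r \<in> forms n (\<alpha> ` {..<N}) j \<and> c r \<in> (\<Union>m. bar_words N \<alpha> m)}"

text \<open>The differential on \<open>\<Omega>\<^sup>jB(M)\<close>. The coefficient of the word \<open>w\<close> receives the
  contribution \<open>(-1)\<^sup>j \<phi> \<and> \<omega>\<^sub>i\<close> from every word \<open>i # w\<close>.\<close>

definition bar_diff ::
    "nat \<Rightarrow> (nat \<Rightarrow> 'k::field_char_0 mpoly) \<Rightarrow> nat \<Rightarrow> 'k bar \<Rightarrow> 'k bar" where
  "bar_diff N \<alpha> j \<Phi> =
     (\<lambda>w. ext_deriv (\<Phi> w) + (\<Sum>i<N. form_scale ((-1) ^ j) (wedge (\<Phi> (i # w)) (dlog (\<alpha> i)))))"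


section \<open>Cohomology\<close>

definition cocycles ::
    "nat \<Rightarrow> nat \<Rightarrow> (nat \<Rightarrow> 'k::field_char_0 mpoly) \<Rightarrow> nat \<Rightarrow> 'k bar set" where
  "cocycles n N \<alpha> i = {\<Phi> \<in> bar_forms n N \<alpha> i. bar_diff N \<alpha> i \<Phi> = 0}"

definition coboundaries ::
    "nat \<Rightarrow> nat \<Rightarrow> (nat \<Rightarrow> 'k::field_char_0 mpoly) \<Rightarrow> nat \<Rightarrow> 'k bar set" where
  "coboundaries n N \<alpha> i =
     (case i of 0 \<Rightarrow> {0} | Suc j \<Rightarrow> bar_diff N \<alpha> j ` bar_forms n N \<alpha> j)"

definition coset :: "'b::plus set \<Rightarrow> 'b \<Rightarrow> 'b set" where
  "coset B z = {z + b | b. b \<in> B}"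

definition cohomology ::
    "nat \<Rightarrow> nat \<Rightarrow> (nat \<Rightarrow> 'k::field_char_0 mpoly) \<Rightarrow> nat \<Rightarrow> 'k bar set set" where
  "cohomology n N \<alpha> i = coset (coboundaries n N \<alpha> i) ` cocycles n N \<alpha> i"

definition bar_scale :: "'k::field_char_0 \<Rightarrow> 'k bar \<Rightarrow> 'k bar" where
  "bar_scale c \<Phi> = (\<lambda>w. form_scale (const_rat c) (\<Phi> w))"

text \<open>The vector space operations on cosets modulo \<open>B\<close>. Adding \<open>B\<close> in the scalar
  multiplication matters for the scalar 0 only.\<close>

definition coset_add :: "'b::plus set \<Rightarrow> 'b set \<Rightarrow> 'b set" where
  "coset_add X Y = {x + y | x y. x \<in> X \<and> y \<in> Y}"

definition coset_scale ::
    "'k::field_char_0 bar set \<Rightarrow> 'k \<Rightarrow> 'k bar set \<Rightarrow> 'k bar set" where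
  "coset_scale B c X = {bar_scale c x + b | x b. x \<in> X \<and> b \<in> B}"

definition cohomology_iso_field ::
    "nat \<Rightarrow> nat \<Rightarrow> (nat \<Rightarrow> 'k::field_char_0 mpoly) \<Rightarrow> nat \<Rightarrow> bool" where
  "cohomology_iso_field n N \<alpha> i \<longleftrightarrow>
     (\<exists>\<theta> :: 'k \<Rightarrow> 'k bar set. bij_betw \<theta> UNIV (cohomology n N \<alpha> i) \<and>
        (\<forall>a b. \<theta> (a + b) = coset_add (\<theta> a) (\<theta> b)) \<and>
        (\<forall>c a. \<theta> (c * a) = coset_scale (coboundaries n N \<alpha> i) c (\<theta> a)))"

end

theory Submission
  imports Defs "HOL-Computational_Algebra.Polynomial"
begin

text \<open>Choose linear coordinates \<open>y\<^sub>0, \<dots>, y\<^bsub>l-1\<^esub>\<close> adapted to the tower of fibrations, and let \<open>B\<^sub>r\<close> be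
  the bar construction of the \<open>r\<close>-dimensional base. The differential of \<open>B(M)\<close> is the de Rham
  differential of a flat connection on \<open>B(M)\<close>, with commuting covariant derivatives
  \<open>D\<^sub>0, \<dots>, D\<^bsub>l-1\<^esub>\<close>. For every \<open>r\<close> the operator \<open>D\<^sub>r\<close> is surjective on \<open>B\<^bsub>r+1\<^esub>\<close> with kernel \<open>B\<^sub>r\<close>, so
  the usual proof of the Poincare lemma (integrate out \<open>y\<^bsub>l-1\<^esub>\<close>, then \<open>y\<^bsub>l-2\<^esub>\<close>, \<dots>) reduces the
  cohomology to that of \<open>B\<^sub>0 = k\<close>.

  The kernel is found by comparing residues along the fibres. For surjectivity, partial fractions in
  \<open>y\<^sub>r\<close> (which exist because \<open>1/(f\<^sub>i - f\<^sub>j)\<close> is regular on the base) reduce the problem to primitives of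
  \<open>(y\<^sub>r - f\<^sub>a)\<^sup>-\<^sup>1 \<otimes> v\<close> with \<open>v\<close> integrable, that is, to an integrable \<open>v'\<close> whose derivative with respect
  to the letter \<open>a\<close> is \<open>v\<close> and whose other horizontal derivatives vanish. The Arnold relations
  \<open>\<omega>\<^sub>a \<and> \<omega>\<^sub>b = dlog (f\<^sub>a - f\<^sub>b) \<and> (\<omega>\<^sub>b - \<omega>\<^sub>a)\<close> provide \<open>v'\<close> by induction on the length.\<close>

section \<open>A derivation and its field of constants\<close>

text \<open>The descent to the base has to respect integrability as well as the coefficient ring.
  The device for this is that 1 and the functions \<open>1 / (y_r - f_a)\<close> are linearly
  independent over everything that is constant along the fibres: an integrability relation is
  brought to a form with at most simple poles and then read off coefficient by coefficient. The
  regularity of \<open>1 / (f_a - f_b)\<close> is sharpened beforehand: an affine-linear unit of the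
  base ring is a constant or a constant multiple of the equation of one base hyperplane. This form
  gives Arnold relations with coefficients in \<open>k\<close>, which word functions with values in
  \<open>k\<close> can absorb. Elements of the bar construction have values in a function field
  instead; \<open>k\<close>-linear functionals carry facts about word functions over to them.
  Finally, the adapted coordinates are linear, so their frame is constant, and contraction commutes
  with every \<open>k\<close>-linear operator on coefficients. Hence the homotopy of the Poincare
  lemma can use any \<open>k\<close>-linear section of \<open>D r\<close>.\<close>

locale slice_derivation =
  fixes d :: "'f::field_char_0 \<Rightarrow> 'f" and y :: 'f
  assumes d_add: "d (a + b) = d a + d b"
    and d_mult: "d (a * b) = d a * b + a * d b"
    and d_y: "d y = 1"
begin

lemma d_0 [simp]: "d 0 = 0"
  using d_add[of 0 0] by simp

lemma d_1 [simp]: "d 1 = 0"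
  using d_mult[of 1 1] by simp

lemma d_minus: "d (- a) = - d a"
  using d_add[of a "- a"] by (simp add: eq_neg_iff_add_eq_0 add.commute)

lemma d_diff: "d (a - b) = d a - d b"
  using d_add[of a "- b"] by (simp add: d_minus)

lemma d_sum: "d (sum f A) = (\<Sum>a\<in>A. d (f a))"
  by (induction A rule: infinite_finite_induct) (auto simp: d_add)

lemma d_inverse: "d (inverse a) = - d a * inverse a ^ 2"
proof (cases "a = 0")
  case False
  have "d a * inverse a + a * d (inverse a) = 0"
    using d_mult[of a "inverse a"] False by simp
  then have "a * d (inverse a) = - (d a * inverse a)"
    by (simp add: eq_neg_iff_add_eq_0 add.commute)
  with False show ?thesis
    by (simp add: field_simps power2_eq_square)
qed simp

lemma d_of_nat [simp]: "d (of_nat n) = 0"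
  by (induction n) (auto simp: d_add)

lemma d_power: "d (a ^ n) = of_nat n * a ^ (n - 1) * d a"
proof (induction n)
  case (Suc n)
  then show ?case
    by (cases n) (auto simp: d_mult algebra_simps)
qed simp

section \<open>Polynomials in \<open>y\<close> over the constants of \<open>d\<close>\<close>

definition const_poly :: "'f poly \<Rightarrow> bool" where
  "const_poly p \<longleftrightarrow> (\<forall>i. d (coeff p i) = 0)"

lemma const_poly_add: "const_poly p \<Longrightarrow> const_poly q \<Longrightarrow> const_poly (p + q)"
  by (simp add: const_poly_def d_add)

lemma const_poly_diff: "const_poly p \<Longrightarrow> const_poly q \<Longrightarrow> const_poly (p - q)"
  by (simp add: const_poly_def d_diff)

lemma const_poly_mult: "const_poly p \<Longrightarrow> const_poly q \<Longrightarrow> const_poly (p * q)"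
  by (simp add: const_poly_def coeff_mult d_sum d_mult)

lemma const_poly_smult: "d c = 0 \<Longrightarrow> const_poly p \<Longrightarrow> const_poly (smult c p)"
  by (simp add: const_poly_def d_mult)

lemma const_poly_pCons: "const_poly (pCons a p) \<longleftrightarrow> d a = 0 \<and> const_poly p"
  by (auto simp: const_poly_def coeff_pCons split: nat.splits)

lemma const_poly_0 [simp]: "const_poly 0"
  by (simp add: const_poly_def)

lemma const_poly_1 [simp]: "const_poly 1"
  by (simp add: one_pCons const_poly_pCons)

lemma d_poly: "const_poly p \<Longrightarrow> d (poly p y) = poly (pderiv p) y"
  by (induction p) (auto simp: const_poly_pCons pderiv_pCons d_add d_mult d_y)

text \<open>Differentiating an algebraic equation for \<open>y\<close> lowers its degree.\<close>

lemma transcendental: "const_poly p \<Longrightarrow> poly p y = 0 \<Longrightarrow> p = 0"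
proof (induction "degree p" arbitrary: p rule: less_induct)
  case less
  have "pderiv p = 0"
  proof (cases "degree p = 0")
    case True
    then show ?thesis by (simp add: pderiv_eq_0_iff)
  next
    case False
    moreover have "const_poly (pderiv p)"
      using less.prems(1) by (simp add: const_poly_def coeff_pderiv d_mult d_add)
    moreover have "poly (pderiv p) y = 0"
      using d_poly[OF less.prems(1)] less.prems(2) by simp
    ultimately show ?thesis
      by (intro less.hyps) (simp_all add: degree_pderiv)
  qed
  then obtain c where "p = [:c:]"
    by (metis pderiv_eq_0_iff degree_eq_zeroE)
  with less.prems show ?case by simp
qed

text \<open>Models the local ring of the line at \<open>y = a\<close> over the constants of
  \<open>d\<close>. It is only a subring, with poles at constants different from \<open>a\<close>;
  this already contains what remains of a function on the fibre once its pole at \<open>a\<close> is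
  cleared.\<close>

inductive_set local_ring :: "'f \<Rightarrow> 'f set" for a :: 'f where
  const: "d c = 0 \<Longrightarrow> c \<in> local_ring a"
| var: "y \<in> local_ring a"
| inv: "d b = 0 \<Longrightarrow> b \<noteq> a \<Longrightarrow> inverse (y - b) \<in> local_ring a"
| add: "u \<in> local_ring a \<Longrightarrow> v \<in> local_ring a \<Longrightarrow> u + v \<in> local_ring a"
| mult: "u \<in> local_ring a \<Longrightarrow> v \<in> local_ring a \<Longrightarrow> u * v \<in> local_ring a"

lemma y_minus_nz: "d b = 0 \<Longrightarrow> y - b \<noteq> 0"
  by (metis d_y eq_iff_diff_eq_0 zero_neq_one)

lemma local_ring_minus: "u \<in> local_ring a \<Longrightarrow> - u \<in> local_ring a"
  using local_ring.mult[OF local_ring.const[of "-1"], of u a] by (simp add: d_minus)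

lemma local_ring_d: "u \<in> local_ring a \<Longrightarrow> d u \<in> local_ring a"
proof (induction rule: local_ring.induct)
  case (inv b)
  then have "inverse (y - b) * inverse (y - b) \<in> local_ring a"
    by (intro local_ring.intros)
  from local_ring_minus[OF this] show ?case
    using inv by (simp add: d_inverse d_diff d_y power2_eq_square)
qed (auto simp: d_y d_add d_mult intro: local_ring.intros)

text \<open>First-order Taylor expansion at \<open>a\<close>. The value \<open>c\<close> is again a
  constant of \<open>d\<close>; for a pole at \<open>b\<close> it is
  \<open>1 / (a - b)\<close>.\<close>

lemma local_ring_expand:
  assumes a: "d a = 0" and "u \<in> local_ring a"
  shows "\<exists>c v. d c = 0 \<and> v \<in> local_ring a \<and> u = c + (y - a) * v"
  using assms(2)
proof (induction rule: local_ring.induct)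
  case (const c)
  then show ?case
    by - (rule exI[of _ c], rule exI[of _ 0], auto intro: local_ring.const)
next
  case var
  show ?case
    by - (rule exI[of _ a], rule exI[of _ 1], auto intro: local_ring.const simp: a)
next
  case (inv b)
  have nz: "y - b \<noteq> 0" "a - b \<noteq> 0"
    using y_minus_nz inv by auto
  have c: "d (inverse (a - b)) = 0"
    using inv a by (simp add: d_inverse d_diff)
  have "- (inverse (a - b) * inverse (y - b)) \<in> local_ring a"
    using inv c by (intro local_ring_minus local_ring.intros)
  moreover have "inverse (y - b) = inverse (a - b) + (y - a) * (- (inverse (a - b) * inverse (y - b)))"
  proof -
    have "inverse p = inverse q + (p - q) * (- (inverse q * inverse p))" if "p \<noteq> 0" "q \<noteq> 0"
      for p q :: 'f
      using that by (simp add: field_simps)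
    from this[OF nz] show ?thesis by simp
  qed
  ultimately show ?case using c by blast
next
  case (add u v)
  then obtain c u' e v' where *: "d c = 0" "u' \<in> local_ring a" "u = c + (y - a) * u'"
      "d e = 0" "v' \<in> local_ring a" "v = e + (y - a) * v'"
    by blast
  have "u + v = (c + e) + (y - a) * (u' + v')"
    unfolding *(3,6) by (simp add: algebra_simps)
  moreover have "u' + v' \<in> local_ring a" "d (c + e) = 0"
    using * by (auto simp: d_add intro: local_ring.intros)
  ultimately show ?case by blast
next
  case (mult u v)
  then obtain c u' e v' where *: "d c = 0" "u' \<in> local_ring a" "u = c + (y - a) * u'"
      "d e = 0" "v' \<in> local_ring a" "v = e + (y - a) * v'"
    by blast
  have "c * v' + u' * v \<in> local_ring a"
    using * mult by (auto intro: local_ring.intros)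
  moreover have "u * v = c * e + (y - a) * (c * v' + u' * v)"
    unfolding *(3,6) by (simp add: algebra_simps)
  ultimately show ?case
    using * by - (rule exI[of _ "c * e"], rule exI[of _ "c * v' + u' * v"], simp add: d_mult)
qed

text \<open>The denominators are products of factors \<open>y - b\<close> with \<open>b\<close>
  different from \<open>a\<close>, hence nonzero at \<open>a\<close>. The polynomial form makes the
  transcendence of \<open>y\<close> applicable.\<close>

lemma local_ring_quotient:
  "u \<in> local_ring a \<Longrightarrow>
     \<exists>p q. const_poly p \<and> const_poly q \<and> poly q a \<noteq> 0 \<and> u * poly q y = poly p y"
proof (induction rule: local_ring.induct)
  case (const c)
  then show ?case
    by - (rule exI[of _ "[:c:]"], rule exI[of _ 1], auto simp: const_poly_pCons)
next
  case var
  show ?case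
    by - (rule exI[of _ "[:0, 1:]"], rule exI[of _ 1], auto simp: const_poly_pCons)
next
  case (inv b)
  then show ?case
    using y_minus_nz[of b]
    by - (rule exI[of _ 1], rule exI[of _ "[:- b, 1:]"], auto simp: const_poly_pCons d_minus)
next
  case (add u v)
  then obtain p q p' q' where *: "const_poly p" "const_poly q" "poly q a \<noteq> 0"
      "u * poly q y = poly p y" "const_poly p'" "const_poly q'" "poly q' a \<noteq> 0"
      "v * poly q' y = poly p' y"
    by blast
  have "(u + v) * poly (q * q') y = poly (p * q' + p' * q) y"
    by (simp add: *(4,8)[symmetric] algebra_simps)
  with * show ?case
    by - (rule exI[of _ "p * q' + p' * q"], rule exI[of _ "q * q'"], auto intro: const_poly_add const_poly_mult)
next
  case (mult u v)
  then obtain p q p' q' where *: "const_poly p" "const_poly q" "poly q a \<noteq> 0"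
      "u * poly q y = poly p y" "const_poly p'" "const_poly q'" "poly q' a \<noteq> 0"
      "v * poly q' y = poly p' y"
    by blast
  have "(u * v) * poly (q * q') y = poly (p * p') y"
    by (simp add: *(4,8)[symmetric] algebra_simps)
  with * show ?case
    by - (rule exI[of _ "p * p'"], rule exI[of _ "q * q'"], auto intro: const_poly_mult)
qed

text \<open>Clearing denominators gives \<open>c * q(y) = (y - a) * p(y)\<close>, a polynomial
  identity because \<open>y\<close> is transcendental over the constants; at \<open>y = a\<close>
  the right side vanishes and \<open>q\<close> does not.\<close>

lemma local_ring_maximal_ideal:
  assumes "d a = 0" "d c = 0" "u \<in> local_ring a" "c = (y - a) * u"
  shows "c = 0"
proof -
  obtain p q where *: "const_poly p" "const_poly q" "poly q a \<noteq> 0" "u * poly q y = poly p y"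
    using local_ring_quotient assms(3) by blast
  have "poly (smult c q - [:- a, 1:] * p) y = 0"
    by (simp add: *(4)[symmetric] assms(4) algebra_simps)
  then have "smult c q - [:- a, 1:] * p = 0"
    using assms * by (intro transcendental const_poly_diff const_poly_smult const_poly_mult)
      (auto simp: const_poly_pCons d_minus)
  then have "poly (smult c q - [:- a, 1:] * p) a = 0"
    by simp
  with * show ?thesis by simp
qed

text \<open>Exact forms have no residues: if \<open>u\<close> has a pole of order \<open>n > 0\<close> at \<open>a\<close>, then
  \<open>d u\<close> has one of order \<open>n + 1\<close>.\<close>

lemma residue_of_exact:
  assumes a: "d a = 0" and g: "d g = 0"
    and "u \<in> local_ring a" "v \<in> local_ring a"
    and "d (u * inverse (y - a) ^ n) + g * inverse (y - a) + v = 0"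
  shows "g = 0"
  using assms(3,5)
proof (induction n arbitrary: u)
  case 0
  define t where "t = y - a"
  have t: "t \<noteq> 0" "d t = 1"
    using y_minus_nz[OF a] by (auto simp: t_def d_diff d_y a)
  have "g * inverse t = - (d u + v)"
    using 0(2) by (simp add: t_def eq_neg_iff_add_eq_0 algebra_simps)
  then have "g = t * - (d u + v)"
    using t by (simp add: field_simps)
  moreover have "- (d u + v) \<in> local_ring a"
    using 0 assms(4) by (intro local_ring_minus local_ring.add local_ring_d)
  ultimately show ?case
    unfolding t_def using local_ring_maximal_ideal a g by blast
next
  case (Suc n)
  define t where "t = y - a"
  have t: "t \<noteq> 0" "d t = 1"
    using y_minus_nz[OF a] by (auto simp: t_def d_diff d_y a)
  have tR: "t \<in> local_ring a" "t ^ k \<in> local_ring a" for k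
  proof -
    show "t \<in> local_ring a"
      using local_ring.add[OF local_ring.var local_ring.const[of "- a"]] a
      by (simp add: t_def d_minus)
    then show "t ^ k \<in> local_ring a"
      by (induction k) (auto intro: local_ring.intros)
  qed
  obtain c u' where c: "d c = 0" "u' \<in> local_ring a" "u = c + t * u'"
    using local_ring_expand[OF a Suc.prems(1)] unfolding t_def by blast
  have "d (inverse t ^ Suc n) = - of_nat (Suc n) * inverse t ^ (n + 2)"
    unfolding d_power d_inverse t(2) by (simp add: power2_eq_square algebra_simps)
  then have "(d u * inverse t ^ Suc n - of_nat (Suc n) * u * inverse t ^ (n + 2))
          + g * inverse t + v = 0"
    using Suc.prems(2) by (simp add: t_def[symmetric] d_mult algebra_simps del: of_nat_Suc power_Suc)
  \<comment> \<open>Clearing the poles leaves an equation in the local ring. Modulo \<open>t\<close>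
    only the leading coefficient \<open>c\<close> of the pole survives, with a factor
    \<open>n + 1\<close> up to sign, which is nonzero in characteristic 0.\<close>
  then have "t ^ (n + 2) * ((d u * inverse t ^ Suc n - of_nat (Suc n) * u * inverse t ^ (n + 2))
          + g * inverse t + v) = 0"
    by simp
  then have "t * d u - of_nat (Suc n) * u + g * t ^ Suc n + v * t ^ (n + 2) = 0"
    using t by (simp add: algebra_simps power_inverse[symmetric]) (simp add: field_simps)
  then have "of_nat (Suc n) * c = t * (d u - of_nat (Suc n) * u' + g * t ^ n + v * t ^ (n + 1))"
    unfolding c(3) by (simp add: algebra_simps)
  moreover have "d u - of_nat (Suc n) * u' + g * t ^ n + v * t ^ (n + 1) \<in> local_ring a"
    unfolding diff_conv_add_uminus using c tR g assms(4) Suc.prems(1)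
    by (intro local_ring.add local_ring_minus local_ring_d local_ring.mult)
      (auto simp del: power_Suc of_nat_Suc intro: local_ring.const)
  ultimately have "of_nat (Suc n) * c = 0"
    unfolding t_def using a c local_ring_maximal_ideal by (metis d_mult d_of_nat mult_zero_left mult_zero_right add_0)
  then have "c = 0"
    by (simp del: of_nat_Suc)
  \<comment> \<open>With \<open>c = 0\<close> the pole order drops by one, and the induction
    hypothesis applies.\<close>
  then have eq: "u * inverse t ^ Suc n = u' * inverse t ^ n"
    using c t by (simp add: field_simps)
  show ?case
    using Suc.IH[OF c(2)] Suc.prems(2) unfolding t_def[symmetric] eq by blast
qed

end

section \<open>Towers of linear fibrations\<close>

text \<open>The field \<open>'f\<close> plays the role of the rational functions, \<open>y\<^sub>0, \<dots>, y\<^bsub>l-1\<^esub>\<close> of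
  linear coordinates adapted to the fibrations, \<open>del\<close> of the dual derivations. The hyperplane
  with index \<open>a\<close> is \<open>y\<^sub>r = f\<^sub>a\<close> with \<open>r = lev a\<close>; it is horizontal for the fibration with fibre
  coordinate \<open>y\<^sub>r\<close> and vertical for those with fibre coordinate \<open>y\<^sub>s\<close>, \<open>s > r\<close>.\<close>

locale fiber_tower =
  fixes \<kappa> :: "'k::field_char_0 \<Rightarrow> 'f::field_char_0" and l N :: nat
    and del :: "nat \<Rightarrow> 'f \<Rightarrow> 'f" and y :: "nat \<Rightarrow> 'f" and lev :: "nat \<Rightarrow> nat"
    and f :: "nat \<Rightarrow> 'f" and c0 :: "nat \<Rightarrow> 'k" and g :: "nat \<Rightarrow> nat \<Rightarrow> 'k"
  assumes \<kappa>_1 [simp]: "\<kappa> 1 = 1"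
    and \<kappa>_add: "\<kappa> (c + e) = \<kappa> c + \<kappa> e"
    and \<kappa>_mult: "\<kappa> (c * e) = \<kappa> c * \<kappa> e"
    and del_add: "del s (u + v) = del s u + del s v"
    and del_mult: "del s (u * v) = del s u * v + u * del s v"
    and del_\<kappa> [simp]: "del s (\<kappa> c) = 0"
    and del_y: "s < l \<Longrightarrow> t < l \<Longrightarrow> del s (y t) = (if s = t then 1 else 0)"
    and lev: "a < N \<Longrightarrow> lev a < l"
    and f_eq: "a < N \<Longrightarrow> f a = \<kappa> (c0 a) + (\<Sum>t<lev a. \<kappa> (g a t) * y t)"
    and same_level: "a < N \<Longrightarrow> b < N \<Longrightarrow> a \<noteq> b \<Longrightarrow> lev a = lev b \<Longrightarrow>
      \<exists>c. c \<noteq> 0 \<and> (f a - f b = \<kappa> c \<or>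
        (\<exists>h<N. lev h < lev a \<and> f a - f b = \<kappa> c * (y (lev h) - f h)))"
begin

lemma \<kappa>_0 [simp]: "\<kappa> 0 = 0"
  using \<kappa>_add[of 0 0] by simp

lemma \<kappa>_minus: "\<kappa> (- a) = - \<kappa> a"
  using \<kappa>_add[of a "- a"] by (simp add: eq_neg_iff_add_eq_0 add.commute)

lemma \<kappa>_diff: "\<kappa> (a - b) = \<kappa> a - \<kappa> b"
  using \<kappa>_add[of a "- b"] by (simp add: \<kappa>_minus)

lemma \<kappa>_sum: "\<kappa> (sum h A) = (\<Sum>a\<in>A. \<kappa> (h a))"
  by (induction A rule: infinite_finite_induct) (auto simp: \<kappa>_add)

lemma \<kappa>_eq_0_iff [simp]: "\<kappa> c = 0 \<longleftrightarrow> c = 0"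
proof
  assume "\<kappa> c = 0"
  then have "c \<noteq> 0 \<Longrightarrow> \<kappa> (c * inverse c) = 0"
    by (simp only: \<kappa>_mult) simp
  then show "c = 0" by force
qed simp

lemma \<kappa>_inverse: "\<kappa> (inverse c) = inverse (\<kappa> c)"
proof (cases "c = 0")
  case False
  then have "\<kappa> c * \<kappa> (inverse c) = 1"
    by (simp add: \<kappa>_mult[symmetric])
  then show ?thesis by (metis inverse_unique)
qed simp

lemma \<kappa>_of_nat: "\<kappa> (of_nat n) = of_nat n"
  by (induction n) (auto simp: \<kappa>_add)

lemma slice: "r < l \<Longrightarrow> slice_derivation (del r) (y r)"
  by standard (auto simp: del_add del_mult del_y)

lemma del_0 [simp]: "del s 0 = 0"
  using del_\<kappa>[of s 0] by simp

lemma del_1 [simp]: "del s 1 = 0"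
  using del_\<kappa>[of s 1] by simp

lemma del_minus: "del s (- u) = - del s u"
  using del_add[of s u "- u"] by (simp add: eq_neg_iff_add_eq_0 add.commute)

lemma del_diff: "del s (u - v) = del s u - del s v"
  using del_add[of s u "- v"] by (simp add: del_minus)

lemma del_sum: "del s (sum h A) = (\<Sum>a\<in>A. del s (h a))"
  by (induction A rule: infinite_finite_induct) (auto simp: del_add)

lemma del_inverse: "r < l \<Longrightarrow> del r (inverse u) = - del r u * inverse u ^ 2"
  using slice_derivation.d_inverse[OF slice] .

section \<open>Normalised equations and the coordinate rings of the bases\<close>

definition A :: "nat \<Rightarrow> 'f" where
  "A a = y (lev a) - f a"

lemma del_f: "a < N \<Longrightarrow> s < l \<Longrightarrow> del s (f a) = (if s < lev a then \<kappa> (g a s) else 0)"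
proof -
  assume a: "a < N" "s < l"
  have "del s (f a) = (\<Sum>t<lev a. \<kappa> (g a t) * (if s = t then 1 else 0))"
    unfolding f_eq[OF a(1)] del_add del_sum del_mult
    using a lev[OF a(1)] by (auto simp: del_y intro!: sum.cong)
  also have "\<dots> = (\<Sum>t<lev a. if t = s then \<kappa> (g a s) else 0)"
    by (rule sum.cong) auto
  also have "\<dots> = (if s < lev a then \<kappa> (g a s) else 0)"
    by simp
  finally show ?thesis .
qed

lemma del_A: "a < N \<Longrightarrow> s < l \<Longrightarrow>
    del s (A a) = (if s = lev a then 1 else if s < lev a then - \<kappa> (g a s) else 0)"
  unfolding A_def del_diff using lev[of a] by (auto simp: del_f del_y)

lemma A_nz: "a < N \<Longrightarrow> A a \<noteq> 0"
  using del_A[of a "lev a"] lev[of a] by force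

lemma f_neq: "a < N \<Longrightarrow> b < N \<Longrightarrow> a \<noteq> b \<Longrightarrow> lev a = lev b \<Longrightarrow> f a \<noteq> f b"
  using same_level[of a b] A_nz by (auto simp: A_def)

text \<open>The component of \<open>dlog (A a)\<close> along the frame vector dual to
  \<open>y s\<close>.\<close>

definition om :: "nat \<Rightarrow> nat \<Rightarrow> 'f" where
  "om s a = del s (A a) * inverse (A a)"

lemma om_high: "a < N \<Longrightarrow> s < l \<Longrightarrow> lev a < s \<Longrightarrow> om s a = 0"
  by (simp add: om_def del_A)

lemma om_lev: "a < N \<Longrightarrow> om (lev a) a = inverse (A a)"
  by (simp add: om_def del_A lev)

text \<open>The coordinate ring of the \<open>r\<close>-dimensional base. All bases share one field,
  so pulling back along a fibration is an inclusion.\<close>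

inductive_set \<O> :: "nat \<Rightarrow> 'f set" for r :: nat where
  const: "\<kappa> c \<in> \<O> r"
| var: "t < r \<Longrightarrow> y t \<in> \<O> r"
| inv: "a < N \<Longrightarrow> lev a < r \<Longrightarrow> inverse (A a) \<in> \<O> r"
| add: "u \<in> \<O> r \<Longrightarrow> v \<in> \<O> r \<Longrightarrow> u + v \<in> \<O> r"
| mult: "u \<in> \<O> r \<Longrightarrow> v \<in> \<O> r \<Longrightarrow> u * v \<in> \<O> r"

lemma \<O>_mono: "r \<le> r' \<Longrightarrow> \<O> r \<subseteq> \<O> r'"
proof
  show "u \<in> \<O> r'" if "r \<le> r'" "u \<in> \<O> r" for u
    using that(2) by induction (use that(1) in \<open>auto intro: \<O>.intros\<close>)
qed

lemma \<O>_Suc: "u \<in> \<O> r \<Longrightarrow> u \<in> \<O> (Suc r)"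
  using \<O>_mono[of r "Suc r"] by auto

lemma \<O>_0 [simp]: "0 \<in> \<O> r" and \<O>_1 [simp]: "1 \<in> \<O> r"
  using \<O>.const[of 0 r] \<O>.const[of 1 r] by simp_all

lemma \<O>_minus: "u \<in> \<O> r \<Longrightarrow> - u \<in> \<O> r"
  using \<O>.mult[OF \<O>.const[of "-1"]] by (fastforce simp: \<kappa>_minus)

lemma \<O>_sum: "(\<And>a. a \<in> S \<Longrightarrow> h a \<in> \<O> r) \<Longrightarrow> sum h S \<in> \<O> r"
  by (induction S rule: infinite_finite_induct) (auto intro: \<O>.add)

lemma \<O>_power: "u \<in> \<O> r \<Longrightarrow> u ^ n \<in> \<O> r"
  by (induction n) (auto intro: \<O>.mult)

lemma \<O>_subset_consts: "u \<in> \<O> r \<Longrightarrow> r \<le> s \<Longrightarrow> s < l \<Longrightarrow> del s u = 0"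
  by (induction rule: \<O>.induct) (auto simp: del_y del_inverse del_A del_add del_mult)

lemma \<O>_del: "u \<in> \<O> r \<Longrightarrow> r \<le> l \<Longrightarrow> s < l \<Longrightarrow> del s u \<in> \<O> r"
proof (induction rule: \<O>.induct)
  case (inv a)
  have "\<exists>c. del s (A a) = \<kappa> c"
    using del_A[OF inv(1,4)] by (metis \<kappa>_0 \<kappa>_1 \<kappa>_minus)
  then show ?case
    using inv by (auto simp: del_inverse power2_eq_square intro!: \<O>_minus \<O>.mult \<O>.const \<O>.inv)
qed (auto simp: del_y del_add del_mult intro: \<O>.intros)

lemma om_\<O>: "r \<le> l \<Longrightarrow> a < N \<Longrightarrow> lev a < r \<Longrightarrow> s < l \<Longrightarrow> om s a \<in> \<O> r"
proof -
  assume a: "r \<le> l" "a < N" "lev a < r" "s < l"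
  have "\<exists>c. del s (A a) = \<kappa> c"
    using del_A[OF a(2,4)] by (metis \<kappa>_0 \<kappa>_1 \<kappa>_minus)
  then show ?thesis
    using a by (auto simp: om_def intro!: \<O>.mult \<O>.const \<O>.inv)
qed

lemma f_\<O>: "a < N \<Longrightarrow> lev a \<le> r \<Longrightarrow> f a \<in> \<O> r"
  by (auto simp: f_eq intro!: \<O>.add \<O>_sum \<O>.mult \<O>.const \<O>.var)

lemma inverse_f_diff:
  assumes "a < N" "b < N" "a \<noteq> b" "lev a = lev b"
  shows "inverse (f a - f b) \<in> \<O> (lev a)"
proof -
  obtain c where c: "c \<noteq> 0" "f a - f b = \<kappa> c \<or>
      (\<exists>h<N. lev h < lev a \<and> f a - f b = \<kappa> c * A h)"
    using same_level[OF assms] unfolding A_def by blast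
  then show ?thesis
    by (auto simp: \<kappa>_inverse[symmetric] intro!: \<O>.mult \<O>.const \<O>.inv)
qed

subsection \<open>Partial fractions in the fibre coordinate\<close>

text \<open>The \<open>\<O> r\<close>-span of the powers of \<open>y r\<close> and of the inverse
  powers of the horizontal equations. It contains all of \<open>\<O> (Suc r)\<close>, because it
  contains 1 and is stable under multiplication by each generator.\<close>

inductive_set pfrac :: "nat \<Rightarrow> 'f set" for r :: nat where
  zero: "0 \<in> pfrac r"
| var: "h \<in> \<O> r \<Longrightarrow> h * y r ^ n \<in> pfrac r"
| inv: "h \<in> \<O> r \<Longrightarrow> a < N \<Longrightarrow> lev a = r \<Longrightarrow> h * inverse (A a) ^ n \<in> pfrac r"
| add: "u \<in> pfrac r \<Longrightarrow> v \<in> pfrac r \<Longrightarrow> u + v \<in> pfrac r"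

lemma pfrac_scale: "u \<in> pfrac r \<Longrightarrow> h \<in> \<O> r \<Longrightarrow> h * u \<in> pfrac r"
proof (induction rule: pfrac.induct)
  case (var h' n)
  then show ?case using pfrac.var[of "h * h'" r n] by (simp add: \<O>.mult mult.assoc)
next
  case (inv h' a n)
  then show ?case using pfrac.inv[of "h * h'" r a n] by (simp add: \<O>.mult mult.assoc)
qed (auto simp: distrib_left intro: pfrac.intros)

lemma pfrac_var: "u \<in> pfrac r \<Longrightarrow> y r * u \<in> pfrac r"
proof (induction rule: pfrac.induct)
  case (var h n)
  then show ?case using pfrac.var[of h r "Suc n"] by (simp add: mult.left_commute)
next
  case (inv h a n)
  show ?case
  proof (cases n)
    case 0
    then show ?thesis using pfrac.var[of h r 1] inv by (simp add: mult.commute)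
  next
    case (Suc m)
    have y: "y r = A a + f a" using inv by (simp add: A_def)
    have "y r * (h * inverse (A a) ^ n) =
        h * inverse (A a) ^ m + (f a * h) * inverse (A a) ^ n"
      using A_nz[OF inv(2)] by (simp add: y Suc distrib_right)
    then show ?thesis
      using inv by (auto intro!: pfrac.intros \<O>.mult f_\<O>)
  qed
qed (auto simp: distrib_left intro: pfrac.intros)

text \<open>A product of poles at different \<open>a\<close> and \<open>b\<close> is split by
  \<open>1 / (A a * A b) = e * (1 / A a - 1 / A b)\<close> with \<open>e = 1 / (f a - f b)\<close>,
  which lies in \<open>\<O> r\<close> by \<open>inverse_f_diff\<close>. Induction on the exponent
  reduces every power to this case.\<close>

lemma pfrac_inv: "u \<in> pfrac r \<Longrightarrow> b < N \<Longrightarrow> lev b = r \<Longrightarrow> inverse (A b) * u \<in> pfrac r"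
proof (induction rule: pfrac.induct)
  case (var h n)
  have "inverse (A b) * y r ^ n \<in> pfrac r"
  proof (induction n)
    case 0
    then show ?case using pfrac.inv[of 1 r b 1] var by simp
  next
    case (Suc n)
    have "y r = A b + f b" using var by (simp add: A_def)
    then have "inverse (A b) * y r ^ Suc n = 1 * y r ^ n + f b * (inverse (A b) * y r ^ n)"
      using A_nz[OF var(2)] by (simp add: distrib_left distrib_right field_simps)
    also have "\<dots> \<in> pfrac r"
      by (intro pfrac.add pfrac.var pfrac_scale Suc f_\<O>) (use var in auto)
    finally show ?case .
  qed
  from pfrac_scale[OF this var(1)] show ?case
    by (simp add: mult.left_commute)
next
  case (inv h a n)
  have "inverse (A b) * inverse (A a) ^ n \<in> pfrac r"
  proof (cases "a = b")
    case True
    then show ?thesis using pfrac.inv[of 1 r b "Suc n"] inv by simp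
  next
    case False
    define e where "e = inverse (f a - f b)"
    have e: "e \<in> \<O> r"
      using inverse_f_diff[of a b] inv False by (simp add: e_def)
    have nz: "A a \<noteq> 0" "A b \<noteq> 0" "f a - f b \<noteq> 0"
      using A_nz f_neq[of a b] inv False by auto
    have "A b = A a + (f a - f b)"
      using inv by (simp add: A_def)
    then have *: "inverse (A b) * inverse (A a) = e * (inverse (A a) - inverse (A b))"
      unfolding e_def using nz by (simp add: divide_simps)
    show ?thesis
    proof (induction n)
      case 0
      then show ?case using pfrac.inv[of 1 r b 1] inv by simp
    next
      case (Suc n)
      have "inverse (A b) * inverse (A a) ^ Suc n =
          (inverse (A b) * inverse (A a)) * inverse (A a) ^ n" by simp
      also have "\<dots> = e * inverse (A a) ^ Suc n + (- e) * (inverse (A b) * inverse (A a) ^ n)"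
        unfolding * by (simp add: algebra_simps)
      also have "\<dots> \<in> pfrac r"
        by (intro pfrac.add pfrac.inv pfrac_scale[OF Suc] \<O>_minus e inv)
      finally show ?case .
    qed
  qed
  from pfrac_scale[OF this inv(1)] show ?case
    by (simp add: mult.left_commute)
qed (auto simp: distrib_left intro: pfrac.intros)

lemma pfrac_mult: "u \<in> \<O> (Suc r) \<Longrightarrow> v \<in> pfrac r \<Longrightarrow> u * v \<in> pfrac r"
proof (induction arbitrary: v rule: \<O>.induct)
  case (const c)
  then show ?case by (simp add: pfrac_scale \<O>.const)
next
  case (var t)
  then show ?case
    by (cases "t = r") (auto simp: pfrac_var intro!: pfrac_scale \<O>.var)
next
  case (inv a)
  then show ?case
    by (cases "lev a = r") (auto simp: pfrac_inv intro!: pfrac_scale \<O>.inv)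
next
  case (add u u')
  then show ?case by (simp add: distrib_right pfrac.add)
next
  case (mult u u')
  then show ?case by (simp add: mult.assoc)
qed

lemma \<O>_subset_pfrac: "u \<in> \<O> (Suc r) \<Longrightarrow> u \<in> pfrac r"
  using pfrac_mult[of u r 1] pfrac.var[of 1 r 0] by simp

text \<open>Coefficients from \<open>\<O> r\<close> are constants of \<open>del r\<close>, so in
  characteristic 0 each term of a partial fraction has a primitive by the power rule, except for the
  exponent -1.\<close>

lemma primitive_up_to_simple_poles:
  assumes r: "r < l" and "u \<in> \<O> (Suc r)"
  shows "\<exists>\<psi> h. \<psi> \<in> \<O> (Suc r) \<and> (\<forall>a. h a \<in> \<O> r) \<and>
    u = del r \<psi> + (\<Sum>a | a < N \<and> lev a = r. h a * inverse (A a))"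
proof -
  interpret slice_derivation "del r" "y r" by (rule slice[OF r])
  show ?thesis
    using \<O>_subset_pfrac[OF assms(2)]
  proof (induction rule: pfrac.induct)
    case zero
    show ?case by (rule exI[of _ 0], rule exI[of _ "\<lambda>_. 0"]) simp
  next
    case (var h n)
    define e where "e = \<kappa> (inverse (of_nat (Suc n))) * h"
    have e: "e \<in> \<O> r" using var by (auto simp: e_def intro: \<O>.mult \<O>.const)
    have "del r (e * y r ^ Suc n) = e * (of_nat (Suc n) * y r ^ n)"
      unfolding d_mult[of e] d_power d_y using \<O>_subset_consts[OF e] r by simp
    also have "\<dots> = h * y r ^ n"
      by (simp add: e_def \<kappa>_inverse \<kappa>_of_nat del: of_nat_Suc)
    finally show ?case
      using e r by - (rule exI[of _ "e * y r ^ Suc n"], rule exI[of _ "\<lambda>_. 0"],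
        auto intro!: \<O>.mult \<O>_power \<O>_Suc[OF e] intro: \<O>.var simp del: power_Suc)
  next
    case (inv h a n)
    have h: "del r h = 0" using \<O>_subset_consts[OF inv(1)] r by simp
    consider "n = 0" | "n = 1" | m where "n = Suc (Suc m)"
      by (metis One_nat_def not0_implies_Suc)
    then show ?case
    proof cases
      case 1
      then show ?thesis
        using inv r h \<O>_Suc[OF inv(1)] \<O>.var[of r "Suc r"]
        by - (rule exI[of _ "h * y r"], rule exI[of _ "\<lambda>_. 0"],
          simp add: del_mult del_y \<O>.mult)
    next
      case 2
      have "(\<Sum>b | b < N \<and> lev b = r. (if b = a then h else 0) * inverse (A b)) =
        (\<Sum>b | b < N \<and> lev b = r. if b = a then h * inverse (A a) else 0)"
        by (rule sum.cong) auto
      also have "\<dots> = h * inverse (A a)"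
        using inv by (subst sum.delta) auto
      finally show ?thesis
        using inv 2 by - (rule exI[of _ 0], rule exI[of _ "\<lambda>b. if b = a then h else 0"], simp)
    next
      case 3
      define e where "e = \<kappa> (- inverse (of_nat (Suc m))) * h"
      have e: "e \<in> \<O> r" using inv by (auto simp: e_def intro: \<O>.mult \<O>.const)
      have "del r (inverse (A a)) = - (inverse (A a) ^ 2)"
        using del_inverse[OF r] del_A[OF inv(2) r] inv by simp
      then have "del r (e * inverse (A a) ^ Suc m) =
          e * (of_nat (Suc m) * inverse (A a) ^ m * - (inverse (A a) ^ 2))"
        unfolding d_mult[of e] d_power using \<O>_subset_consts[OF e] r by simp
      also have "\<dots> = h * inverse (A a) ^ n"
        by (simp add: e_def \<kappa>_minus \<kappa>_inverse \<kappa>_of_nat 3 power2_eq_square del: of_nat_Suc)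
  finally have "h * inverse (A a) ^ n = del r (e * inverse (A a) ^ Suc m)"
        by simp
      moreover have "e * inverse (A a) ^ Suc m \<in> \<O> (Suc r)"
        by (intro \<O>.mult \<O>_power \<O>_Suc[OF e] \<O>.inv) (use inv in auto)
      ultimately show ?thesis
        by - (rule exI[of _ "e * inverse (A a) ^ Suc m"], rule exI[of _ "\<lambda>_. 0"], simp)
    qed
  next
    case (add u v)
    then obtain \<psi> h \<psi>' h' where *:
        "\<psi> \<in> \<O> (Suc r)" "\<forall>a. h a \<in> \<O> r" "\<psi>' \<in> \<O> (Suc r)" "\<forall>a. h' a \<in> \<O> r"
      and u: "u = del r \<psi> + (\<Sum>a | a < N \<and> lev a = r. h a * inverse (A a))"
      and v: "v = del r \<psi>' + (\<Sum>a | a < N \<and> lev a = r. h' a * inverse (A a))"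
      by blast
    have "u + v = del r (\<psi> + \<psi>') + (\<Sum>a | a < N \<and> lev a = r. (h a + h' a) * inverse (A a))"
      unfolding u v by (simp add: del_add distrib_right sum.distrib)
    with * show ?case
      by - (rule exI[of _ "\<psi> + \<psi>'"], rule exI[of _ "\<lambda>a. h a + h' a"], auto intro: \<O>.add)
  qed
qed

text \<open>Residue comparison at the single pole \<open>a\<close>. The other simple poles and
  \<open>h\<close> are regular at \<open>a\<close>, and \<open>\<phi>\<close> becomes so after
  multiplication by a power of \<open>A a\<close>; then \<open>residue_of_exact\<close>
  applies.\<close>

lemma residues_zero:
  assumes r: "r < l" and "\<phi> \<in> \<O> (Suc r)" "del r h = 0"
    and \<gamma>: "\<And>a. a < N \<Longrightarrow> lev a = r \<Longrightarrow> del r (\<gamma> a) = 0"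
    and eq: "del r \<phi> + h + (\<Sum>a | a < N \<and> lev a = r. \<gamma> a * inverse (A a)) = 0"
    and a: "a < N" "lev a = r"
  shows "\<gamma> a = 0"
proof -
  interpret slice_derivation "del r" "y r" by (rule slice[OF r])
  have fc: "del r (f b) = 0" if "b < N" "lev b = r" for b
    using del_f[OF that(1) r] that by simp
  have Aa: "A b = y r - f b" if "lev b = r" for b
    using that by (simp add: A_def)
  define R where "R = local_ring (f a)"
  have R: "u \<in> R \<Longrightarrow> v \<in> R \<Longrightarrow> u + v \<in> R" "u \<in> R \<Longrightarrow> v \<in> R \<Longrightarrow> u * v \<in> R"
     "del r u = 0 \<Longrightarrow> u \<in> R" for u v
    unfolding R_def by (auto intro: local_ring.intros)
  have AR: "A a ^ k \<in> R" for k
  proof (induction k)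
    case (Suc k)
    have "A a = y r + - f a" using a by (simp add: A_def)
    moreover have "y r + - f a \<in> R"
      unfolding R_def using fc[OF a] by (intro local_ring.add local_ring.var local_ring.const) (simp add: d_minus)
    ultimately show ?case using Suc R(2) by simp
  qed (simp add: R)
  have AinvR: "inverse (A b) \<in> R" if "b < N" "lev b = r" "b \<noteq> a" for b
    unfolding R_def Aa[OF that(2)] using that fc f_neq[of b a] a by (intro local_ring.inv) auto
  have "\<exists>n. \<phi> * A a ^ n \<in> R"
    using assms(2)
  proof (induction rule: \<O>.induct)
    case (const c)
    show ?case by (rule exI[of _ 0]) (simp add: R)
  next
    case (var t)
    have "y t \<in> R"
    proof (cases "t = r")
      case True
      then show ?thesis by (simp add: R_def local_ring.var)
    next
      case False
      then show ?thesis using var r by (intro R(3)) (simp add: del_y)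
    qed
    then show ?case by (intro exI[of _ 0]) simp
  next
    case (inv b)
    consider "lev b < r" | "lev b = r" "b \<noteq> a" | "b = a" using inv by linarith
    then show ?case
    proof cases
      case 1
      then have "inverse (A b) \<in> R"
        using inv r by (intro R(3)) (simp add: del_inverse del_A)
      then show ?thesis by (intro exI[of _ 0]) simp
    next
      case 2
      then show ?thesis using AinvR inv by (intro exI[of _ 0]) simp
    next
      case 3
      then show ?thesis using A_nz[OF a(1)] by (intro exI[of _ 1]) (simp add: R)
    qed
  next
    case (add u v)
    then obtain n m where "u * A a ^ n \<in> R" "v * A a ^ m \<in> R" by blast
    then have "(u * A a ^ n) * A a ^ m + (v * A a ^ m) * A a ^ n \<in> R"
      using R AR by blast
    then show ?case
      by (intro exI[of _ "n + m"]) (simp add: algebra_simps power_add)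
  next
    case (mult u v)
    then obtain n m where "u * A a ^ n \<in> R" "v * A a ^ m \<in> R" by blast
    then have "(u * A a ^ n) * (v * A a ^ m) \<in> R"
      using R by blast
    then show ?case
      by (intro exI[of _ "n + m"]) (simp add: algebra_simps power_add)
  qed
  then obtain n where n: "\<phi> * A a ^ n \<in> R" by blast
  define H where "H = {b. b < N \<and> lev b = r} - {a}"
  have finH: "finite H" by (simp add: H_def)
  have sumR: "(\<Sum>b\<in>S. \<gamma> b * inverse (A b)) \<in> R" if "S \<subseteq> H" for S
    using finite_subset[OF that finH] that
  proof (induction S rule: finite_induct)
    case empty
    then show ?case by (simp add: R)
  next
    case (insert b S)
    then have "\<gamma> b * inverse (A b) \<in> R"
      using AinvR[of b] R(3)[OF \<gamma>[of b]] by (intro R(2)) (auto simp: H_def)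
    with insert show ?case
      by (simp add: R(1))
  qed
  have eq1: "(\<phi> * A a ^ n) * inverse (y r - f a) ^ n = \<phi>"
    using A_nz[OF a(1)] unfolding Aa[OF a(2), symmetric] by (simp add: power_inverse)
  have eq2: "(\<Sum>b | b < N \<and> lev b = r. \<gamma> b * inverse (A b)) =
      \<gamma> a * inverse (y r - f a) + (\<Sum>b\<in>H. \<gamma> b * inverse (A b))"
    unfolding H_def Aa[OF a(2), symmetric] using a by (subst sum.remove[of _ a]) auto
  have "del r ((\<phi> * A a ^ n) * inverse (y r - f a) ^ n) + \<gamma> a * inverse (y r - f a)
      + (h + (\<Sum>b\<in>H. \<gamma> b * inverse (A b))) = 0"
    unfolding eq1 using eq unfolding eq2 by (simp only: ac_simps)
  moreover have "h + (\<Sum>b\<in>H. \<gamma> b * inverse (A b)) \<in> R"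
    using sumR assms(3) R by blast
  ultimately show ?thesis
    using residue_of_exact[OF fc[OF a] \<gamma>[OF a] n[unfolded R_def]] unfolding R_def by blast
qed

text \<open>The case \<open>\<phi> = 0\<close> of \<open>residues_zero\<close>; in this form
  relations along the fibre are read off below.\<close>

lemma simple_poles_independent:
  assumes r: "r < l" and h: "del r h = 0"
    and \<gamma>: "\<And>a. a < N \<Longrightarrow> lev a = r \<Longrightarrow> del r (\<gamma> a) = 0"
    and eq: "h + (\<Sum>a | a < N \<and> lev a = r. \<gamma> a * inverse (A a)) = 0"
  shows "h = 0" "\<And>a. a < N \<Longrightarrow> lev a = r \<Longrightarrow> \<gamma> a = 0"
proof -
  show *: "\<gamma> a = 0" if "a < N" "lev a = r" for a
    using residues_zero[OF r \<O>_0 h \<gamma> _ that] eq by simp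
  then show "h = 0" using eq by simp
qed

text \<open>\<open>\<phi>\<close> is a quotient \<open>p(y) / q(y)\<close> over
  \<open>\<O> r\<close> whose denominator, a product of factors \<open>y - f a\<close>, is monic. As
  \<open>\<phi>\<close> is constant and \<open>y\<close> transcendental,
  \<open>p = \<phi> * q\<close> as polynomials, and the leading coefficient exhibits
  \<open>\<phi>\<close> as an element of \<open>\<O> r\<close>.\<close>

lemma \<O>_consts:
  assumes r: "r < l" and "\<phi> \<in> \<O> (Suc r)" "del r \<phi> = 0"
  shows "\<phi> \<in> \<O> r"
proof -
  interpret slice_derivation "del r" "y r" by (rule slice[OF r])
  have "\<exists>p q. (\<forall>i. coeff p i \<in> \<O> r) \<and> const_poly q \<and> lead_coeff q = 1 \<and>
      (\<forall>i. coeff q i \<in> \<O> r) \<and> \<phi> * poly q (y r) = poly p (y r)"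
    using assms(2)
  proof (induction rule: \<O>.induct)
    case (const c)
    show ?case
      by (rule exI[of _ "[:\<kappa> c:]"], rule exI[of _ 1])
        (auto simp: coeff_pCons intro: \<O>.const split: nat.splits)
  next
    case (var t)
    show ?case
    proof (cases "t = r")
      case True
      then show ?thesis
        by - (rule exI[of _ "[:0, 1:]"], rule exI[of _ 1],
          auto simp: coeff_pCons split: nat.splits)
    next
      case False
      then have "y t \<in> \<O> r" using var by (intro \<O>.var) auto
      then show ?thesis
        by - (rule exI[of _ "[:y t:]"], rule exI[of _ 1],
          auto simp: coeff_pCons split: nat.splits)
    qed
  next
    case (inv a)
    show ?case
    proof (cases "lev a = r")
      case True
      have "f a \<in> \<O> r" "del r (f a) = 0"
        using inv True r by (auto simp: f_\<O> del_f)
      then show ?thesis using A_nz[OF inv(1)] True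
        by - (rule exI[of _ 1], rule exI[of _ "[:- f a, 1:]"],
          auto simp: coeff_pCons A_def const_poly_pCons d_minus \<O>_minus split: nat.splits)
    next
      case False
      then have "inverse (A a) \<in> \<O> r" using inv by (intro \<O>.inv) auto
      then show ?thesis
        by - (rule exI[of _ "[:inverse (A a):]"], rule exI[of _ 1],
          auto simp: coeff_pCons split: nat.splits)
    qed
  next
    case (add u v)
    then obtain p q p' q' where *: "\<forall>i. coeff p i \<in> \<O> r" "const_poly q" "lead_coeff q = 1"
      "\<forall>i. coeff q i \<in> \<O> r" "u * poly q (y r) = poly p (y r)"
      "\<forall>i. coeff p' i \<in> \<O> r" "const_poly q'" "lead_coeff q' = 1"
      "\<forall>i. coeff q' i \<in> \<O> r" "v * poly q' (y r) = poly p' (y r)"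
      by blast
    have "(u + v) * poly (q * q') (y r) = poly (p * q' + p' * q) (y r)"
      by (simp add: *(5,10)[symmetric] algebra_simps)
    moreover have "lead_coeff (q * q') = 1"
      using * by (simp only: lead_coeff_mult) simp
    moreover have "coeff (p * q' + p' * q) i \<in> \<O> r" "coeff (q * q') i \<in> \<O> r" for i
      using * by (auto simp: coeff_mult intro!: \<O>.add \<O>_sum \<O>.mult)
    ultimately show ?case
      using const_poly_mult[OF *(2,7)] by blast
  next
    case (mult u v)
    then obtain p q p' q' where *: "\<forall>i. coeff p i \<in> \<O> r" "const_poly q" "lead_coeff q = 1"
      "\<forall>i. coeff q i \<in> \<O> r" "u * poly q (y r) = poly p (y r)"
      "\<forall>i. coeff p' i \<in> \<O> r" "const_poly q'" "lead_coeff q' = 1"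
      "\<forall>i. coeff q' i \<in> \<O> r" "v * poly q' (y r) = poly p' (y r)"
      by blast
    have "(u * v) * poly (q * q') (y r) = poly (p * p') (y r)"
      by (simp add: *(5,10)[symmetric] algebra_simps)
    moreover have "lead_coeff (q * q') = 1"
      using * by (simp only: lead_coeff_mult) simp
    moreover have "coeff (p * p') i \<in> \<O> r" "coeff (q * q') i \<in> \<O> r" for i
      using * by (auto simp: coeff_mult intro!: \<O>_sum \<O>.mult)
    ultimately show ?case
      using const_poly_mult[OF *(2,7)] by blast
  qed
  then obtain p q where *: "\<forall>i. coeff p i \<in> \<O> r" "const_poly q" "lead_coeff q = 1"
      "\<phi> * poly q (y r) = poly p (y r)"
    by blast
  have "const_poly p"
    using * r by (auto simp: const_poly_def intro: \<O>_subset_consts[of _ r])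
  then have "smult \<phi> q - p = 0"
    using * assms(3) by (intro transcendental const_poly_diff const_poly_smult) auto
  then have "coeff p (degree q) = coeff (smult \<phi> q) (degree q)"
    by simp
  then have "coeff p (degree q) = \<phi>"
    using * by simp
  with * show ?thesis by metis
qed

subsection \<open>Integrable words\<close>

definition om2 :: "nat \<Rightarrow> nat \<Rightarrow> nat \<Rightarrow> nat \<Rightarrow> 'f" where
  "om2 s t a b = om s a * om t b - om t a * om s b"

text \<open>The part of length at most \<open>m\<close> of \<open>V\<close> for the hyperplanes of level below \<open>r\<close>.\<close>

definition W :: "nat \<Rightarrow> nat \<Rightarrow> (nat list \<Rightarrow> 'k) set" where
  "W r m = {c. (\<forall>w. c w \<noteq> 0 \<longrightarrow> length w \<le> m \<and> (\<forall>a\<in>set w. a < N \<and> lev a < r)) \<and>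
     (\<forall>u v. \<forall>s<l. \<forall>t<l. (\<Sum>a<N. \<Sum>b<N. \<kappa> (c (u @ [a, b] @ v)) * om2 s t a b) = 0)}"

lemma W_support: "c \<in> W r m \<Longrightarrow> c w \<noteq> 0 \<Longrightarrow> length w \<le> m \<and> (\<forall>a\<in>set w. a < N \<and> lev a < r)"
  by (simp add: W_def)

lemma W_integrable: "c \<in> W r m \<Longrightarrow> s < l \<Longrightarrow> t < l \<Longrightarrow>
    (\<Sum>a<N. \<Sum>b<N. \<kappa> (c (u @ [a, b] @ v)) * om2 s t a b) = 0"
  unfolding W_def by blast

lemma W_zero: "(\<lambda>_. 0) \<in> W r m"
  by (simp add: W_def)

lemma W_mono: "r \<le> r' \<Longrightarrow> m \<le> m' \<Longrightarrow> c \<in> W r m \<Longrightarrow> c \<in> W r' m'"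
  unfolding W_def by fastforce

lemma W_add: "c \<in> W r m \<Longrightarrow> e \<in> W r m \<Longrightarrow> (\<lambda>w. c w + e w) \<in> W r m"
  unfolding W_def by (auto simp: \<kappa>_add distrib_right sum.distrib) (metis add.right_neutral)+

lemma W_scale: "c \<in> W r m \<Longrightarrow> (\<lambda>w. k * c w) \<in> W r m"
  unfolding W_def by (auto simp: \<kappa>_mult mult.assoc sum_distrib_left[symmetric])

lemma W_diff: "c \<in> W r m \<Longrightarrow> e \<in> W r m \<Longrightarrow> (\<lambda>w. c w - e w) \<in> W r m"
  using W_add[OF _ W_scale[of e r m "-1"]] by simp

lemma W_sum: "(\<And>i. i \<in> I \<Longrightarrow> c i \<in> W r m) \<Longrightarrow> (\<lambda>w. \<Sum>i\<in>I. c i w) \<in> W r m"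
  by (induction I rule: infinite_finite_induct) (auto simp: W_zero intro: W_add)

lemma W_tail: assumes "c \<in> W r m" shows "(\<lambda>w. c (a # w)) \<in> W r (m - 1)"
proof -
  have "(\<Sum>a'<N. \<Sum>b<N. \<kappa> (c (a # u @ [a', b] @ v)) * om2 s t a' b) = 0"
    if "s < l" "t < l" for u v s t
    using W_integrable[OF assms that, of "a # u" v] by simp
  moreover have "length w \<le> m - 1 \<and> (\<forall>a\<in>set w. a < N \<and> lev a < r)" if "c (a # w) \<noteq> 0" for w
    using W_support[OF assms that] by auto
  ultimately show ?thesis unfolding W_def by simp
qed

text \<open>Pairs of letters behind the first letter are handled by the tails, which leaves the pair
  at the front.\<close>

lemma W_ConsI:
  assumes "\<And>a. (\<lambda>w. c (a # w)) \<in> W r m"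
    and letters: "\<And>a w. c (a # w) \<noteq> 0 \<Longrightarrow> a < N \<and> lev a < r"
    and int: "\<And>v s t. s < l \<Longrightarrow> t < l \<Longrightarrow> (\<Sum>a<N. \<Sum>b<N. \<kappa> (c (a # b # v)) * om2 s t a b) = 0"
  shows "c \<in> W r (Suc m)"
proof -
  have "length w \<le> Suc m \<and> (\<forall>a\<in>set w. a < N \<and> lev a < r)" if "c w \<noteq> 0" for w
  proof (cases w)
    case (Cons a v)
    then show ?thesis
      using W_support[OF assms(1)[of a], of v] letters[of a v] that by auto
  qed simp
  moreover have "(\<Sum>a<N. \<Sum>b<N. \<kappa> (c (u @ [a, b] @ v)) * om2 s t a b) = 0"
    if "s < l" "t < l" for u v s t
  proof (cases u)
    case Nil
    then show ?thesis using int[OF that] by simp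
  next
    case (Cons a u')
    then show ?thesis using W_integrable[OF assms(1)[of a] that, of u' v] by simp
  qed
  ultimately show ?thesis unfolding W_def by simp
qed

definition Low :: "nat \<Rightarrow> nat set" where "Low r = {a. a < N \<and> lev a < r}"
definition Hor :: "nat \<Rightarrow> nat set" where "Hor r = {a. a < N \<and> lev a = r}"

lemma finite_Low [simp]: "finite (Low r)" and finite_Hor [simp]: "finite (Hor r)"
  by (auto simp: Low_def Hor_def)

lemma sum_letters:
  assumes "\<And>a. a < N \<Longrightarrow> r < lev a \<Longrightarrow> h a = 0"
  shows "(\<Sum>a<N. h a) = (\<Sum>a\<in>Low r. h a) + (\<Sum>a\<in>Hor r. h a :: 'b::comm_monoid_add)"
proof -
  have "(\<Sum>a<N. h a) = (\<Sum>a\<in>Low r \<union> Hor r. h a)"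
    using assms by (intro sum.mono_neutral_right) (force simp: Low_def Hor_def)+
  also have "\<dots> = (\<Sum>a\<in>Low r. h a) + (\<Sum>a\<in>Hor r. h a)"
    by (rule sum.union_disjoint) (auto simp: Low_def Hor_def)
  finally show ?thesis .
qed

text \<open>A letter of lower level has no component along \<open>y r\<close>, and that of a
  horizontal one is \<open>1 / A a\<close>; this turns relations along the fibre into sums of simple
  poles.\<close>

lemma sum_om_fibre:
  assumes r: "r < l" and "\<And>a. a < N \<Longrightarrow> r < lev a \<Longrightarrow> h a = 0"
  shows "(\<Sum>a<N. h a * om r a) = (\<Sum>a\<in>Hor r. h a * inverse (A a))"
proof -
  have "(\<Sum>a<N. h a * om r a) = (\<Sum>a\<in>Low r. h a * om r a) + (\<Sum>a\<in>Hor r. h a * om r a)"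
    using assms by (intro sum_letters) auto
  moreover have "(\<Sum>a\<in>Low r. h a * om r a) = 0"
    by (rule sum.neutral) (auto simp: Low_def om_high[OF _ r])
  moreover have "(\<Sum>a\<in>Hor r. h a * om r a) = (\<Sum>a\<in>Hor r. h a * inverse (A a))"
    by (rule sum.cong) (auto simp: Hor_def om_lev)
  ultimately show ?thesis by simp
qed

lemma del_om: "a \<in> Low r \<Longrightarrow> r < l \<Longrightarrow> s < l \<Longrightarrow> del r (om s a) = 0"
  using om_\<O>[of r a s] \<O>_subset_consts[of "om s a" r r] by (auto simp: Low_def)

text \<open>Along the top coordinate the relation is one between simple poles, which removes the
  letters of the highest level; induction on the level does the rest.\<close>

lemma om_independent:
  assumes "r \<le> l" "\<And>a. k a \<noteq> 0 \<Longrightarrow> a \<in> Low r"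
    and "\<And>s. s < r \<Longrightarrow> (\<Sum>a<N. \<kappa> (k a) * om s a) = 0"
  shows "k a = 0"
  using assms
proof (induction r)
  case 0
  then show ?case by (auto simp: Low_def)
next
  case (Suc r)
  have r: "r < l" using Suc.prems by simp
  have "(\<Sum>a<N. \<kappa> (k a) * om r a) = (\<Sum>a\<in>Hor r. \<kappa> (k a) * inverse (A a))"
    using Suc.prems(2) by (intro sum_om_fibre[OF r]) (force simp: Low_def)
  then have "(\<Sum>a | a < N \<and> lev a = r. \<kappa> (k a) * inverse (A a)) = 0"
    using Suc.prems(3)[of r] by (simp add: Hor_def)
  then have *: "\<kappa> (k a) = 0" if "a < N" "lev a = r" for a
    using simple_poles_independent(2)[OF r _ _ _ that, of 0 "\<lambda>a. \<kappa> (k a)"] by simp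
  have "a \<in> Low r" if "k a \<noteq> 0" for a
    using Suc.prems(2)[OF that] *[of a] that by (force simp: Low_def)
  then show ?case
    using Suc by (intro Suc.IH) auto
qed

text \<open>A word that starts with a vertical letter followed by a horizontal one would give
  \<open>\<Sum>\<^sub>b \<omega>\<^sub>b \<wedge> dy / (y - f\<^sub>a)\<close> with vertical \<open>b\<close>, contradicting the independence of the \<open>\<omega>\<^sub>b\<close>.\<close>

lemma W_vertical:
  assumes r: "r < l" and "c \<in> W (Suc r) m" and "\<And>a w. a \<in> Hor r \<Longrightarrow> c (a # w) = 0"
  shows "c \<in> W r m"
proof -
  have "\<forall>a\<in>set w. lev a < r" if "c w \<noteq> 0" for w
    using assms(2,3) that
  proof (induction w arbitrary: c m)
    case (Cons a w)
    have low: "e \<in> Low r" if "c (e # v) \<noteq> 0" for e v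
      using W_support[OF Cons.prems(1) that] Cons.prems(2)[of e v] that
      by (force simp: Low_def Hor_def less_Suc_eq)
    have "c (e # b # v) = 0" if b: "b \<in> Hor r" for e b v
    proof (rule om_independent[of r "\<lambda>e. c (e # b # v)"])
      show "r \<le> l" using r by simp
      show "e \<in> Low r" if "c (e # b # v) \<noteq> 0" for e using low that by blast
      fix s assume s: "s < r"
      define h where "h b = (\<Sum>e<N. \<kappa> (c (e # b # v)) * om s e)" for b
      \<comment> \<open>Only vertical \<open>e\<close> have a nonzero coefficient. For them
        \<open>om r e = 0\<close>, so the alternating product keeps one of its two terms.\<close>
      have eq: "\<kappa> (c (e # b # v)) * om2 s r e b = \<kappa> (c (e # b # v)) * om s e * om r b"
        if "e < N" for e b
        using low[of e "b # v"] om_high[of e r] r by (force simp: om2_def Low_def)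
      have "(\<Sum>e<N. \<Sum>b<N. \<kappa> (c (e # b # v)) * om s e * om r b) =
          (\<Sum>e<N. \<Sum>b<N. \<kappa> (c (e # b # v)) * om2 s r e b)"
        by (intro sum.cong refl) (simp only: lessThan_iff eq)
      also have "\<dots> = 0"
        using W_integrable[OF Cons.prems(1), of s r "[]" v] s r by simp
      finally have "(\<Sum>e<N. \<Sum>b<N. \<kappa> (c (e # b # v)) * om s e * om r b) = 0" .
      then have "(\<Sum>b<N. h b * om r b) = 0"
        by (subst (asm) sum.swap) (simp add: h_def sum_distrib_right)
      moreover have "(\<Sum>b<N. h b * om r b) = (\<Sum>b\<in>Hor r. h b * inverse (A b))"
      proof (rule sum_om_fibre[OF r])
        fix b assume "r < lev b"
        then have "c (e # b # v) = 0" for e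
          using W_support[OF Cons.prems(1), of "e # b # v"] by force
        then show "h b = 0" by (simp add: h_def)
      qed
      moreover have "del r (h b) = 0" for b
        unfolding h_def del_sum del_mult
        using low del_om[OF _ r, of _ s] s r by (intro sum.neutral) force
      ultimately show "(\<Sum>e<N. \<kappa> (c (e # b # v)) * om s e) = 0"
        using simple_poles_independent(2)[OF r, of 0 h b] b by (simp add: h_def Hor_def)
    qed
    then have "\<forall>e\<in>set w. lev e < r"
      using Cons.prems by (intro Cons.IH[OF W_tail[OF Cons.prems(1), of a]]) auto
    then show ?case
      using low[OF Cons.prems(3)] by (simp add: Low_def)
  qed simp
  then show ?thesis
    using assms(2) unfolding W_def by auto
qed

subsection \<open>The Arnold relations\<close>

text \<open>If \<open>f a - f b\<close> is constant, \<open>A a\<close> and \<open>A b\<close> have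
  the same derivatives and the left side is 0, so \<open>\<epsilon> = 0\<close> works. If it is a
  multiple of \<open>A h\<close>, the Arnold relation of \<open>a\<close>, \<open>b\<close>,
  \<open>h\<close> gives the indicator of \<open>h\<close>. The sum covers both cases at
  once.\<close>

lemma arnold_exists:
  assumes "a \<in> Hor r" "b \<in> Hor r"
  shows "\<exists>\<epsilon>. \<forall>s<l. \<forall>t<l. om2 s t a b = (\<Sum>h\<in>Low r. \<kappa> (\<epsilon> h) * (om2 s t h b - om2 s t h a))"
proof (cases "a = b")
  case True
  then show ?thesis by (intro exI[of _ "\<lambda>_. 0"]) (simp add: om2_def)
next
  case False
  have ab: "a < N" "b < N" "lev a = lev b" "lev a = r"
    using assms by (auto simp: Hor_def)
  obtain c where c: "f a - f b = \<kappa> c \<or> (\<exists>h<N. lev h < r \<and> f a - f b = \<kappa> c * A h)"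
    using same_level[OF ab(1,2) False ab(3)] unfolding A_def ab(4) by blast
  have AB: "A b - A a = f a - f b" using assms by (simp add: A_def Hor_def)
  have nz: "A a \<noteq> 0" "A b \<noteq> 0" using A_nz assms by (auto simp: Hor_def)
  from c show ?thesis
  proof (elim disjE exE conjE)
    assume "f a - f b = \<kappa> c"
    then have "A b = A a + \<kappa> c" using AB by (simp add: algebra_simps)
    then have "del s (A b) = del s (A a)" for s by (simp add: del_add)
    then show ?thesis
      by (intro exI[of _ "\<lambda>_. 0"]) (simp add: om2_def om_def)
  next
    fix h assume h: "h < N" "lev h < r" "f a - f b = \<kappa> c * A h"
    have B: "A b = A a + \<kappa> c * A h" using AB h by (simp add: algebra_simps)
    have nzh: "A h \<noteq> 0" using A_nz h by simp
    have "om2 s t a b = om2 s t h b - om2 s t h a" for s t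
    proof -
      have dB: "del s (A b) = del s (A a) + \<kappa> c * del s (A h)" for s
        unfolding B by (simp add: del_add del_mult)
      have id: "(x * inverse P) * ((x' + c * z') * inverse Q) - (x' * inverse P) * ((x + c * z) * inverse Q) =
        ((z * inverse H) * ((x' + c * z') * inverse Q) - (z' * inverse H) * ((x + c * z) * inverse Q))
        - ((z * inverse H) * (x' * inverse P) - (z' * inverse H) * (x * inverse P))"
        if "Q = P + c * H" "P \<noteq> 0" "Q \<noteq> 0" "H \<noteq> 0" for x x' z z' c P Q H :: 'f
      proof -
        \<comment> \<open>This partial fraction identity is the only use of
          \<open>Q = P + c * H\<close>; the rest is polynomial algebra.\<close>
        have "c * (inverse P * inverse Q) = inverse H * (inverse P - inverse Q)"
          using that by (simp add: field_simps)
        then show ?thesis by algebra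
      qed
      show ?thesis
        unfolding om2_def om_def dB by (rule id[OF B nz nzh])
    qed
    moreover have "(\<Sum>h'\<in>Low r. \<kappa> (if h' = h then 1 else 0) * (om2 s t h' b - om2 s t h' a)) =
        om2 s t h b - om2 s t h a" for s t
    proof -
      have "(\<Sum>h'\<in>Low r. \<kappa> (if h' = h then 1 else 0) * (om2 s t h' b - om2 s t h' a)) =
        (\<Sum>h'\<in>Low r. if h' = h then om2 s t h b - om2 s t h a else 0)"
        by (rule sum.cong) auto
      then show ?thesis using h by (simp add: Low_def)
    qed
    ultimately show ?thesis
      by (intro exI[of _ "\<lambda>h'. if h' = h then 1 else 0"]) simp
  qed
qed

text \<open>One choice of coefficients per pair lets all Arnold relations be applied uniformly,
  without distinguishing parallel hyperplanes.\<close>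

definition eps :: "nat \<Rightarrow> nat \<Rightarrow> nat \<Rightarrow> 'k" where
  "eps a b = (SOME \<epsilon>. \<forall>s<l. \<forall>t<l.
     om2 s t a b = (\<Sum>h\<in>Low (lev a). \<kappa> (\<epsilon> h) * (om2 s t h b - om2 s t h a)))"

lemma arnold:
  assumes "a \<in> Hor r" "b \<in> Hor r" "s < l" "t < l"
  shows "om2 s t a b = (\<Sum>h\<in>Low r. \<kappa> (eps a b h) * (om2 s t h b - om2 s t h a))"
proof -
  have "lev a = r" using assms by (simp add: Hor_def)
  from someI_ex[OF arnold_exists[OF assms(1,2), folded this]] show ?thesis
    using assms \<open>lev a = r\<close> unfolding eps_def by auto
qed

text \<open>The coefficient of \<open>\<omega>\<^sub>b \<and> \<omega>\<^sub>a\<close> (\<open>b\<close> vertical, \<open>a\<close> horizontal) once the Arnold relations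
  have eliminated the products of two horizontal forms.\<close>

definition mix :: "nat \<Rightarrow> (nat \<Rightarrow> nat \<Rightarrow> 'k) \<Rightarrow> nat \<Rightarrow> nat \<Rightarrow> 'k" where
  "mix r C b a = C b a - C a b + (\<Sum>e\<in>Hor r. eps e a b * C e a - eps a e b * C a e)"

text \<open>Products of two horizontal forms are rewritten by \<open>arnold\<close>, and mixed
  products are ordered with the vertical letter first. The one remaining horizontal letter
  contributes a simple pole along the fibre.\<close>

lemma normal_form:
  assumes st: "s < l" "t < l"
    and C: "\<And>a b. C a b \<noteq> 0 \<Longrightarrow> a \<in> Low (Suc r) \<and> b \<in> Low (Suc r)"
  shows "(\<Sum>a<N. \<Sum>b<N. \<kappa> (C a b) * om2 s t a b) =
    (\<Sum>a\<in>Low r. \<Sum>b\<in>Low r. \<kappa> (C a b) * om2 s t a b) +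
    (\<Sum>a\<in>Hor r. \<Sum>b\<in>Low r. \<kappa> (mix r C b a) * om2 s t b a)"
proof -
  define q where "q a b = \<kappa> (C a b) * om2 s t a b" for a b
  have z: "C a b = 0" if "r < lev a \<or> r < lev b" for a b
    using C[of a b] that by (force simp: Low_def)
  have anti: "om2 s t a b = - om2 s t b a" for a b
    by (simp add: om2_def)
  have "(\<Sum>a<N. \<Sum>b<N. q a b) = (\<Sum>a<N. (\<Sum>b\<in>Low r. q a b) + (\<Sum>b\<in>Hor r. q a b))"
    by (intro sum.cong refl sum_letters) (simp add: q_def z)
  also have "\<dots> = (\<Sum>a\<in>Low r. (\<Sum>b\<in>Low r. q a b) + (\<Sum>b\<in>Hor r. q a b)) +
     (\<Sum>a\<in>Hor r. (\<Sum>b\<in>Low r. q a b) + (\<Sum>b\<in>Hor r. q a b))"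
    by (intro sum_letters) (simp add: q_def z)
  also have "\<dots> = (\<Sum>a\<in>Low r. \<Sum>b\<in>Low r. q a b) +
     ((\<Sum>a\<in>Hor r. \<Sum>b\<in>Low r. q b a) + (\<Sum>a\<in>Hor r. \<Sum>b\<in>Low r. q a b) +
      (\<Sum>a\<in>Hor r. \<Sum>b\<in>Hor r. q a b))"
    by (simp add: sum.distrib sum.swap[of _ "Hor r" "Low r"])
  also have "(\<Sum>a\<in>Hor r. \<Sum>b\<in>Low r. q a b) =
      (\<Sum>a\<in>Hor r. \<Sum>b\<in>Low r. - (\<kappa> (C a b) * om2 s t b a))"
    unfolding q_def by (intro sum.cong refl) (subst anti, simp)
  also have "(\<Sum>a\<in>Hor r. \<Sum>b\<in>Hor r. q a b) =
      (\<Sum>a\<in>Hor r. \<Sum>e\<in>Hor r. \<Sum>b\<in>Low r. \<kappa> (C a e * eps a e b) * om2 s t b e) -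
      (\<Sum>a\<in>Hor r. \<Sum>e\<in>Hor r. \<Sum>b\<in>Low r. \<kappa> (C a e * eps a e b) * om2 s t b a)"
    unfolding q_def sum_subtractf[symmetric]
    by (intro sum.cong refl, subst arnold[OF _ _ st])
       (auto simp: sum_distrib_left sum_subtractf[symmetric] algebra_simps \<kappa>_mult)
  also have "(\<Sum>a\<in>Hor r. \<Sum>e\<in>Hor r. \<Sum>b\<in>Low r. \<kappa> (C a e * eps a e b) * om2 s t b e) =
      (\<Sum>a\<in>Hor r. \<Sum>b\<in>Low r. \<Sum>e\<in>Hor r. \<kappa> (C e a * eps e a b) * om2 s t b a)"
    by (subst sum.swap) (intro sum.cong refl sum.swap)
  also have "(\<Sum>a\<in>Hor r. \<Sum>e\<in>Hor r. \<Sum>b\<in>Low r. \<kappa> (C a e * eps a e b) * om2 s t b a) =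
      (\<Sum>a\<in>Hor r. \<Sum>b\<in>Low r. \<Sum>e\<in>Hor r. \<kappa> (C a e * eps a e b) * om2 s t b a)"
    by (intro sum.cong refl sum.swap)
  finally have *: "(\<Sum>a<N. \<Sum>b<N. q a b) = (\<Sum>a\<in>Low r. \<Sum>b\<in>Low r. q a b) +
     ((\<Sum>a\<in>Hor r. \<Sum>b\<in>Low r. q b a) +
      (\<Sum>a\<in>Hor r. \<Sum>b\<in>Low r. - (\<kappa> (C a b) * om2 s t b a)) +
      ((\<Sum>a\<in>Hor r. \<Sum>b\<in>Low r. \<Sum>e\<in>Hor r. \<kappa> (C e a * eps e a b) * om2 s t b a) -
       (\<Sum>a\<in>Hor r. \<Sum>b\<in>Low r. \<Sum>e\<in>Hor r. \<kappa> (C a e * eps a e b) * om2 s t b a)))" .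
  have "\<kappa> (mix r C b a) * om2 s t b a = q b a + - (\<kappa> (C a b) * om2 s t b a) +
      ((\<Sum>e\<in>Hor r. \<kappa> (C e a * eps e a b) * om2 s t b a) -
       (\<Sum>e\<in>Hor r. \<kappa> (C a e * eps a e b) * om2 s t b a))" for a b
    by (simp add: mix_def q_def \<kappa>_add \<kappa>_diff \<kappa>_sum \<kappa>_mult sum_subtractf sum_distrib_right
        sum_distrib_left algebra_simps)
  then have "(\<Sum>a\<in>Hor r. \<Sum>b\<in>Low r. \<kappa> (mix r C b a) * om2 s t b a) =
     ((\<Sum>a\<in>Hor r. \<Sum>b\<in>Low r. q b a) +
      (\<Sum>a\<in>Hor r. \<Sum>b\<in>Low r. - (\<kappa> (C a b) * om2 s t b a)) +
      ((\<Sum>a\<in>Hor r. \<Sum>b\<in>Low r. \<Sum>e\<in>Hor r. \<kappa> (C e a * eps e a b) * om2 s t b a) -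
       (\<Sum>a\<in>Hor r. \<Sum>b\<in>Low r. \<Sum>e\<in>Hor r. \<kappa> (C a e * eps a e b) * om2 s t b a)))"
    by (simp only: sum.distrib sum_subtractf)
  with * show ?thesis unfolding q_def by simp
qed

text \<open>In normal form the integrability relation is its vertical part \<open>X\<close> plus
  simple poles whose coefficients are constant along the fibre. By independence
  \<open>X = 0\<close>, which is the relation for the truncated words.\<close>

lemma W_projection:
  assumes r: "r < l" and c: "c \<in> W (Suc r) m"
  shows "(\<lambda>w. if \<forall>a\<in>set w. lev a < r then c w else 0) \<in> W r m"
proof -
  define p where "p w = (if \<forall>a\<in>set w. lev a < r then c w else 0)" for w
  have "length w \<le> m \<and> (\<forall>a\<in>set w. a < N \<and> lev a < r)" if "p w \<noteq> 0" for w
    using W_support[OF c, of w] that by (auto simp: p_def split: if_splits)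
  moreover have "(\<Sum>a<N. \<Sum>b<N. \<kappa> (p (u @ [a, b] @ v)) * om2 s t a b) = 0"
    if st: "s < l" "t < l" for u v s t
  proof (cases "\<forall>a\<in>set u \<union> set v. lev a < r")
    case False
    then have "p (u @ [a, b] @ v) = 0" for a b
      by (auto simp: p_def)
    then show ?thesis by simp
  next
    case True
    define C where "C a b = c (u @ [a, b] @ v)" for a b
    define X where "X = (\<Sum>a\<in>Low r. \<Sum>b\<in>Low r. \<kappa> (C a b) * om2 s t a b)"
    \<comment> \<open>\<open>del t (A a)\<close> is a constant, so \<open>h a\<close> is constant
      along the fibre; the pole \<open>1 / A a\<close> is split off from the mixed products.\<close>
    define h where "h a = (\<Sum>b\<in>Low r. \<kappa> (mix r C b a) *
        (om s b * del t (A a) - om t b * del s (A a)))" for a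
    have C: "a \<in> Low (Suc r) \<and> b \<in> Low (Suc r)" if "C a b \<noteq> 0" for a b
      using W_support[OF c, of "u @ [a, b] @ v"] that by (auto simp: C_def Low_def)
    have p: "p (u @ [a, b] @ v) = (if a \<in> Low r \<and> b \<in> Low r then C a b else 0)" for a b
      using True C[of a b] by (auto simp: p_def C_def Low_def)
    have "(\<Sum>a\<in>Hor r. \<Sum>b\<in>Low r. \<kappa> (mix r C b a) * om2 s t b a) =
        (\<Sum>a\<in>Hor r. h a * inverse (A a))"
      unfolding h_def sum_distrib_right
      by (intro sum.cong refl) (simp add: om2_def om_def algebra_simps)
    moreover have "(\<Sum>a<N. \<Sum>b<N. \<kappa> (C a b) * om2 s t a b) =
        X + (\<Sum>a\<in>Hor r. \<Sum>b\<in>Low r. \<kappa> (mix r C b a) * om2 s t b a)"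
      unfolding X_def by (rule normal_form[OF st C])
    moreover have "(\<Sum>a<N. \<Sum>b<N. \<kappa> (C a b) * om2 s t a b) = 0"
      unfolding C_def by (rule W_integrable[OF c st])
    ultimately have "X + (\<Sum>a | a < N \<and> lev a = r. h a * inverse (A a)) = 0"
      by (simp add: Hor_def)
    moreover have "del r X = 0"
      unfolding X_def del_sum
      by (intro sum.neutral ballI) (simp add: del_mult om2_def del_diff del_om r st)
    moreover have "del r (h a) = 0" if "a < N" for a
    proof -
      have "del r (del t (A a)) = 0" if "t < l" for t
        using del_A[OF \<open>a < N\<close> that] by (simp add: del_minus)
      then show ?thesis
        unfolding h_def del_sum
        by (intro sum.neutral ballI) (simp add: del_mult del_diff del_om r st)
    qed
    ultimately have "X = 0"
      using simple_poles_independent(1)[OF r, of X h] by blast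
    have "(\<Sum>a<N. \<Sum>b<N. \<kappa> (p (u @ [a, b] @ v)) * om2 s t a b) =
        (\<Sum>a<N. \<Sum>b<N. if a \<in> Low r then if b \<in> Low r then \<kappa> (C a b) * om2 s t a b else 0 else 0)"
      unfolding p by (intro sum.cong refl) auto
    also have "\<dots> = X"
    proof -
      have L: "{..<N} \<inter> Low r = Low r" by (auto simp: Low_def)
      have "(\<Sum>b<N. if a \<in> Low r then if b \<in> Low r then \<kappa> (C a b) * om2 s t a b else 0 else 0) =
        (if a \<in> Low r then \<Sum>b\<in>Low r. \<kappa> (C a b) * om2 s t a b else 0)" for a
        using sum.inter_restrict[of "{..<N}" "\<lambda>b. \<kappa> (C a b) * om2 s t a b" "Low r"] by (simp add: L)
      then show ?thesis
        using sum.inter_restrict[of "{..<N}" "\<lambda>a. \<Sum>b\<in>Low r. \<kappa> (C a b) * om2 s t a b" "Low r"]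
        by (simp add: L X_def)
    qed
    finally show ?thesis using \<open>X = 0\<close> by simp
  qed
  ultimately show ?thesis
    unfolding W_def p_def[symmetric] by simp
qed

subsection \<open>Linear functionals over the constants\<close>

sublocale vs: vector_space "\<lambda>c x. \<kappa> c * x"
  by unfold_locales (auto simp: \<kappa>_add \<kappa>_mult algebra_simps)

text \<open>Composed with such a map, a field-valued family of words becomes
  \<open>k\<close>-valued, so that facts about \<open>W\<close> apply to it; conversely these maps
  separate the elements of the field.\<close>

definition functional :: "('f \<Rightarrow> 'k) \<Rightarrow> bool" where
  "functional h \<longleftrightarrow> (\<forall>u v. h (u + v) = h u + h v) \<and> (\<forall>c u. h (\<kappa> c * u) = c * h u)"

lemma functional_add: "functional h \<Longrightarrow> h (u + v) = h u + h v"
  and functional_scale: "functional h \<Longrightarrow> h (\<kappa> c * u) = c * h u"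
  by (auto simp: functional_def)

lemma functional_0: "functional h \<Longrightarrow> h 0 = 0"
  using functional_add[of h 0 0] by simp

lemma functional_sum: "functional h \<Longrightarrow> h (sum x S) = (\<Sum>i\<in>S. h (x i))"
  by (induction S rule: infinite_finite_induct) (auto simp: functional_add functional_0)

lemma functional_representation:
  "vs.independent B \<Longrightarrow> vs.span B = UNIV \<Longrightarrow> functional (\<lambda>v. vs.representation B v b)"
  by (simp add: functional_def vs.representation_add vs.representation_scale)

lemma functional_separates:
  assumes "\<And>h. functional h \<Longrightarrow> h x = 0"
  shows "x = 0"
proof (rule ccontr)
  assume "x \<noteq> 0"
  then have ind: "vs.independent {x}" by simp
  define B where "B = vs.extend_basis {x}"
  have B: "vs.independent B" "vs.span B = UNIV" "x \<in> B"
    using vs.independent_extend_basis[OF ind] vs.span_extend_basis[OF ind]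
      vs.extend_basis_superset[OF ind] by (auto simp: B_def)
  from assms[OF functional_representation[OF B(1,2)], of x] B show False
    by (simp add: vs.representation_basis)
qed

subsection \<open>Prescribing the horizontal derivatives\<close>

text \<open>The vertical derivatives \<open>v b\<close> of the word sought are determined by the Arnold relations
  up to words without horizontal letters, and are normalised by having no such words. The remaining
  obstruction \<open>X = \<Sum> v b (b' # w) \<omega>\<^sub>b \<wedge> \<omega>\<^bsub>b'\<^esub>\<close> is a form on the base; since it is closed,
  its horizontal derivatives vanish, and therefore \<open>X = 0\<close>.\<close>

lemma W_extension:
  assumes r: "r < l" and "\<And>a. a \<in> Hor r \<Longrightarrow> u a \<in> W (Suc r) m"
  shows "\<exists>c\<in>W (Suc r) (Suc m). \<forall>a\<in>Hor r. \<forall>w. c (a # w) = u a w"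
  using assms(2)
proof (induction m arbitrary: u rule: less_induct)
  case (less m)
  \<comment> \<open>Obtained by solving \<open>mix = 0\<close> for the value of the word sought on
    \<open>b # a # w\<close>.\<close>
  define q where "q b a w = u a (b # w) -
      (\<Sum>e\<in>Hor r. eps e a b * u e (a # w) - eps a e b * u a (e # w))" for a b w
  have qW: "q b a \<in> W (Suc r) (m - 1)" if "a \<in> Hor r" for a b
    unfolding q_def using that less.prems by (intro W_diff W_sum W_scale W_tail)
  have "\<exists>v\<in>W (Suc r) m. (\<forall>a\<in>Hor r. \<forall>w. v (a # w) = q b a w) \<and>
      (\<forall>w. (\<forall>e\<in>set w. lev e < r) \<longrightarrow> v w = 0)" for b
  proof (cases m)
    case 0
    have "u a (e # w) = 0" if "a \<in> Hor r" for a e w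
      using W_support[OF less.prems[OF that], of "e # w"] 0 by auto
    then have "q b a w = 0" if "a \<in> Hor r" for a w
      using that by (simp add: q_def)
    then show ?thesis
      by (intro bexI[of _ "\<lambda>_. 0"]) (auto simp: W_zero)
  next
    case (Suc m')
    then obtain v where v: "v \<in> W (Suc r) m" "\<And>a w. a \<in> Hor r \<Longrightarrow> v (a # w) = q b a w"
      using less.IH[of m' "q b"] qW by auto
    \<comment> \<open>Removing the purely vertical part normalises the vertical derivative. By
      \<open>W_projection\<close> it stays integrable, and its values on words that start with a
      horizontal letter are unchanged.\<close>
    define p where "p w = (if \<forall>a\<in>set w. lev a < r then v w else 0)" for w
    have "p \<in> W r m"
      unfolding p_def by (rule W_projection[OF r v(1)])
    then have "p \<in> W (Suc r) m"
      by (rule W_mono[rotated 2]) auto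
    with v(1) have "(\<lambda>w. v w - p w) \<in> W (Suc r) m"
      by (rule W_diff)
    moreover have "v (a # w) - p (a # w) = q b a w" if "a \<in> Hor r" for a w
      using v(2)[OF that] that by (simp add: p_def Hor_def)
    ultimately show ?thesis
      by (intro bexI[of _ "\<lambda>w. v w - p w"]) (auto simp: p_def)
  qed
  then obtain v where v: "\<And>b. v b \<in> W (Suc r) m"
      "\<And>b a w. a \<in> Hor r \<Longrightarrow> v b (a # w) = q b a w"
      "\<And>b w. (\<forall>e\<in>set w. lev e < r) \<Longrightarrow> v b w = 0"
    by metis
  define c where "c w = (case w of [] \<Rightarrow> 0 | a # w' \<Rightarrow>
      if a \<in> Hor r then u a w' else if a \<in> Low r then v a w' else 0)" for w
  have cH: "c (a # w) = u a w" if "a \<in> Hor r" for a w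
    using that by (simp add: c_def)
  have cL: "c (a # w) = v a w" if "a \<in> Low r" for a w
    using that by (auto simp: c_def Low_def Hor_def)
  have letters: "a < N \<and> lev a < Suc r" if "c (a # w) \<noteq> 0" for a w
    using that by (auto simp: c_def Low_def Hor_def split: if_splits)
  have tails: "(\<lambda>w. c (a # w)) \<in> W (Suc r) m" for a
    using less.prems v(1) W_zero by (cases "a \<in> Hor r"; cases "a \<in> Low r") (auto simp: c_def)
  have letters2: "a \<in> Low (Suc r) \<and> b \<in> Low (Suc r)" if "c (a # b # w) \<noteq> 0" for a b w
    using letters[OF that] W_support[OF tails[of a], of "b # w"] that by (auto simp: Low_def)
  define X where "X s t w = (\<Sum>a\<in>Low r. \<Sum>b\<in>Low r. \<kappa> (c (a # b # w)) * om2 s t a b)" for s t w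
  have X: "(\<Sum>a<N. \<Sum>b<N. \<kappa> (c (a # b # w)) * om2 s t a b) = X s t w"
    if st: "s < l" "t < l" for s t w
  proof -
    have "mix r (\<lambda>a b. c (a # b # w)) b a = 0" if "a \<in> Hor r" "b \<in> Low r" for a b
      using that by (simp add: mix_def cH cL v(2) q_def)
    then show ?thesis
      using normal_form[OF st, of "\<lambda>a b. c (a # b # w)" r] letters2 by (simp add: X_def)
  qed
  have X_high: "X s t w = 0" if "s < l" "t < l" "r \<le> s \<or> r \<le> t" for s t w
    unfolding X_def using that
    by (intro sum.neutral ballI) (auto simp: Low_def om2_def om_high)
  have X_hor: "X s t (a # w) = 0" if a: "a \<in> Hor r" and st: "s < l" "t < l" for s t a w
  proof -
    \<comment> \<open>Both sides expand the 3 by 3 determinant of \<open>om s\<close>,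
      \<open>om t\<close>, \<open>om r\<close> at \<open>a\<close>, \<open>b\<close>,
      \<open>e\<close>, along the last letter on the left and along the first on the right. After
      summation the right side vanishes because the tails are integrable, and the left side reduces
      to its first term by \<open>X_high\<close>. This is the closedness of
      \<open>X\<close>.\<close>
    have det: "om2 s t a b * om r e + om2 t r a b * om s e + om2 r s a b * om t e =
        om s a * om2 t r b e + om t a * om2 r s b e + om r a * om2 s t b e" for a b e
      unfolding om2_def by (simp add: algebra_simps)
    have z: "(\<Sum>b<N. \<Sum>e<N. \<kappa> (c (a # b # e # w)) * om2 s t b e) = 0"
      if "s < l" "t < l" for s t a
      using W_integrable[OF tails[of a] that, of "[]" w] by simp
    have "(\<Sum>e<N. X s t (e # w) * om r e) =
      (\<Sum>e<N. X s t (e # w) * om r e + X t r (e # w) * om s e + X r s (e # w) * om t e)"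
      using X_high st r by simp
    also have "\<dots> = (\<Sum>e<N. \<Sum>a<N. \<Sum>b<N. \<kappa> (c (a # b # e # w)) *
        (om2 s t a b * om r e + om2 t r a b * om s e + om2 r s a b * om t e))"
      by (simp add: X[symmetric] st r sum_distrib_right sum_distrib_left sum.distrib algebra_simps)
    also have "\<dots> = (\<Sum>a<N. \<Sum>b<N. \<Sum>e<N. \<kappa> (c (a # b # e # w)) *
        (om2 s t a b * om r e + om2 t r a b * om s e + om2 r s a b * om t e))"
      by (subst sum.swap) (intro sum.cong refl sum.swap)
    also have "\<dots> = (\<Sum>a<N. om s a * (\<Sum>b<N. \<Sum>e<N. \<kappa> (c (a # b # e # w)) * om2 t r b e) +
        om t a * (\<Sum>b<N. \<Sum>e<N. \<kappa> (c (a # b # e # w)) * om2 r s b e) +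
        om r a * (\<Sum>b<N. \<Sum>e<N. \<kappa> (c (a # b # e # w)) * om2 s t b e))"
      unfolding det by (simp add: sum_distrib_left sum.distrib algebra_simps)
    also have "\<dots> = 0"
      using z st r by simp
    finally have "(\<Sum>e<N. X s t (e # w) * om r e) = 0" .
    moreover have "(\<Sum>e<N. X s t (e # w) * om r e) = (\<Sum>e\<in>Hor r. X s t (e # w) * inverse (A e))"
    proof (rule sum_om_fibre[OF r])
      fix e assume "r < lev e"
      then have "c (a # b # e # w) = 0" for a b
        using W_support[OF tails[of a], of "b # e # w"] by fastforce
      then show "X s t (e # w) = 0" by (simp add: X_def)
    qed
    moreover have "del r (X s t v) = 0" for v
      unfolding X_def del_sum
      by (intro sum.neutral ballI) (simp add: del_mult om2_def del_diff del_om r st)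
    ultimately show ?thesis
      using simple_poles_independent(2)[OF r, of 0 "\<lambda>e. X s t (e # w)" a] a by (simp add: Hor_def)
  qed
  have "X s t w = 0" if st: "s < l" "t < l" for s t w
  proof (rule functional_separates)
    fix h :: "'f \<Rightarrow> 'k" assume h: "functional h"
    have hX: "h (X s t w) = (\<Sum>a\<in>Low r. \<Sum>b\<in>Low r. h (om2 s t a b) * v a (b # w))" for w
      by (simp add: X_def functional_sum[OF h] functional_scale[OF h] cL mult.commute)
    \<comment> \<open>After pairing with \<open>h\<close>, \<open>X\<close> is a
      \<open>k\<close>-combination of tails of the \<open>v a\<close>. Vanishing horizontal
      derivatives confine it to vertical words, where every \<open>v a\<close> is 0 by its
      normalisation.\<close>
    have "(\<lambda>w. h (X s t w)) \<in> W (Suc r) (m - 1)"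
      unfolding hX by (intro W_sum W_scale W_tail v(1))
    then have *: "(\<lambda>w. h (X s t w)) \<in> W r (m - 1)"
      by (rule W_vertical[OF r]) (simp add: X_hor st functional_0[OF h])
    show "h (X s t w) = 0"
    proof (rule ccontr)
      assume "h (X s t w) \<noteq> 0"
      then have "\<forall>e\<in>set w. lev e < r" using W_support[OF *] by blast
      then have "h (X s t w) = 0"
        unfolding hX by (intro sum.neutral ballI) (simp add: v(3) Low_def)
      with \<open>h (X s t w) \<noteq> 0\<close> show False by simp
    qed
  qed
  then have "c \<in> W (Suc r) (Suc m)"
    using tails letters X by (intro W_ConsI) auto
  then show ?case
    using cH by blast
qed

subsection \<open>The bar construction as a module with connection\<close>

text \<open>The tensor product of \<open>\<O> r\<close> with the integrable words, realised inside
  the functions from words to the field. One tensor may mix words of different lengths up to the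
  bound \<open>m\<close>.\<close>

inductive_set bar :: "nat \<Rightarrow> (nat list \<Rightarrow> 'f) set" for r :: nat where
  tensor: "\<phi> \<in> \<O> r \<Longrightarrow> c \<in> W r m \<Longrightarrow> (\<lambda>w. \<phi> * \<kappa> (c w)) \<in> bar r"
| add: "F \<in> bar r \<Longrightarrow> G \<in> bar r \<Longrightarrow> (\<lambda>w. F w + G w) \<in> bar r"

lemma bar_zero: "(\<lambda>_. 0) \<in> bar r"
  using bar.tensor[OF \<O>_0 W_zero] by simp

lemma bar_sum: "(\<And>i. i \<in> I \<Longrightarrow> F i \<in> bar r) \<Longrightarrow> (\<lambda>w. \<Sum>i\<in>I. F i w) \<in> bar r"
  by (induction I rule: infinite_finite_induct) (auto simp: bar_zero intro: bar.add)

lemma bar_scale: "F \<in> bar r \<Longrightarrow> (\<lambda>w. \<kappa> k * F w) \<in> bar r"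
proof (induction rule: bar.induct)
  case (tensor \<phi> c m)
  then show ?case
    using bar.tensor[OF \<O>.mult[OF \<O>.const[of k] tensor(1)] tensor(2)] by (simp add: mult.assoc)
qed (auto simp: distrib_left intro: bar.add)

lemma bar_mono: "r \<le> r' \<Longrightarrow> F \<in> bar r \<Longrightarrow> F \<in> bar r'"
proof -
  assume r: "r \<le> r'"
  show "F \<in> bar r \<Longrightarrow> F \<in> bar r'"
  proof (induction rule: bar.induct)
    case (tensor \<phi> c m)
    then show ?case using \<O>_mono[OF r] W_mono[OF r order_refl] by (blast intro: bar.tensor)
  qed (rule bar.add)
qed

lemma bar_bounds:
  "F \<in> bar r \<Longrightarrow> (\<forall>w. F w \<in> \<O> r) \<and> (\<exists>m. \<forall>h. functional h \<longrightarrow> (\<lambda>w. h (F w)) \<in> W r m)"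
proof (induction rule: bar.induct)
  case (tensor \<phi> c m)
  have "(\<lambda>w. h (\<phi> * \<kappa> (c w))) \<in> W r m" if "functional h" for h
    using W_scale[OF tensor(2), of "h \<phi>"] functional_scale[OF that, of _ \<phi>]
    by (simp add: mult.commute)
  then show ?case using tensor \<O>.mult \<O>.const by blast
next
  case (add F G)
  then obtain m n where *: "\<And>h. functional h \<Longrightarrow> (\<lambda>w. h (F w)) \<in> W r m"
    "\<And>h. functional h \<Longrightarrow> (\<lambda>w. h (G w)) \<in> W r n" by blast
  have "(\<lambda>w. h (F w + G w)) \<in> W r (max m n)" if "functional h" for h
    unfolding functional_add[OF that]
    by (intro W_add W_mono[OF order_refl _ *(1)[OF that]] W_mono[OF order_refl _ *(2)[OF that]]) auto
  then show ?case using add \<O>.add by blast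
qed

lemma support_from_functionals:
  assumes "\<And>h. functional h \<Longrightarrow> (\<lambda>w. h (F w)) \<in> W r m" "F w \<noteq> 0"
  shows "length w \<le> m \<and> (\<forall>a\<in>set w. a < N \<and> lev a < r)"
  using functional_separates[of "F w"] W_support[OF assms(1), of _ w] assms(2) by blast

text \<open>Converse of \<open>bar_bounds\<close>. The values of \<open>F\<close> are finitely many,
  since its words have bounded length; expanding in a basis of their span gives pure tensors whose
  word parts are functionals applied to \<open>F\<close>.\<close>

lemma bar_from_functionals:
  assumes F: "\<And>w. F w \<in> \<O> r" and W: "\<And>h. functional h \<Longrightarrow> (\<lambda>w. h (F w)) \<in> W r m"
  shows "F \<in> bar r"
proof -
  have "finite {w. set w \<subseteq> {..<N} \<and> length w \<le> m}"
    by (rule finite_lists_length_le) simp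
  then have "finite {w. F w \<noteq> 0}"
    by (rule rev_finite_subset) (use support_from_functionals[of F r m, OF W] in auto)
  then have "finite (insert 0 (F ` {w. F w \<noteq> 0}))" by simp
  then have "finite (range F)"
    by (rule rev_finite_subset) auto
  obtain B0 where B0: "B0 \<subseteq> range F" "vs.independent B0" "range F \<subseteq> vs.span B0"
    using vs.maximal_independent_subset by blast
  have fin: "finite B0" using B0(1) \<open>finite (range F)\<close> finite_subset by blast
  define B where "B = vs.extend_basis B0"
  have B: "vs.independent B" "vs.span B = UNIV" "B0 \<subseteq> B"
    using vs.independent_extend_basis[OF B0(2)] vs.span_extend_basis[OF B0(2)]
      vs.extend_basis_superset[OF B0(2)] by (auto simp: B_def)
  have "F w = (\<Sum>b\<in>B0. b * \<kappa> (vs.representation B (F w) b))" for w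
  proof -
    have s: "F w \<in> vs.span B0" using B0(3) by blast
    have "F w = (\<Sum>b\<in>B0. \<kappa> (vs.representation B0 (F w) b) * b)"
      using vs.sum_representation_eq[OF B0(2) s fin order_refl] by simp
    then show ?thesis
      using vs.representation_extend[OF B(1) s B(3)] by (simp add: mult.commute)
  qed
  then have "F = (\<lambda>w. \<Sum>b\<in>B0. b * \<kappa> (vs.representation B (F w) b))" by blast
  also have "\<dots> \<in> bar r"
  proof (intro bar_sum bar.tensor)
    show "b \<in> \<O> r" if "b \<in> B0" for b using that B0(1) F by auto
    show "(\<lambda>w. vs.representation B (F w) b) \<in> W r m" for b
      using W[OF functional_representation[OF B(1,2)]] .
  qed
  finally show ?thesis .
qed

text \<open>The differential of the bar construction strips the first letter of a word, so the
  coefficient at \<open>w\<close> collects terms from all words \<open>a # w\<close>.\<close>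

definition D :: "nat \<Rightarrow> (nat list \<Rightarrow> 'f) \<Rightarrow> nat list \<Rightarrow> 'f" where
  "D s F = (\<lambda>w. del s (F w) + (\<Sum>a<N. F (a # w) * om s a))"

lemma D_add: "D s (\<lambda>w. F w + G w) = (\<lambda>w. D s F w + D s G w)"
  by (auto simp: D_def del_add distrib_right sum.distrib)

lemma D_zero: "D s (\<lambda>_. 0) = (\<lambda>_. 0)"
  by (simp add: D_def)

lemma D_sum: "D s (\<lambda>w. \<Sum>i\<in>I. F i w) = (\<lambda>w. \<Sum>i\<in>I. D s (F i) w)"
  by (induction I rule: infinite_finite_induct) (simp_all add: D_zero D_add)

lemma D_scale: "D s (\<lambda>w. \<kappa> k * F w) = (\<lambda>w. \<kappa> k * D s F w)"
  by (simp add: D_def del_mult sum_distrib_left distrib_left mult.assoc)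

lemma D_tensor: "D s (\<lambda>w. \<phi> * \<kappa> (c w)) =
    (\<lambda>w. del s \<phi> * \<kappa> (c w) + (\<Sum>a<N. \<phi> * om s a * \<kappa> (c (a # w))))"
  by (simp add: D_def del_mult mult.assoc mult.commute[of "\<kappa> _" "om _ _"])

lemma bar_tail_om:
  assumes "r \<le> l" "s < l" "\<phi> \<in> \<O> r" "c \<in> W r m"
  shows "(\<lambda>w. \<phi> * om s a * \<kappa> (c (a # w))) \<in> bar r"
proof (cases "a < N \<and> lev a < r")
  case True
  then show ?thesis
    using assms by (intro bar.tensor[OF _ W_tail] \<O>.mult om_\<O>) auto
next
  case False
  then have "c (a # w) = 0" for w using W_support[OF assms(4), of "a # w"] by auto
  then show ?thesis by (simp add: bar_zero)
qed

lemma D_bar: "F \<in> bar r \<Longrightarrow> r \<le> l \<Longrightarrow> s < l \<Longrightarrow> D s F \<in> bar r"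
proof (induction rule: bar.induct)
  case (tensor \<phi> c m)
  then show ?case
    unfolding D_tensor by (intro bar.add bar.tensor[of _ _ c m] bar_sum bar_tail_om \<O>_del)
qed (simp add: D_add bar.add)

text \<open>Downward induction on the length of \<open>w\<close>. Once the coefficients of all
  longer words lie in \<open>\<O> r\<close>, the equation at \<open>w\<close> compares residues: the
  horizontal \<open>F (a # w)\<close> vanish and \<open>F w\<close> is constant along the fibre.
  Then \<open>W_vertical\<close> excludes horizontal letters at every position.\<close>

lemma bar_kernel:
  assumes r: "r < l" and F: "F \<in> bar (Suc r)" and DF: "D r F = (\<lambda>_. 0)"
  shows "F \<in> bar r"
proof -
  obtain m where FO: "\<And>w. F w \<in> \<O> (Suc r)"
    and W: "\<And>h. functional h \<Longrightarrow> (\<lambda>w. h (F w)) \<in> W (Suc r) m"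
    using bar_bounds[OF F] by blast
  have support: "F w = 0" if "\<not> (length w \<le> m \<and> (\<forall>a\<in>set w. a < N \<and> lev a < Suc r))" for w
    using support_from_functionals[of F "Suc r" m w, OF W] that by blast
  \<comment> \<open>For \<open>n = 0\<close> the word exceeds the maximal length \<open>m\<close>,
    so everything vanishes; the instance \<open>Suc m\<close> covers all words.\<close>
  have vanish: "F w \<in> \<O> r \<and> (\<forall>a\<in>Hor r. F (a # w) = 0)" if "m < length w + n" for w n
    using that
  proof (induction n arbitrary: w)
    case 0
    then show ?case using support[of w] support[of "_ # w"] by simp
  next
    case (Suc n)
    have IH: "F (a # w) \<in> \<O> r" for a using Suc.IH[of "a # w"] Suc.prems by simp
    have "(\<Sum>a<N. F (a # w) * om r a) = (\<Sum>a\<in>Hor r. F (a # w) * inverse (A a))"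
      by (rule sum_om_fibre[OF r]) (simp add: support)
    then have eq: "del r (F w) + 0 + (\<Sum>a | a < N \<and> lev a = r. F (a # w) * inverse (A a)) = 0"
      using fun_cong[OF DF, of w] by (simp add: D_def Hor_def)
    have z: "F (a # w) = 0" if "a < N" "lev a = r" for a
      by (rule residues_zero[OF r FO _ _ eq that]) (use \<O>_subset_consts[OF IH] r in auto)
    then have "del r (F w) = 0" using eq by simp
    then show ?case
      using \<O>_consts[OF r FO] z by (simp add: Hor_def)
  qed
  then have *: "F w \<in> \<O> r" "a \<in> Hor r \<Longrightarrow> F (a # w) = 0" for w a
    using vanish[of w "Suc m"] by auto
  show ?thesis
  proof (rule bar_from_functionals)
    show "(\<lambda>w. h (F w)) \<in> W r m" if "functional h" for h
      by (rule W_vertical[OF r W[OF that]]) (simp add: * functional_0[OF that])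
  qed (rule *)
qed

text \<open>For a tensor of \<open>\<phi>\<close> and \<open>c\<close>, induction on the word
  length. If \<open>\<psi>\<close> is a primitive of \<open>\<phi>\<close> up to simple poles, the
  tensor of \<open>\<psi>\<close> and \<open>c\<close> is a primitive up to those poles and up to
  terms with the shorter tails of \<open>c\<close>. The poles are integrated with the words from
  \<open>W_extension\<close>.\<close>

lemma bar_surjective:
  assumes r: "r < l" and "F \<in> bar (Suc r)"
  shows "\<exists>G\<in>bar (Suc r). D r G = F"
  using assms(2)
proof (induction rule: bar.induct)
  case (add F F')
  then obtain G G' where "G \<in> bar (Suc r)" "D r G = F" "G' \<in> bar (Suc r)" "D r G' = F'" by blast
  then show ?case by (intro bexI[of _ "\<lambda>w. G w + G' w"] bar.add) (auto simp: D_add)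
next
  case (tensor \<phi> c m)
  then show ?case
  proof (induction m arbitrary: \<phi> c rule: less_induct)
    case (less m)
    obtain \<psi> h where \<psi>: "\<psi> \<in> \<O> (Suc r)" and h: "\<And>a. h a \<in> \<O> r"
      and \<phi>: "\<phi> = del r \<psi> + (\<Sum>a\<in>Hor r. h a * inverse (A a))"
      using primitive_up_to_simple_poles[OF r less.prems(1)] unfolding Hor_def by blast
    have hc: "del r (h a) = 0" for a using \<O>_subset_consts[OF h] r by simp
    have "\<exists>G\<in>bar (Suc r). D r G = (\<lambda>w. h a * inverse (A a) * \<kappa> (c w))" if a: "a \<in> Hor r" for a
    proof -
      have "(\<lambda>w. if b = a then c w else 0) \<in> W (Suc r) m" for b
        using less.prems(2) W_zero by (cases "b = a") auto
      then obtain e where e: "e \<in> W (Suc r) (Suc m)"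
        "\<And>b w. b \<in> Hor r \<Longrightarrow> e (b # w) = (if b = a then c w else 0)"
        using W_extension[OF r, of "\<lambda>b w. if b = a then c w else 0" m] by auto
      have "(\<Sum>b<N. h a * om r b * \<kappa> (e (b # w))) = h a * inverse (A a) * \<kappa> (c w)" for w
      proof -
        have "(\<Sum>b<N. h a * om r b * \<kappa> (e (b # w))) = (\<Sum>b<N. (h a * \<kappa> (e (b # w))) * om r b)"
          by (simp add: algebra_simps)
        also have "\<dots> = (\<Sum>b\<in>Hor r. (h a * \<kappa> (e (b # w))) * inverse (A b))"
          using W_support[OF e(1)] by (intro sum_om_fibre[OF r]) force
        also have "\<dots> = (\<Sum>b\<in>Hor r. if b = a then h a * \<kappa> (c w) * inverse (A a) else 0)"
          by (rule sum.cong) (auto simp: e(2))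
        also have "\<dots> = h a * inverse (A a) * \<kappa> (c w)"
          using a by (simp add: mult.commute mult.left_commute)
        finally show ?thesis .
      qed
      then have "D r (\<lambda>w. h a * \<kappa> (e w)) = (\<lambda>w. h a * inverse (A a) * \<kappa> (c w))"
        unfolding D_tensor by (simp add: hc)
      then show ?thesis
        using bar.tensor[OF \<O>_Suc[OF h] e(1)] by blast
    qed
    then obtain G1 where G1: "\<And>a. a \<in> Hor r \<Longrightarrow> G1 a \<in> bar (Suc r)"
        "\<And>a. a \<in> Hor r \<Longrightarrow> D r (G1 a) = (\<lambda>w. h a * inverse (A a) * \<kappa> (c w))"
      by metis
    have "\<exists>G\<in>bar (Suc r). D r G = (\<lambda>w. \<psi> * om r a * \<kappa> (c (a # w)))" if a: "a < N" for a
    proof (cases "m = 0 \<or> r < lev a")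
      case True
      then have "c (a # w) = 0" for w using W_support[OF less.prems(2), of "a # w"] by force
      then show ?thesis by (intro bexI[of _ "\<lambda>_. 0"]) (auto simp: D_zero bar_zero)
    next
      case False
      then show ?thesis
        using \<psi> r a less.prems(2)
        by (intro less.IH[of "m - 1"] W_tail \<O>.mult om_\<O>) auto
    qed
    then obtain G2 where G2: "\<And>a. a < N \<Longrightarrow> G2 a \<in> bar (Suc r)"
        "\<And>a. a < N \<Longrightarrow> D r (G2 a) = (\<lambda>w. \<psi> * om r a * \<kappa> (c (a # w)))"
      by metis
    define G where "G = (\<lambda>w. (\<psi> * \<kappa> (c w) + \<kappa> (-1) * (\<Sum>a<N. G2 a w)) + (\<Sum>a\<in>Hor r. G1 a w))"
    have "G \<in> bar (Suc r)"
      unfolding G_def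
      by (intro bar.add bar.tensor[OF \<psi> less.prems(2)] bar_scale bar_sum G1 G2) auto
    moreover have "D r G = (\<lambda>w. \<phi> * \<kappa> (c w))"
      unfolding G_def D_add D_scale D_sum D_tensor \<phi>
      by (auto simp: G1 G2 \<kappa>_minus algebra_simps sum_distrib_left sum_distrib_right sum_negf)
    ultimately show ?case by blast
  qed
qed

text \<open>No letter has level below 0, so only the empty word remains, and \<open>\<O> 0\<close>
  consists of the constants.\<close>

lemma bar_0: "bar 0 = {\<lambda>w. if w = [] then \<kappa> k else 0 | k. True}"
proof (intro equalityI subsetI)
  fix F assume "F \<in> bar 0"
  then show "F \<in> {\<lambda>w. if w = [] then \<kappa> k else 0 | k. True}"
  proof (induction rule: bar.induct)
    case (tensor \<phi> c m)
    have "\<exists>k. \<phi> = \<kappa> k"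
      using tensor(1)
    proof (induction rule: \<O>.induct)
      case (add u v)
      then show ?case by (metis \<kappa>_add)
    next
      case (mult u v)
      then show ?case by (metis \<kappa>_mult)
    qed auto
    then obtain k where k: "\<phi> = \<kappa> k" by blast
    have "c w = 0" if "w \<noteq> []" for w
      using W_support[OF tensor(2), of w] that by (cases w) auto
    then have "(\<lambda>w. \<phi> * \<kappa> (c w)) = (\<lambda>w. if w = [] then \<kappa> (k * c []) else 0)"
      by (auto simp: k \<kappa>_mult)
    then show ?case by blast
  next
    case (add F G)
    then obtain k k' where "F = (\<lambda>w. if w = [] then \<kappa> k else 0)" "G = (\<lambda>w. if w = [] then \<kappa> k' else 0)"
      by blast
    then have "(\<lambda>w. F w + G w) = (\<lambda>w. if w = [] then \<kappa> (k + k') else 0)"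
      by (auto simp: \<kappa>_add)
    then show ?case by blast
  qed
next
  fix F :: "nat list \<Rightarrow> 'f" assume "F \<in> {\<lambda>w. if w = [] then \<kappa> k else 0 | k. True}"
  then obtain k where k: "F = (\<lambda>w. if w = [] then \<kappa> k else 0)" by blast
  have "(\<lambda>w. if w = [] then 1 else 0) \<in> W 0 0"
    by (auto simp: W_def)
  from bar.tensor[OF \<O>.const[of k] this] show "F \<in> bar 0"
    unfolding k by (simp add: if_distrib cong: if_cong)
qed

lemma del_commute: "u \<in> \<O> l \<Longrightarrow> s < l \<Longrightarrow> t < l \<Longrightarrow> del s (del t u) = del t (del s u)"
proof (induction rule: \<O>.induct)
  case (inv a)
  have *: "del s (del t (A a)) = 0" if "s < l" "t < l" for s t
    using del_A[OF inv(1) that(2)] by (simp add: del_minus)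
  have "del s (del t (inverse (A a))) =
      2 * del s (A a) * del t (A a) * inverse (A a) ^ 3" if "s < l" "t < l" for s t
    using that *[OF that] by (simp add: del_inverse del_mult del_minus power2_eq_square
        power3_eq_cube algebra_simps)
  then show ?case using inv by (simp add: algebra_simps)
qed (auto simp: del_y del_add del_mult algebra_simps)

lemma del_om_commute: "a < N \<Longrightarrow> s < l \<Longrightarrow> t < l \<Longrightarrow> del s (om t a) = del t (om s a)"
proof -
  assume a: "a < N" "s < l" "t < l"
  have *: "del s (del t (A a)) = 0" if "s < l" "t < l" for s t
    using del_A[OF a(1) that(2)] by (simp add: del_minus)
  show ?thesis
    using a by (simp add: om_def del_mult * del_inverse algebra_simps)
qed

text \<open>Integrability is flatness of the connection \<open>D\<close>.\<close>

lemma D_commute: "F \<in> bar l \<Longrightarrow> s < l \<Longrightarrow> t < l \<Longrightarrow> D s (D t F) = D t (D s F)"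
proof (induction rule: bar.induct)
  case (tensor \<phi> c m)
  have DD: "D s (D t (\<lambda>w. \<phi> * \<kappa> (c w))) w =
      (del s (del t \<phi>) * \<kappa> (c w) + (\<Sum>a<N. (del t \<phi> * om s a + del s \<phi> * om t a) * \<kappa> (c (a # w))) +
       (\<Sum>a<N. \<phi> * del s (om t a) * \<kappa> (c (a # w)))) +
      \<phi> * (\<Sum>a<N. \<Sum>b<N. \<kappa> (c (a # b # w)) * (om t a * om s b))" for s t w
  proof -
    have sw: "(\<Sum>b<N. \<Sum>a<N. \<phi> * om t a * om s b * \<kappa> (c (a # b # w))) =
      \<phi> * (\<Sum>a<N. \<Sum>b<N. \<kappa> (c (a # b # w)) * (om t a * om s b))"
      by (subst sum.swap) (simp add: sum_distrib_left algebra_simps)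
    show ?thesis
      unfolding sw[symmetric] unfolding D_tensor D_add D_sum
      by (subst sum.swap) (simp add: D_tensor del_mult sum.distrib algebra_simps)
  qed
  show ?case
  proof
    fix w
    have "(\<Sum>a<N. \<Sum>b<N. \<kappa> (c (a # b # w)) * om2 s t a b) = 0"
      using W_integrable[OF tensor(2-4), of "[]" w] by simp
    then have "(\<Sum>a<N. \<Sum>b<N. \<kappa> (c (a # b # w)) * (om t a * om s b)) =
        (\<Sum>a<N. \<Sum>b<N. \<kappa> (c (a # b # w)) * (om s a * om t b))"
      by (simp add: om2_def right_diff_distrib sum_subtractf)
    moreover have "(\<Sum>a<N. \<phi> * del s (om t a) * \<kappa> (c (a # w))) =
        (\<Sum>a<N. \<phi> * del t (om s a) * \<kappa> (c (a # w)))"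
      by (rule sum.cong) (simp_all add: del_om_commute tensor)
    moreover have "(\<Sum>a<N. (del t \<phi> * om s a + del s \<phi> * om t a) * \<kappa> (c (a # w))) =
        (\<Sum>a<N. (del s \<phi> * om t a + del t \<phi> * om s a) * \<kappa> (c (a # w)))"
      by (simp add: add.commute)
    ultimately show "D s (D t (\<lambda>w. \<phi> * \<kappa> (c w))) w = D t (D s (\<lambda>w. \<phi> * \<kappa> (c w))) w"
      unfolding DD by (simp add: del_commute[OF tensor(1,3,4)])
  qed
qed (simp add: D_add)

end

section \<open>The Koszul complex of a flat connection\<close>

definition even_below :: "nat \<Rightarrow> nat set \<Rightarrow> bool" where
  "even_below i T \<longleftrightarrow> even (card {j \<in> T. j < i})"

text \<open>The sign acts by negation, since the coefficients of forms will be elements of a bar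
  module, which has no multiplication.\<close>

definition sg :: "nat \<Rightarrow> nat set \<Rightarrow> 'b \<Rightarrow> 'b::ab_group_add" where
  "sg i T x = (if even_below i T then x else - x)"

text \<open>Exterior multiplication by \<open>dx_i\<close> from the left; \<open>contract_dx\<close>
  is contraction with the coordinate vector. Both carry the same sign because \<open>T\<close> has
  equally many elements below \<open>i\<close> with or without \<open>i\<close> itself.\<close>

definition wedge_dx :: "nat \<Rightarrow> (nat set \<Rightarrow> 'b) \<Rightarrow> nat set \<Rightarrow> 'b::ab_group_add" where
  "wedge_dx i \<Phi> T = (if i \<in> T then sg i T (\<Phi> (T - {i})) else 0)"

definition contract_dx :: "nat \<Rightarrow> (nat set \<Rightarrow> 'b) \<Rightarrow> nat set \<Rightarrow> 'b::ab_group_add" where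
  "contract_dx i \<Phi> T = (if i \<in> T then 0 else sg i T (\<Phi> (insert i T)))"

lemma sg_0 [simp]: "sg i T 0 = 0"
  by (simp add: sg_def)

lemma even_below_insert: "j \<notin> T \<Longrightarrow> even_below i (insert j T) \<longleftrightarrow> (even_below i T \<longleftrightarrow> \<not> j < i)"
proof (cases "j < i")
  case True
  assume "j \<notin> T"
  moreover from True have "{k \<in> insert j T. k < i} = insert j {k \<in> T. k < i}" by auto
  ultimately show ?thesis using True by (simp add: even_below_def)
next
  case False
  then have "{k \<in> insert j T. k < i} = {k \<in> T. k < i}" by auto
  then show ?thesis using False by (simp add: even_below_def)
qed

lemma even_below_remove: "j \<in> T \<Longrightarrow> even_below i (T - {j}) \<longleftrightarrow> (even_below i T \<longleftrightarrow> \<not> j < i)"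
  using even_below_insert[of j "T - {j}" i] by (auto simp: insert_absorb)

text \<open>The Clifford relation. For different \<open>i\<close> and \<open>j\<close> exactly one
  of the two orders picks up an extra sign, depending on which index is smaller.\<close>

lemma ext_con: "wedge_dx i (contract_dx j \<Phi>) T + contract_dx j (wedge_dx i \<Phi>) T = (if i = j then \<Phi> T else 0)"
proof (cases "i = j")
  case True
  then show ?thesis
    by (auto simp: wedge_dx_def contract_dx_def sg_def even_below_insert even_below_remove insert_absorb)
next
  case False
  have *: "insert j (T - {i}) = insert j T - {i}" using False by auto
  show ?thesis
    using False by (auto simp: wedge_dx_def contract_dx_def sg_def even_below_insert even_below_remove *)
qed

lemma con_con: "contract_dx i (contract_dx j \<Phi>) T + contract_dx j (contract_dx i \<Phi>) T = 0"
proof (cases "i = j")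
  case True
  then show ?thesis by (auto simp: contract_dx_def sg_def)
next
  case False
  have *: "insert j (insert i T) = insert i (insert j T)" by auto
  show ?thesis
    using False by (auto simp: contract_dx_def sg_def even_below_insert *)
qed

lemma ext_ext: "wedge_dx i (wedge_dx j \<Phi>) T + wedge_dx j (wedge_dx i \<Phi>) T = 0"
proof (cases "i = j")
  case True
  then show ?thesis by (auto simp: wedge_dx_def sg_def)
next
  case False
  have *: "T - {j} - {i} = T - {i} - {j}" by auto
  show ?thesis
    using False by (auto simp: wedge_dx_def sg_def even_below_remove *)
qed

text \<open>\<open>D s\<close> is the covariant derivative along the frame vector with coordinates \<open>E s\<close>, and \<open>Y\<close>
  is the dual frame, so that \<open>\<Sum>\<^sub>s Y s i *v D s\<close> is the derivative along the \<open>i\<close>-th coordinate.\<close>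

locale koszul_tower = vector_space scale
  for scale :: "'k::field_char_0 \<Rightarrow> 'b::ab_group_add \<Rightarrow> 'b" (infixr \<open>*v\<close> 75) +
  fixes l :: nat and D :: "nat \<Rightarrow> 'b \<Rightarrow> 'b" and B :: "nat \<Rightarrow> 'b set"
    and Y E :: "nat \<Rightarrow> nat \<Rightarrow> 'k"
  assumes D_add: "D s (x + y) = D s x + D s y"
    and D_scale: "D s (c *v x) = c *v D s x"
    and B_subspace: "subspace (B r)"
    and B_mono: "r \<le> r' \<Longrightarrow> B r \<subseteq> B r'"
    and D_B: "s < l \<Longrightarrow> x \<in> B l \<Longrightarrow> D s x \<in> B l"
    and D_comm: "s < l \<Longrightarrow> t < l \<Longrightarrow> x \<in> B l \<Longrightarrow> D s (D t x) = D t (D s x)"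
    and D_const: "x \<in> B r \<Longrightarrow> r \<le> s \<Longrightarrow> s < l \<Longrightarrow> D s x = 0"
    and D_surj: "r < l \<Longrightarrow> x \<in> B (Suc r) \<Longrightarrow> \<exists>z\<in>B (Suc r). D r z = x"
    and D_kernel: "r < l \<Longrightarrow> x \<in> B (Suc r) \<Longrightarrow> D r x = 0 \<Longrightarrow> x \<in> B r"
    and dual1: "i < l \<Longrightarrow> j < l \<Longrightarrow> (\<Sum>s<l. Y s i * E s j) = (if i = j then 1 else 0)"
    and dual2: "s < l \<Longrightarrow> t < l \<Longrightarrow> (\<Sum>i<l. Y s i * E t i) = (if s = t then 1 else 0)"
begin

lemma B_0: "0 \<in> B r" and B_add: "x \<in> B r \<Longrightarrow> z \<in> B r \<Longrightarrow> x + z \<in> B r"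
  and B_scale: "x \<in> B r \<Longrightarrow> c *v x \<in> B r"
  and B_sum: "(\<And>i. i \<in> S \<Longrightarrow> h i \<in> B r) \<Longrightarrow> sum h S \<in> B r"
  and B_minus: "x \<in> B r \<Longrightarrow> - x \<in> B r"
  using B_subspace by (auto simp: subspace_0 subspace_add subspace_scale
      subspace_neg intro: subspace_sum)

lemma B_char: "r \<le> l \<Longrightarrow> x \<in> B l \<Longrightarrow> (\<And>s. r \<le> s \<Longrightarrow> s < l \<Longrightarrow> D s x = 0) \<Longrightarrow> x \<in> B r"
  by (induction rule: inc_induct) (auto intro: D_kernel)

lemma D_linear: "Vector_Spaces.linear scale scale (D s)"
  by unfold_locales (auto simp: D_add D_scale)

definition additive :: "('b \<Rightarrow> 'b) \<Rightarrow> bool" where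
  "additive h \<longleftrightarrow> (\<forall>x z. h (x + z) = h x + h z) \<and> (\<forall>c x. h (c *v x) = c *v h x)"

lemma additive_D: "additive (D s)"
  by (simp add: additive_def D_add D_scale)

lemma additive_0: "additive h \<Longrightarrow> h 0 = 0"
  unfolding additive_def by (metis add_cancel_right_right)

lemma additive_minus: "additive h \<Longrightarrow> h (- x) = - h x"
  using additive_0 unfolding additive_def by (metis add.right_inverse add_eq_0_iff)

lemma additive_sum: "additive h \<Longrightarrow> h (sum f S) = (\<Sum>i\<in>S. h (f i))"
  by (induction S rule: infinite_finite_induct) (auto simp: additive_0, simp add: additive_def)

lemma ext_additive: "additive h \<Longrightarrow> wedge_dx i (\<lambda>T. h (\<Phi> T)) T = h (wedge_dx i \<Phi> T)"
  by (simp add: wedge_dx_def sg_def additive_0 additive_minus)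

lemma con_additive: "additive h \<Longrightarrow> contract_dx i (\<lambda>T. h (\<Phi> T)) T = h (contract_dx i \<Phi> T)"
  by (simp add: contract_dx_def sg_def additive_0 additive_minus)

lemma ext_scale: "wedge_dx i (\<lambda>T. c *v \<Phi> T) T = c *v wedge_dx i \<Phi> T"
  and con_scale: "contract_dx i (\<lambda>T. c *v \<Phi> T) T = c *v contract_dx i \<Phi> T"
  by (simp_all add: wedge_dx_def contract_dx_def sg_def)

lemma ext_add: "wedge_dx i (\<lambda>T. \<Phi> T + \<Psi> T) T = wedge_dx i \<Phi> T + wedge_dx i \<Psi> T"
  by (simp add: wedge_dx_def sg_def)

lemma ext_sum: "wedge_dx i (\<lambda>T. \<Sum>k\<in>S. \<Phi> k T) T = (\<Sum>k\<in>S. wedge_dx i (\<Phi> k) T)"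
  and con_sum: "contract_dx i (\<lambda>T. \<Sum>k\<in>S. \<Phi> k T) T = (\<Sum>k\<in>S. contract_dx i (\<Phi> k) T)"
  by (simp_all add: wedge_dx_def contract_dx_def sg_def sum_negf)

text \<open>Multiplication by the covector \<open>dy_s\<close> with coordinates \<open>Y s\<close>;
  \<open>Con s\<close> is contraction with the frame vector \<open>E s\<close>. The coordinates are
  scalars, hence both commute with \<open>k\<close>-linear maps of the coefficients.\<close>

definition Ext :: "nat \<Rightarrow> (nat set \<Rightarrow> 'b) \<Rightarrow> nat set \<Rightarrow> 'b" where
  "Ext s \<Phi> T = (\<Sum>i<l. Y s i *v wedge_dx i \<Phi> T)"

definition Con :: "nat \<Rightarrow> (nat set \<Rightarrow> 'b) \<Rightarrow> nat set \<Rightarrow> 'b" where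
  "Con s \<Phi> T = (\<Sum>i<l. E s i *v contract_dx i \<Phi> T)"

lemma Ext_additive: "additive h \<Longrightarrow> Ext s (\<lambda>T. h (\<Phi> T)) T = h (Ext s \<Phi> T)"
  and Con_additive: "additive h \<Longrightarrow> Con s (\<lambda>T. h (\<Phi> T)) T = h (Con s \<Phi> T)"
  by (simp_all add: Ext_def Con_def ext_additive con_additive additive_sum)
     (simp_all add: additive_def)

lemma Ext_add: "Ext s (\<lambda>T. \<Phi> T + \<Psi> T) T = Ext s \<Phi> T + Ext s \<Psi> T"
  by (simp add: Ext_def  ext_add scale_right_distrib sum.distrib)

lemma Con_zero: "Con s (\<lambda>_. 0) T = 0"
  by (simp add: Con_def contract_dx_def cong: if_cong)

lemma Ext_sum: "Ext s (\<lambda>T. \<Sum>k\<in>S. \<Phi> k T) T = (\<Sum>k\<in>S. Ext s (\<Phi> k) T)"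
  and Con_sum: "Con s (\<lambda>T. \<Sum>k\<in>S. \<Phi> k T) T = (\<Sum>k\<in>S. Con s (\<Phi> k) T)"
  unfolding Ext_def Con_def ext_sum con_sum scale_sum_right by (rule sum.swap)+

lemma Ext_Con:
  assumes "s < l" "t < l"
  shows "Ext s (Con t \<Phi>) T + Con t (Ext s \<Phi>) T = (if s = t then \<Phi> T else 0)"
proof -
  have "Ext s (Con t \<Phi>) T = (\<Sum>i<l. \<Sum>j<l. (Y s i * E t j) *v wedge_dx i (contract_dx j \<Phi>) T)"
    unfolding Ext_def Con_def[abs_def] ext_sum ext_scale by (simp add: scale_sum_right)
  moreover have "Con t (Ext s \<Phi>) T = (\<Sum>i<l. \<Sum>j<l. (Y s i * E t j) *v contract_dx j (wedge_dx i \<Phi>) T)"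
    unfolding Con_def Ext_def[abs_def] con_sum con_scale
    by (subst sum.swap) (simp add: scale_sum_right mult.commute)
  ultimately have "Ext s (Con t \<Phi>) T + Con t (Ext s \<Phi>) T =
      (\<Sum>i<l. \<Sum>j<l. (Y s i * E t j) *v (if i = j then \<Phi> T else 0))"
    by (simp add: sum.distrib[symmetric] scale_right_distrib[symmetric] ext_con)
  also have "\<dots> = (\<Sum>i<l. \<Sum>j<l. if j = i then (Y s i * E t i) *v \<Phi> T else 0)"
    by (intro sum.cong refl) auto
  also have "\<dots> = (\<Sum>i<l. Y s i * E t i) *v \<Phi> T"
    by (simp add: scale_sum_left)
  finally show ?thesis using dual2[OF assms] by simp
qed

lemma Con_Con: "Con s (Con t \<Phi>) T = - Con t (Con s \<Phi>) T"
proof -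
  have "Con s (Con t \<Phi>) T = (\<Sum>i<l. \<Sum>j<l. (E s i * E t j) *v contract_dx i (contract_dx j \<Phi>) T)" for s t
    unfolding Con_def[of s] Con_def[of t, abs_def] con_sum con_scale by (simp add: scale_sum_right)
  moreover have "(\<Sum>i<l. \<Sum>j<l. (E t i * E s j) *v contract_dx i (contract_dx j \<Phi>) T) =
      (\<Sum>i<l. \<Sum>j<l. (E s i * E t j) *v contract_dx j (contract_dx i \<Phi>) T)"
    by (subst sum.swap) (simp add: mult.commute)
  ultimately have "Con s (Con t \<Phi>) T + Con t (Con s \<Phi>) T = 0"
    by (simp add: sum.distrib[symmetric] scale_right_distrib[symmetric] con_con)
  then show ?thesis by (simp add: eq_neg_iff_add_eq_0)
qed

lemma Ext_Ext: "Ext s (Ext t \<Phi>) T = - Ext t (Ext s \<Phi>) T"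
proof -
  have "Ext s (Ext t \<Phi>) T = (\<Sum>i<l. \<Sum>j<l. (Y s i * Y t j) *v wedge_dx i (wedge_dx j \<Phi>) T)" for s t
    unfolding Ext_def[of s] Ext_def[of t, abs_def] ext_sum ext_scale by (simp add: scale_sum_right)
  moreover have "(\<Sum>i<l. \<Sum>j<l. (Y t i * Y s j) *v wedge_dx i (wedge_dx j \<Phi>) T) =
      (\<Sum>i<l. \<Sum>j<l. (Y s i * Y t j) *v wedge_dx j (wedge_dx i \<Phi>) T)"
    by (subst sum.swap) (simp add: mult.commute)
  ultimately have "Ext s (Ext t \<Phi>) T + Ext t (Ext s \<Phi>) T = 0"
    by (simp add: sum.distrib[symmetric] scale_right_distrib[symmetric] ext_ext)
  then show ?thesis by (simp add: eq_neg_iff_add_eq_0)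
qed

lemma self_neg_zero: "x = - x \<Longrightarrow> x = (0::'b)"
proof -
  assume "x = - x"
  then have "x + x = 0" by (metis add.right_inverse)
  then have "(2::'k) *v x = 0"
    using scale_left_distrib[of 1 1 x] by simp
  then show ?thesis by simp
qed

section \<open>The differential, Cartan's formula and the Poincare lemma\<close>

definition dd :: "(nat set \<Rightarrow> 'b) \<Rightarrow> nat set \<Rightarrow> 'b" where
  "dd \<Phi> T = (\<Sum>s<l. Ext s (\<lambda>T. D s (\<Phi> T)) T)"

lemma dd_add: "dd (\<lambda>T. \<Phi> T + \<Psi> T) T = dd \<Phi> T + dd \<Psi> T"
  by (simp add: dd_def D_add Ext_add sum.distrib)

lemma dd_zero: "dd (\<lambda>_. 0) T = 0"
  by (simp add: dd_def additive_0[OF additive_D] Ext_def wedge_dx_def sg_def cong: if_cong)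

text \<open>The frame is constant, so the Lie derivative along its \<open>t\<close>-th vector is
  \<open>D t\<close> on each coefficient; the formula is \<open>Ext_Con\<close> summed over the
  frame.\<close>

lemma cartan:
  assumes "t < l"
  shows "dd (Con t \<Phi>) T + Con t (dd \<Phi>) T = D t (\<Phi> T)"
proof -
  have "dd (Con t \<Phi>) T = (\<Sum>s<l. Ext s (Con t (\<lambda>T. D s (\<Phi> T))) T)"
    unfolding dd_def Con_additive[OF additive_D, symmetric] by simp
  moreover have "Con t (dd \<Phi>) T = (\<Sum>s<l. Con t (Ext s (\<lambda>T. D s (\<Phi> T))) T)"
    unfolding dd_def[abs_def] Con_sum by simp
  ultimately have "dd (Con t \<Phi>) T + Con t (dd \<Phi>) T = (\<Sum>s<l. if s = t then D s (\<Phi> T) else 0)"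
    using assms by (simp add: sum.distrib[symmetric] Ext_Con)
  then show ?thesis using assms by simp
qed

text \<open>Flatness makes second derivatives symmetric while the \<open>Ext\<close> anticommute, so
  the double sum equals its own negative.\<close>

lemma dd_dd:
  assumes "\<And>T. \<Phi> T \<in> B l"
  shows "dd (dd \<Phi>) T = 0"
proof (rule self_neg_zero)
  have *: "dd (dd \<Phi>) T = (\<Sum>s<l. \<Sum>t<l. Ext s (Ext t (\<lambda>T. D s (D t (\<Phi> T)))) T)"
    unfolding dd_def additive_sum[OF additive_D] Ext_additive[OF additive_D, symmetric] Ext_sum ..
  also have "\<dots> = (\<Sum>s<l. \<Sum>t<l. Ext t (Ext s (\<lambda>T. D t (D s (\<Phi> T)))) T)"
    by (rule sum.swap)
  also have "\<dots> = (\<Sum>s<l. \<Sum>t<l. - Ext s (Ext t (\<lambda>T. D s (D t (\<Phi> T)))) T)"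
    using D_comm assms by (intro sum.cong refl) (subst Ext_Ext, simp)
  also have "\<dots> = - dd (dd \<Phi>) T"
    unfolding * by (simp add: sum_negf)
  finally show "dd (dd \<Phi>) T = - dd (dd \<Phi>) T" .
qed

text \<open>Only the coefficients are restricted to \<open>B r\<close>: the index sets refer to the
  original \<open>dx_i\<close>, not to the adapted \<open>dy_s\<close>. That a form does not contain
  \<open>dy_s\<close> is expressed by the vanishing of \<open>Con s\<close>.\<close>

definition Forms :: "nat \<Rightarrow> nat \<Rightarrow> (nat set \<Rightarrow> 'b) set" where
  "Forms r j = {\<Phi>. \<forall>T. \<Phi> T \<in> B r \<and> (\<Phi> T \<noteq> 0 \<longrightarrow> T \<subseteq> {..<l} \<and> card T = j)}"

lemma sg_B: "x \<in> B r \<Longrightarrow> sg i T x \<in> B r"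
  by (simp add: sg_def B_minus)

lemma Con_Forms:
  assumes "\<Phi> \<in> Forms r (Suc j)"
  shows "Con s \<Phi> \<in> Forms r j"
proof -
  have B: "\<Phi> T \<in> B r" for T using assms by (simp add: Forms_def)
  have "T \<subseteq> {..<l} \<and> card T = j" if nz: "Con s \<Phi> T \<noteq> 0" for T
  proof -
    obtain i where i: "i < l" "contract_dx i \<Phi> T \<noteq> 0"
      using sum.not_neutral_contains_not_neutral[OF nz[unfolded Con_def]] by auto
    then have *: "i \<notin> T" "\<Phi> (insert i T) \<noteq> 0"
      by (auto simp: contract_dx_def sg_def split: if_splits)
    then have "insert i T \<subseteq> {..<l}" "card (insert i T) = Suc j"
      using assms by (auto simp: Forms_def)
    then show ?thesis
      using *(1) finite_subset[of "insert i T" "{..<l}"] by auto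
  qed
  moreover have "Con s \<Phi> T \<in> B r" for T
    unfolding Con_def contract_dx_def by (auto intro!: B_sum B_scale sg_B B B_0)
  ultimately show ?thesis by (simp add: Forms_def)
qed

lemma dd_Forms:
  assumes "\<Phi> \<in> Forms l j"
  shows "dd \<Phi> \<in> Forms l (Suc j)"
proof -
  have B: "\<Phi> T \<in> B l" for T using assms by (simp add: Forms_def)
  have "T \<subseteq> {..<l} \<and> card T = Suc j" if nz: "dd \<Phi> T \<noteq> 0" for T
  proof -
    obtain s where s: "Ext s (\<lambda>T. D s (\<Phi> T)) T \<noteq> 0"
      using sum.not_neutral_contains_not_neutral[OF nz[unfolded dd_def]] by auto
    then obtain i where i: "i < l" "wedge_dx i (\<lambda>T. D s (\<Phi> T)) T \<noteq> 0"
      using sum.not_neutral_contains_not_neutral[OF s[unfolded Ext_def]] by auto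
    then have "i \<in> T" "\<Phi> (T - {i}) \<noteq> 0"
      using additive_0[OF additive_D] by (auto simp: wedge_dx_def sg_def split: if_splits)
    moreover from this have "T - {i} \<subseteq> {..<l}" "card (T - {i}) = j"
      using assms by (auto simp: Forms_def)
    moreover from calculation have "finite T"
      using finite_subset[of "T - {i}" "{..<l}"] by simp
    ultimately show ?thesis
      using i(1) card_Suc_Diff1[of T i] by (intro conjI subsetI) force+
  qed
  moreover have "dd \<Phi> T \<in> B l" for T
    unfolding dd_def Ext_def wedge_dx_def by (auto intro!: B_sum B_scale sg_B D_B B B_0)
  ultimately show ?thesis by (simp add: Forms_def)
qed

text \<open>Coordinate contractions are combinations of the frame contractions, and a nonzero
  coefficient at \<open>T\<close> survives contraction with an \<open>i\<close> in \<open>T\<close>;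
  positive degree provides such an \<open>i\<close>.\<close>

lemma Con_zero_imp_zero:
  assumes "\<Phi> \<in> Forms r (Suc j)" "\<And>s T. s < l \<Longrightarrow> Con s \<Phi> T = 0"
  shows "\<Phi> T = 0"
proof (rule ccontr)
  assume nz: "\<Phi> T \<noteq> 0"
  then have T: "T \<subseteq> {..<l}" "card T = Suc j" using assms(1) by (auto simp: Forms_def)
  then obtain i where i: "i \<in> T" by fastforce
  then have il: "i < l" using T by auto
  have "(\<Sum>s<l. Y s i *v Con s \<Phi> (T - {i})) = (\<Sum>j<l. \<Sum>s<l. (Y s i * E s j) *v contract_dx j \<Phi> (T - {i}))"
    unfolding Con_def by (subst sum.swap) (simp add: scale_sum_right)
  also have "\<dots> = (\<Sum>j<l. (\<Sum>s<l. Y s i * E s j) *v contract_dx j \<Phi> (T - {i}))"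
    by (simp add: scale_sum_left)
  also have "\<dots> = (\<Sum>j<l. if j = i then contract_dx i \<Phi> (T - {i}) else 0)"
    using dual1[OF il] by (intro sum.cong refl) auto
  also have "\<dots> = contract_dx i \<Phi> (T - {i})" using il by simp
  finally have "contract_dx i \<Phi> (T - {i}) = 0"
    using assms(2) by simp
  then show False
    using nz i by (simp add: contract_dx_def sg_def insert_absorb split: if_splits)
qed

text \<open>Integrating along the fibre coordinate \<open>y\<^sub>r\<close> with a linear section of \<open>D r\<close> makes a closed
  form independent of \<open>y\<^sub>r\<close> and \<open>dy\<^sub>r\<close>.\<close>

lemma poincare_step:
  assumes "r \<le> l" "\<Phi> \<in> Forms r (Suc j)" "\<And>T. dd \<Phi> T = 0"
    and "\<And>s T. r \<le> s \<Longrightarrow> s < l \<Longrightarrow> Con s \<Phi> T = 0"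
  shows "\<exists>\<Psi>\<in>Forms l j. \<forall>T. dd \<Psi> T = \<Phi> T"
  using assms
proof (induction r arbitrary: \<Phi>)
  case 0
  then have "\<Phi> T = 0" for T using Con_zero_imp_zero by blast
  then show ?case
    by (intro bexI[of _ "\<lambda>_. 0"]) (auto simp: dd_zero Forms_def B_0)
next
  case (Suc r)
  have r: "r < l" using Suc.prems by simp
  interpret vp: vector_space_pair scale scale by unfold_locales
  \<comment> \<open>Being \<open>k\<close>-linear, the section commutes with every
    \<open>Con s\<close>, so it introduces no \<open>dy_s\<close> that \<open>\<Phi>\<close> does
    not contain.\<close>
  obtain \<sigma> where \<sigma>: "range \<sigma> \<subseteq> B (Suc r)" "Vector_Spaces.linear scale scale \<sigma>"
      "\<And>v. v \<in> D r ` B (Suc r) \<Longrightarrow> D r (\<sigma> v) = v"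
    using vp.linear_exists_right_inverse_on[OF D_linear[of r] B_subspace[of "Suc r"]] by blast
  have \<sigma>_add: "additive \<sigma>"
    using vp.linear_add[OF \<sigma>(2)] vp.linear_scale[OF \<sigma>(2)] by (simp add: additive_def)
  define \<Theta> where "\<Theta> T = \<sigma> (\<Phi> T)" for T
  have \<Theta>B: "\<Theta> T \<in> B (Suc r)" for T using \<sigma>(1) by (auto simp: \<Theta>_def)
  have "\<Theta> T \<noteq> 0 \<longrightarrow> \<Phi> T \<noteq> 0" for T using additive_0[OF \<sigma>_add] by (auto simp: \<Theta>_def)
  then have \<Theta>: "\<Theta> \<in> Forms (Suc r) (Suc j)"
    using Suc.prems(2) \<Theta>B by (simp add: Forms_def)
  have \<Theta>l: "\<Theta> \<in> Forms l (Suc j)"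
    using \<Theta> B_mono[of "Suc r" l] r by (auto simp: Forms_def)
  define \<Psi> where "\<Psi> = Con r \<Theta>"
  have \<Psi>: "\<Psi> \<in> Forms l j" unfolding \<Psi>_def by (rule Con_Forms[OF \<Theta>l])
  define \<Phi>' where "\<Phi>' = Con r (dd \<Theta>)"
  have "D r (\<Theta> T) = \<Phi> T" for T
  proof -
    have "\<Phi> T \<in> D r ` B (Suc r)"
      using D_surj[OF r, of "\<Phi> T"] Suc.prems(2) unfolding Forms_def by force
    then show ?thesis unfolding \<Theta>_def by (rule \<sigma>(3))
  qed
  \<comment> \<open>Cartan's formula for \<open>\<Theta>\<close>, together with
    \<open>D r (\<Theta> T) = \<Phi> T\<close>, splits \<open>\<Phi>\<close> into an exact form and
    the rest \<open>\<Phi>'\<close>.\<close>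
  then have split: "dd \<Psi> T + \<Phi>' T = \<Phi> T" for T
    using cartan[OF r, of \<Theta> T] by (simp add: \<Psi>_def \<Phi>'_def)
  have Con0: "Con s \<Phi>' T = 0" if s: "r \<le> s" "s < l" for s T
  proof (cases "s = r")
    case True
    then show ?thesis unfolding \<Phi>'_def using Con_Con self_neg_zero by blast
  next
    case False
    then have s': "Suc r \<le> s" using s by simp
    have "Con s (dd \<Theta>) T = 0" for T
    proof -
      have "Con s \<Theta> = (\<lambda>_. 0)"
        unfolding \<Theta>_def[abs_def]
        by (intro ext) (simp add: Con_additive[OF \<sigma>_add] Suc.prems(4)[OF s' s(2)] additive_0[OF \<sigma>_add])
      then show ?thesis
        using cartan[OF s(2), of \<Theta> T] D_const[OF \<Theta>B s' s(2)] by (simp add: dd_zero)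
    qed
    then have "Con s (dd \<Theta>) = (\<lambda>_. 0)" by blast
    then show ?thesis
      unfolding \<Phi>'_def by (subst Con_Con) (simp add: Con_zero)
  qed
  have eq: "(\<lambda>T. dd \<Psi> T + \<Phi>' T) = \<Phi>" using split by blast
  have dd0: "dd \<Phi>' T = 0" for T
    using dd_add[of "dd \<Psi>" \<Phi>' T] dd_dd[of \<Psi> T] \<Psi> Suc.prems(3)[of T]
    unfolding eq by (simp add: Forms_def)
  have l: "\<Phi>' \<in> Forms l (Suc j)"
    unfolding \<Phi>'_def by (rule Con_Forms[OF dd_Forms[OF \<Theta>l]])
  \<comment> \<open>By Cartan's formula a closed form without \<open>dy_s\<close> has coefficients
    killed by \<open>D s\<close>; this moves the coefficients of \<open>\<Phi>'\<close> down to
    \<open>B r\<close>.\<close>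
  have "\<Phi>' T \<in> B r" for T
  proof (rule B_char)
    show "D s (\<Phi>' T) = 0" if s: "r \<le> s" "s < l" for s
    proof -
      have "Con s \<Phi>' = (\<lambda>_. 0)" using Con0[OF s] by blast
      moreover have "dd \<Phi>' = (\<lambda>_. 0)" using dd0 by blast
      ultimately show ?thesis
        using cartan[OF s(2), of \<Phi>' T] by (simp add: dd_zero Con_zero)
    qed
  qed (use r l in \<open>auto simp: Forms_def\<close>)
  then have "\<Phi>' \<in> Forms r (Suc j)" using l by (simp add: Forms_def)
  then obtain \<Psi>' where \<Psi>': "\<Psi>' \<in> Forms l j" "\<And>T. dd \<Psi>' T = \<Phi>' T"
    using Suc.IH[of \<Phi>'] r dd0 Con0 by auto
  have "(\<lambda>T. \<Psi> T + \<Psi>' T) \<in> Forms l j"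
    using \<Psi> \<Psi>'(1) unfolding Forms_def by (auto simp: B_add) (metis add.right_neutral subsetD lessThan_iff, metis add.right_neutral)
  then show ?case
    using split \<Psi>'(2) by (intro bexI[of _ "\<lambda>T. \<Psi> T + \<Psi>' T"]) (auto simp: dd_add)
qed

theorem poincare:
  assumes "\<Phi> \<in> Forms l (Suc j)" "\<And>T. dd \<Phi> T = 0"
  shows "\<exists>\<Psi>\<in>Forms l j. \<forall>T. dd \<Psi> T = \<Phi> T"
  by (rule poincare_step[OF order_refl assms]) auto

text \<open>In degree 0 all contractions vanish, so Cartan's formula gives
  \<open>D s (\<Phi> T) = 0\<close> for every \<open>s < l\<close>.\<close>

lemma closed_functions:
  assumes "\<Phi> \<in> Forms l 0" "\<And>T. dd \<Phi> T = 0"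
  shows "\<Phi> T \<in> B 0"
proof (rule B_char)
  show "\<Phi> T \<in> B l" using assms by (simp add: Forms_def)
  fix s assume s: "s < l"
  have "Con s \<Phi> = (\<lambda>_. 0)"
  proof
    fix T
    have "contract_dx i \<Phi> T = 0" if "i < l" for i
    proof (cases "i \<in> T")
      case False
      have "\<Phi> (insert i T) = 0"
      proof (rule ccontr)
        assume "\<Phi> (insert i T) \<noteq> 0"
        then have "insert i T \<subseteq> {..<l}" "card (insert i T) = 0"
          using assms by (auto simp: Forms_def)
        then show False using finite_subset[of "insert i T" "{..<l}"] by auto
      qed
      then show ?thesis by (simp add: contract_dx_def sg_def)
    qed (simp add: contract_dx_def)
    then show "Con s \<Phi> T = 0" by (simp add: Con_def)
  qed
  moreover have "dd \<Phi> = (\<lambda>_. 0)" using assms by blast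
  ultimately show "D s (\<Phi> T) = 0"
    using cartan[OF s, of \<Phi> T] by (simp add: dd_zero Con_zero)
qed simp

text \<open>The differential in the original coordinates, for the comparison with
  \<open>bar_diff\<close>.\<close>

lemma dd_eq: "dd \<Phi> T = (\<Sum>i<l. wedge_dx i (\<lambda>T. \<Sum>s<l. Y s i *v D s (\<Phi> T)) T)"
  unfolding dd_def Ext_def ext_sum ext_scale by (rule sum.swap)

end

section \<open>Rational functions\<close>

instance fract :: ("{idom, ring_char_0}") field_char_0
proof
  show "inj (of_nat :: nat \<Rightarrow> 'a fract)"
    unfolding of_nat_fract by (rule injI) (simp add: eq_fract)
qed

lemma pderiv_rat_Fract:
  "b \<noteq> 0 \<Longrightarrow> pderiv_rat i (Fract a b) =
     Fract (pderiv_mpoly i a * b - a * pderiv_mpoly i b) (b * b)"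
  by (simp add: Fract.abs_eq pderiv_rat.abs_eq)

lemma pderiv_rat_add: "pderiv_rat i (u + v) = pderiv_rat i u + pderiv_rat i v"
proof -
  obtain a b where u: "u = Fract a b" "b \<noteq> 0" by (cases u)
  obtain c d where v: "v = Fract c d" "d \<noteq> 0" by (cases v)
  show ?thesis
    using u v by (simp add: pderiv_rat_Fract eq_fract pderiv_mpoly_add pderiv_mpoly_mult algebra_simps)
qed

lemma pderiv_rat_mult: "pderiv_rat i (u * v) = pderiv_rat i u * v + u * pderiv_rat i v"
proof -
  obtain a b where u: "u = Fract a b" "b \<noteq> 0" by (cases u)
  obtain c d where v: "v = Fract c d" "d \<noteq> 0" by (cases v)
  show ?thesis
    using u v by (simp add: pderiv_rat_Fract eq_fract pderiv_mpoly_add pderiv_mpoly_mult algebra_simps)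
qed

lemma pderiv_Const: "pderiv_mpoly i (Const c) = 0"
  by (simp add: Const_def pderiv_mpoly_single)

lemma pderiv_Var: "pderiv_mpoly i (Var j) = (if i = j then 1 else 0)"
  by (auto simp: Var_def pderiv_mpoly_single lookup_single when_def single_one)

lemma pderiv_poly_rat: "pderiv_rat i (poly_rat p) = poly_rat (pderiv_mpoly i p)"
proof -
  have "pderiv_mpoly i 1 = (0 :: 'a mpoly)"
    using pderiv_Const[of i 1] by (simp add: Const_def single_one)
  then show ?thesis by (simp add: poly_rat_def pderiv_rat_Fract)
qed

lemma poly_rat_add: "poly_rat (p + q) = poly_rat p + poly_rat q"
  and poly_rat_mult: "poly_rat (p * q) = poly_rat p * poly_rat q"
  and poly_rat_0 [simp]: "poly_rat 0 = 0"
  and poly_rat_1 [simp]: "poly_rat 1 = 1"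
  and poly_rat_eq_iff: "poly_rat p = poly_rat q \<longleftrightarrow> p = q"
  by (simp_all add: poly_rat_def eq_fract Zero_fract_def One_fract_def)

lemma poly_rat_sum: "poly_rat (sum f A) = (\<Sum>a\<in>A. poly_rat (f a))"
  by (induction A rule: infinite_finite_induct) (auto simp: poly_rat_add)

lemma Const_add: "Const (a + b) = Const a + Const b"
  and Const_mult: "Const (a * b) = Const a * Const b"
  and Const_1: "Const 1 = 1"
  by (simp_all add: Const_def single_add mult_single single_one)

lemma const_rat_add: "const_rat (a + b) = const_rat a + const_rat b"
  and const_rat_mult: "const_rat (a * b) = const_rat a * const_rat b"
  and const_rat_1: "const_rat 1 = 1"
  by (simp_all add: const_rat_def Const_add Const_mult Const_1 poly_rat_add poly_rat_mult)

lemma const_rat_0: "const_rat 0 = 0"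
  by (simp add: const_rat_def Const_def)

lemma const_rat_sum: "const_rat (sum f A) = (\<Sum>a\<in>A. const_rat (f a))"
  by (induction A rule: infinite_finite_induct) (auto simp: const_rat_add const_rat_0)

lemma pderiv_const_rat: "pderiv_rat i (const_rat c) = 0"
  by (simp add: const_rat_def pderiv_poly_rat pderiv_Const)

subsection \<open>Evaluation of polynomials\<close>

definition eval_monom :: "(nat \<Rightarrow> 'k::field_char_0) \<Rightarrow> (nat \<Rightarrow>\<^sub>0 nat) \<Rightarrow> 'k" where
  "eval_monom x m = (\<Prod>i\<in>Poly_Mapping.keys m. x i ^ Poly_Mapping.lookup m i)"

lemma eval_monom_superset:
  assumes "finite A" "Poly_Mapping.keys m \<subseteq> A"
  shows "eval_monom x m = (\<Prod>i\<in>A. x i ^ Poly_Mapping.lookup m i)"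
  unfolding eval_monom_def
  by (rule prod.mono_neutral_left) (use assms in \<open>auto simp: in_keys_iff\<close>)

lemma eval_monom_add: "eval_monom x (m + n) = eval_monom x m * eval_monom x n"
proof -
  let ?A = "Poly_Mapping.keys m \<union> Poly_Mapping.keys n"
  have "eval_monom x k = (\<Prod>i\<in>?A. x i ^ Poly_Mapping.lookup k i)"
    if "k = m \<or> k = n \<or> k = m + n" for k
    by (rule eval_monom_superset) (use that Poly_Mapping.keys_add[of m n] in auto)
  then show ?thesis
    by (simp add: lookup_add power_add prod.distrib)
qed

lemma eval_mpoly_superset:
  assumes "finite A" "Poly_Mapping.keys p \<subseteq> A"
  shows "eval_mpoly x p = (\<Sum>m\<in>A. Poly_Mapping.lookup p m * eval_monom x m)"
  unfolding eval_mpoly_def eval_monom_def[symmetric]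
  by (rule sum.mono_neutral_left) (use assms in \<open>auto simp: in_keys_iff\<close>)

lemma eval_mpoly_add: "eval_mpoly x (p + q) = eval_mpoly x p + eval_mpoly x q"
proof -
  let ?A = "Poly_Mapping.keys p \<union> Poly_Mapping.keys q"
  have "eval_mpoly x r = (\<Sum>m\<in>?A. Poly_Mapping.lookup r m * eval_monom x m)"
    if "r = p \<or> r = q \<or> r = p + q" for r
    by (rule eval_mpoly_superset) (use that Poly_Mapping.keys_add[of p q] in auto)
  then show ?thesis
    by (simp add: lookup_add distrib_right sum.distrib)
qed

lemma eval_mpoly_0: "eval_mpoly x 0 = 0"
  by (simp add: eval_mpoly_def)

lemma eval_mpoly_sum: "eval_mpoly x (sum f A) = (\<Sum>a\<in>A. eval_mpoly x (f a))"
  by (induction A rule: infinite_finite_induct) (auto simp: eval_mpoly_add eval_mpoly_0)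

lemma eval_mpoly_single: "eval_mpoly x (Poly_Mapping.single m c) = c * eval_monom x m"
  by (subst eval_mpoly_superset[of "{m}"]) auto

lemma eval_mpoly_mult: "eval_mpoly x (p * q) = eval_mpoly x p * eval_mpoly x q"
proof -
  let ?s = "\<lambda>p m. Poly_Mapping.single m (Poly_Mapping.lookup p m)"
  have "eval_mpoly x ((\<Sum>m\<in>Poly_Mapping.keys p. ?s p m) * (\<Sum>n\<in>Poly_Mapping.keys q. ?s q n)) =
     eval_mpoly x (\<Sum>m\<in>Poly_Mapping.keys p. ?s p m) * eval_mpoly x (\<Sum>n\<in>Poly_Mapping.keys q. ?s q n)"
    by (simp add: sum_product eval_mpoly_sum mult_single eval_mpoly_single eval_monom_add algebra_simps)
  then show ?thesis
    by (simp only: mpoly_sum_single)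
qed

lemma eval_Const: "eval_mpoly x (Const c) = c"
  by (simp add: Const_def eval_mpoly_single eval_monom_def)

lemma eval_Var: "eval_mpoly x (Var i) = x i"
  by (simp add: Var_def eval_mpoly_single eval_monom_def)

lemma eval_prod_list: "eval_mpoly x (prod_list ps) = prod_list (map (eval_mpoly x) ps)"
  by (induction ps) (simp_all add: eval_mpoly_mult eval_Const[of x 1, unfolded Const_1])

section \<open>Denominators and units of coordinate rings\<close>

lemma coord_ring_quotient:
  "u \<in> coord_ring n S \<Longrightarrow> \<exists>ss p. set ss \<subseteq> S \<and> u * poly_rat (prod_list ss) = poly_rat p"
proof (induction rule: coord_ring.induct)
  case (const c)
  show ?case by (rule exI[of _ "[]"]) (auto simp: const_rat_def)
next
  case (var i)
  show ?case by (rule exI[of _ "[]"]) auto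
next
  case (inv s)
  \<comment> \<open>The set \<open>S\<close> is arbitrary; for \<open>s = 0\<close> the convention
    \<open>inverse 0 = 0\<close> makes the numerator 0.\<close>
  then show ?case
    by (intro exI[of _ "[s]"]) (cases "poly_rat s = 0", auto intro: exI[of _ 0] exI[of _ 1])
next
  case (add u v)
  then obtain ss p ss' p' where *: "set ss \<subseteq> S" "u * poly_rat (prod_list ss) = poly_rat p"
      "set ss' \<subseteq> S" "v * poly_rat (prod_list ss') = poly_rat p'"
    by blast
  have "(u + v) * poly_rat (prod_list (ss @ ss')) =
      poly_rat (p * prod_list ss' + p' * prod_list ss)"
    by (simp add: poly_rat_mult poly_rat_add *(2,4)[symmetric] algebra_simps)
  with * show ?case by (metis set_append Un_least)
next
  case (mult u v)
  then obtain ss p ss' p' where *: "set ss \<subseteq> S" "u * poly_rat (prod_list ss) = poly_rat p"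
      "set ss' \<subseteq> S" "v * poly_rat (prod_list ss') = poly_rat p'"
    by blast
  have "(u * v) * poly_rat (prod_list (ss @ ss')) = poly_rat (p * p')"
    by (simp add: poly_rat_mult *(2,4)[symmetric] algebra_simps)
  with * show ?case by (metis set_append Un_least)
qed

text \<open>Clears the denominators of \<open>1 / p\<close>. Consequently every zero of
  \<open>p\<close> is a zero of some inverted element, which is how the fibration condition becomes
  geometric.\<close>

lemma unit_divides_product:
  assumes "p \<noteq> 0" "inverse (poly_rat p) \<in> coord_ring n S"
  shows "\<exists>ss q. set ss \<subseteq> S \<and> prod_list ss = p * q"
proof -
  obtain ss q where *: "set ss \<subseteq> S" "inverse (poly_rat p) * poly_rat (prod_list ss) = poly_rat q"
    using coord_ring_quotient[OF assms(2)] by blast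
  have "poly_rat p \<noteq> 0" using assms(1) poly_rat_eq_iff[of p 0] by simp
  then have "poly_rat (prod_list ss) = poly_rat p * poly_rat q"
    using *(2) by (simp add: field_simps)
  then show ?thesis
    using *(1) by (auto simp: poly_rat_mult[symmetric] poly_rat_eq_iff)
qed

section \<open>Adapted coordinates of a fiber-type arrangement\<close>

definition lin :: "nat \<Rightarrow> (nat \<Rightarrow> 'k::field_char_0) \<Rightarrow> (nat \<Rightarrow> 'k) \<Rightarrow> 'k" where
  "lin n a x = (\<Sum>i<n. a i * x i)"

definition aff_poly :: "nat \<Rightarrow> 'k \<Rightarrow> (nat \<Rightarrow> 'k) \<Rightarrow> 'k::field_char_0 mpoly" where
  "aff_poly n c a = Const c + (\<Sum>i<n. Const (a i) * Var i)"

lemma eval_aff_poly: "eval_mpoly x (aff_poly n c a) = c + lin n a x"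
  by (simp add: aff_poly_def lin_def eval_mpoly_add eval_mpoly_sum eval_mpoly_mult eval_Const eval_Var)

definition unit_vec :: "nat \<Rightarrow> nat \<Rightarrow> 'k::field_char_0" where
  "unit_vec i j = (if j = i then 1 else 0)"

lemma unit_vec_space: "i < n \<Longrightarrow> unit_vec i \<in> affine_space n"
  by (auto simp: unit_vec_def affine_space_def)

lemma lin_unit_vec: "lin n a (unit_vec i) = (if i < n then a i else 0)"
proof -
  have "lin n a (unit_vec i) = (\<Sum>j<n. if j = i then a i else 0)"
    unfolding lin_def unit_vec_def by (rule sum.cong) auto
  then show ?thesis by simp
qed

lemma lin_add: "lin n a (\<lambda>i. x i + z i) = lin n a x + lin n a z"
  and lin_diff: "lin n a (\<lambda>i. x i - z i) = lin n a x - lin n a z"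
  and lin_scale: "lin n a (\<lambda>i. t * x i) = t * lin n a x"
  and lin_diff_left: "lin n (\<lambda>i. a i - b i) x = lin n a x - lin n b x"
  by (simp_all add: lin_def algebra_simps sum.distrib sum_subtractf sum_distrib_left)

lemma lin_sum: "lin n a (\<lambda>i. \<Sum>k\<in>S. x k i) = (\<Sum>k\<in>S. lin n a (x k))"
  unfolding lin_def sum_distrib_left by (rule sum.swap)

lemma affine_eq_coeffs:
  assumes "\<And>x. x \<in> affine_space n \<Longrightarrow> c + lin n a x = c' + lin n a' x"
  shows "c = c'" "\<And>i. i < n \<Longrightarrow> a i = a' i"
proof -
  show c: "c = c'"
    using assms[of "\<lambda>_. 0"] by (simp add: affine_space_def lin_def)
  show "a i = a' i" if "i < n" for i
    using assms[OF unit_vec_space[OF that]] that c by (simp add: lin_unit_vec)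
qed

text \<open>Move \<open>x\<close> to the hyperplane along a coordinate axis.\<close>

lemma affine_multiple:
  assumes j: "j < n" "a j \<noteq> 0"
    and zero: "\<And>x. x \<in> affine_space n \<Longrightarrow> c + lin n a x = 0 \<Longrightarrow> c' + lin n a' x = 0"
    and x: "x \<in> affine_space n"
  shows "c' + lin n a' x = a' j / a j * (c + lin n a x)"
proof -
  define t where "t = (c + lin n a x) / a j"
  define z where "z i = x i - t * unit_vec j i" for i
  have "z \<in> affine_space n"
    using x unit_vec_space[OF j(1)] by (auto simp: z_def affine_space_def)
  moreover have lz: "lin n b z = lin n b x - t * b j" for b
    unfolding z_def[abs_def] lin_diff lin_scale using j by (simp add: lin_unit_vec)
  moreover have "c + lin n a z = 0"
    using j by (simp add: lz t_def)
  ultimately have "c' + lin n a' z = 0" using zero by blast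
  then have "(c' + lin n a' x) - t * a' j = 0" by (simp add: lz add_diff_eq)
  then have "c' + lin n a' x = t * a' j" by simp
  then show ?thesis by (simp add: t_def)
qed

text \<open>A point \<open>p\<close> avoiding the earlier zero sets and a point \<open>q\<close>
  avoiding the new one span a line in the hyperplane on which each equation has at most one zero;
  the field is infinite, so some point of the line avoids all of them.\<close>

lemma hyperplane_avoids:
  fixes a :: "nat \<Rightarrow> 'k::field_char_0"
  assumes j: "j < n" "a j \<noteq> 0"
    and "\<And>c' a'. (c', a') \<in> set ss \<Longrightarrow>
      \<exists>x\<in>affine_space n. c + lin n a x = 0 \<and> c' + lin n a' x \<noteq> 0"
  shows "\<exists>x\<in>affine_space n. c + lin n a x = 0 \<and> (\<forall>(c', a')\<in>set ss. c' + lin n a' x \<noteq> 0)"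
  using assms(3)
proof (induction ss)
  case Nil
  have "lin n a (\<lambda>i. - c / a j * unit_vec j i) = - c"
    unfolding lin_scale using j by (simp add: lin_unit_vec)
  moreover have "(\<lambda>i. - c / a j * unit_vec j i) \<in> affine_space n"
    using unit_vec_space[OF j(1)] by (auto simp: affine_space_def)
  ultimately show ?case by (intro bexI[of _ "\<lambda>i. - c / a j * unit_vec j i"]) auto
next
  case (Cons s ss)
  obtain c0 a0 where s: "s = (c0, a0)" by (cases s)
  obtain p where p: "p \<in> affine_space n" "c + lin n a p = 0"
      "\<And>c' a'. (c', a') \<in> set ss \<Longrightarrow> c' + lin n a' p \<noteq> 0"
    using Cons by fastforce
  obtain q where q: "q \<in> affine_space n" "c + lin n a q = 0" "c0 + lin n a0 q \<noteq> 0"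
    using Cons.prems[of c0 a0] s by auto
  define z where "z t = (\<lambda>i. p i + t * (q i - p i))" for t
  have lz: "lin n b (z t) = lin n b p + t * (lin n b q - lin n b p)" for b t
    unfolding z_def lin_add lin_scale lin_diff ..
  have "finite {t. c' + lin n a' (z t) = 0}" if "(c', a') \<in> set (s # ss)" for c' a'
  proof -
    have uniq: "t = t'" if "c' + lin n a' (z t) = 0" "c' + lin n a' (z t') = 0" for t t'
    proof -
      have "c' + lin n a' p \<noteq> 0 \<or> c' + lin n a' q \<noteq> 0"
        using \<open>(c', a') \<in> set (s # ss)\<close> p q s by auto
      then have "lin n a' q \<noteq> lin n a' p"
        using that by (auto simp: lz)
      moreover have "(t - t') * (lin n a' q - lin n a' p) =
          (c' + lin n a' (z t)) - (c' + lin n a' (z t'))"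
        by (simp add: lz algebra_simps)
      ultimately show ?thesis using that by simp
    qed
    show ?thesis
    proof (cases "\<exists>t0. c' + lin n a' (z t0) = 0")
      case True
      then obtain t0 where "c' + lin n a' (z t0) = 0" by blast
      then have "{t. c' + lin n a' (z t) = 0} \<subseteq> {t0}"
        using uniq by blast
      then show ?thesis by (rule finite_subset) simp
    qed simp
  qed
  then have "finite (\<Union>(c', a')\<in>set (s # ss). {t. c' + lin n a' (z t) = 0})"
    by (intro finite_UN_I) auto
  then obtain t where t: "t \<notin> (\<Union>(c', a')\<in>set (s # ss). {t. c' + lin n a' (z t) = 0})"
    using ex_new_if_finite[OF infinite_UNIV_char_0] by blast
  have "z t \<in> affine_space n"
    using p q by (auto simp: z_def affine_space_def)
  moreover have "c + lin n a (z t) = 0"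
    using p(2) q(2) by (simp add: lz eq_neg_iff_add_eq_0[symmetric] add.commute)
  ultimately show ?case using t by blast
qed

lemma linear_functional_coords:
  fixes T :: "(nat \<Rightarrow> 'k::field_char_0) \<Rightarrow> 'k"
  assumes add: "\<And>x z. x \<in> affine_space n \<Longrightarrow> z \<in> affine_space n \<Longrightarrow> T (x + z) = T x + T z"
    and scale: "\<And>c x. x \<in> affine_space n \<Longrightarrow> T (\<lambda>i. c * x i) = c * T x"
    and x: "x \<in> affine_space n"
  shows "T x = lin n (\<lambda>i. T (unit_vec i)) x"
proof -
  have "T x = lin k (\<lambda>i. T (unit_vec i)) x" if "k \<le> n" "x \<in> affine_space k" for k x
    using that
  proof (induction k arbitrary: x)
    case 0
    then have "x = (\<lambda>i. 0 * x i)" by (auto simp: affine_space_def)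
    then show ?case
      using scale[of x 0] 0 by (simp add: lin_def affine_space_def)
  next
    case (Suc k)
    define x' where "x' i = (if i < k then x i else 0)" for i
    have x: "x = x' + (\<lambda>i. x k * unit_vec k i)"
    proof
      show "x i = (x' + (\<lambda>i. x k * unit_vec k i)) i" for i
        using Suc.prems by (cases i k rule: linorder_cases) (auto simp: x'_def unit_vec_def affine_space_def)
    qed
    have sp: "x' \<in> affine_space k" "x' \<in> affine_space n" "unit_vec k \<in> affine_space n"
       "(\<lambda>i. x k * unit_vec k i) \<in> affine_space n"
      using Suc.prems by (auto simp: x'_def affine_space_def unit_vec_def)
    have "T x = T x' + x k * T (unit_vec k)"
      by (subst x) (simp add: add[OF sp(2,4)] scale[OF sp(3)])
    also have "T x' = lin k (\<lambda>i. T (unit_vec i)) x'"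
      using Suc sp by simp
    also have "\<dots> = lin k (\<lambda>i. T (unit_vec i)) x"
      by (simp add: lin_def x'_def)
    finally show ?case by (simp add: lin_def mult.commute)
  qed
  then show ?thesis using x by blast
qed

definition rhs :: "nat \<Rightarrow> (nat \<Rightarrow> nat \<Rightarrow> 'k) \<Rightarrow> nat \<Rightarrow> 'k \<Rightarrow> (nat \<Rightarrow> 'k) \<Rightarrow> (nat \<Rightarrow> 'k) \<Rightarrow> 'k::field_char_0"
  where "rhs n Y r c g x = c + (\<Sum>t<r. g t * lin n (Y t) x)"

text \<open>Linear coordinates \<open>Y\<close> with dual basis \<open>E\<close> such that each hyperplane \<open>H\<close> has an equation
  \<open>Y\<^sub>r = c + \<Sum> g\<^sub>t Y\<^sub>t\<close> (\<open>t < r = lev H\<close>), and the difference of the right-hand sides of two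
  hyperplanes of the same level is a constant or defines a hyperplane of lower level.\<close>

definition adapted :: "nat \<Rightarrow> (nat \<Rightarrow> 'k::field_char_0) set set \<Rightarrow> (nat \<Rightarrow> nat \<Rightarrow> 'k) \<Rightarrow>
    (nat \<Rightarrow> nat \<Rightarrow> 'k) \<Rightarrow> ((nat \<Rightarrow> 'k) set \<Rightarrow> nat) \<Rightarrow> ((nat \<Rightarrow> 'k) set \<Rightarrow> 'k) \<Rightarrow>
    ((nat \<Rightarrow> 'k) set \<Rightarrow> nat \<Rightarrow> 'k) \<Rightarrow> bool" where
  "adapted n \<A> Y E lev c g \<longleftrightarrow>
     (\<forall>s<n. E s \<in> affine_space n) \<and>
     (\<forall>s<n. \<forall>t<n. lin n (Y s) (E t) = (if s = t then 1 else 0)) \<and>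
     (\<forall>i<n. \<forall>j<n. (\<Sum>s<n. Y s j * E s i) = (if i = j then 1 else 0)) \<and>
     (\<forall>H\<in>\<A>. lev H < n \<and>
        H = {x \<in> affine_space n. lin n (Y (lev H)) x = rhs n Y (lev H) (c H) (g H) x}) \<and>
     (\<forall>H\<in>\<A>. \<forall>H'\<in>\<A>. H \<noteq> H' \<longrightarrow> lev H = lev H' \<longrightarrow> (\<exists>k. k \<noteq> 0 \<and>
        ((\<forall>x\<in>affine_space n. rhs n Y (lev H) (c H) (g H) x - rhs n Y (lev H') (c H') (g H') x = k) \<or>
         (\<exists>H0\<in>\<A>. lev H0 < lev H \<and> (\<forall>x\<in>affine_space n.
            rhs n Y (lev H) (c H) (g H) x - rhs n Y (lev H') (c H') (g H') x =
            k * (lin n (Y (lev H0)) x - rhs n Y (lev H0) (c H0) (g H0) x))))))"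

lemma rhs_affine: "rhs n Y r c g x = c + lin n (\<lambda>i. \<Sum>t<r. g t * Y t i) x"
proof -
  have "(\<Sum>t<r. g t * lin n (Y t) x) = lin n (\<lambda>i. \<Sum>t<r. g t * Y t i) x"
    unfolding lin_def sum_distrib_left sum_distrib_right
    by (subst sum.swap) (simp add: mult.assoc)
  then show ?thesis by (simp add: rhs_def)
qed

lemma aff_poly_diff:
  "aff_poly n c a - aff_poly n c' a' = aff_poly n (c - c') (\<lambda>i. a i - a' i)"
proof -
  have "aff_poly n c a = aff_poly n (c - c') (\<lambda>i. a i - a' i) + aff_poly n c' a'"
    using Const_add[of "c - c'" c'] Const_add[of "a i - a' i" "a' i" for i]
    by (simp add: aff_poly_def sum.distrib[symmetric] distrib_right[symmetric])
  then show ?thesis by simp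
qed

lemma frame_expansion:
  assumes "\<forall>s<n. E s \<in> affine_space n"
    and "\<forall>i<n. \<forall>j<n. (\<Sum>s<n. Y s j * E s i) = (if i = j then 1 else 0)"
    and z: "z \<in> affine_space n"
  shows "z = (\<lambda>p. \<Sum>s<n. lin n (Y s) z * E s p)"
proof
  fix p
  show "z p = (\<Sum>s<n. lin n (Y s) z * E s p)"
  proof (cases "p < n")
    case True
    have "(\<Sum>s<n. lin n (Y s) z * E s p) = (\<Sum>q<n. (\<Sum>s<n. Y s q * E s p) * z q)"
      unfolding lin_def sum_distrib_right by (subst sum.swap) (simp add: ac_simps)
    also have "\<dots> = (\<Sum>q<n. if q = p then z p else 0)"
      using assms(2) True by (intro sum.cong refl) auto
    finally show ?thesis using True by simp
  next
    case False
    then have "E s p = 0" if "s < n" for s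
      using assms(1) that by (auto simp: affine_space_def)
    then show ?thesis using z False by (simp add: affine_space_def)
  qed
qed

lemma degree_one_aff_poly:
  "degree_one n \<alpha> \<longleftrightarrow> (\<exists>c a. \<alpha> = aff_poly n c a \<and> (\<exists>i<n. a i \<noteq> 0))"
  by (auto simp: degree_one_def aff_poly_def)

lemma affine_linear_aff_poly: "affine_linear n \<alpha> \<longleftrightarrow> (\<exists>c a. \<alpha> = aff_poly n c a)"
  by (auto simp: affine_linear_def aff_poly_def)

section \<open>Adapted coordinates by induction over the fibrations\<close>

lemma adapted_line:
  fixes \<A> :: "(nat \<Rightarrow> 'k::field_char_0) set set"
  assumes "arrangement 1 \<A>"
  shows "\<exists>Y E lev c g. adapted 1 \<A> Y E lev c g"
proof -
  have "\<forall>H\<in>\<A>. \<exists>c. H = {x \<in> affine_space 1. x 0 = c}"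
  proof
    fix H assume "H \<in> \<A>"
    then obtain \<alpha> where \<alpha>: "degree_one 1 \<alpha>" "H = zero_set 1 \<alpha>"
      using assms by (auto simp: arrangement_def)
    then obtain c a where "\<alpha> = aff_poly 1 c a" "a 0 \<noteq> 0"
      by (auto simp: degree_one_aff_poly)
    then have "H = {x \<in> affine_space 1. x 0 = - c / a 0}"
      using \<alpha>(2) by (auto simp: zero_set_def eval_aff_poly lin_def eq_neg_iff_add_eq_0 field_simps)
    then show "\<exists>c. H = {x \<in> affine_space 1. x 0 = c}" by blast
  qed
  then obtain c where c: "\<And>H. H \<in> \<A> \<Longrightarrow> H = {x \<in> affine_space 1. x 0 = c H}"
    by (metis (no_types))
  have ne: "c H - c H' \<noteq> 0" if "H \<in> \<A>" "H' \<in> \<A>" "H \<noteq> H'" for H H'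
    using c[OF that(1)] c[OF that(2)] that(3) by (metis right_minus_eq)
  have "adapted 1 \<A> (\<lambda>_ _. 1) (\<lambda>_. unit_vec 0) (\<lambda>_. 0) c (\<lambda>_ _. 0)"
    unfolding adapted_def
  proof (intro conjI ballI impI)
    fix H H' assume "H \<in> \<A>" "H' \<in> \<A>" "H \<noteq> H'"
    then have "c H - c H' \<noteq> 0" by (rule ne)
    moreover have "rhs 1 (\<lambda>_ _. 1) 0 (c H) (\<lambda>_. 0) x - rhs 1 (\<lambda>_ _. 1) 0 (c H') (\<lambda>_. 0) x = c H - c H'" for x
      by (simp add: rhs_def)
    ultimately show "\<exists>k. k \<noteq> 0 \<and>
        ((\<forall>x\<in>affine_space 1. rhs 1 (\<lambda>_ _. 1) 0 (c H) (\<lambda>_. 0) x - rhs 1 (\<lambda>_ _. 1) 0 (c H') (\<lambda>_. 0) x = k) \<or>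
         (\<exists>H0\<in>\<A>. (0::nat) < 0 \<and> (\<forall>x\<in>affine_space 1.
            rhs 1 (\<lambda>_ _. 1) 0 (c H) (\<lambda>_. 0) x - rhs 1 (\<lambda>_ _. 1) 0 (c H') (\<lambda>_. 0) x =
            k * (lin 1 (\<lambda>_. 1) x - rhs 1 (\<lambda>_ _. 1) 0 (c H0) (\<lambda>_. 0) x))))"
      by blast
  next
    fix H assume "H \<in> \<A>"
    then show "H = {x \<in> affine_space 1. lin 1 (\<lambda>_. 1) x = rhs 1 (\<lambda>_ _. 1) 0 (c H) (\<lambda>_. 0) x}"
      using c[of H] by (simp add: rhs_def lin_def)
  qed (auto simp: lin_def unit_vec_space unit_vec_def)
  then show ?thesis by blast
qed

text \<open>The linear forms of the base are pulled back along \<open>\<pi>\<close> and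
  \<open>y\<close> is added on top; vertical hyperplanes inherit level and equation from their
  images, horizontal ones get level \<open>n\<close>. The substance lies in the difference of two
  horizontal right-hand sides: if it is not constant, regularity of its inverse must produce a base
  hyperplane with a proportional equation.\<close>

lemma adapted_step:
  fixes \<A> :: "(nat \<Rightarrow> 'k::field_char_0) set set"
  assumes fib: "linear_fibration n \<pi> y \<A>"
    and IH: "adapted n (vertical_images n \<pi> \<A>) Y E lev c g"
  shows "\<exists>Y E lev c g. adapted (Suc n) \<A> Y E lev c g"
proof -
  define S where "S = (affine_space (Suc n) :: (nat \<Rightarrow> 'k) set)"
  have E: "\<forall>s<n. E s \<in> affine_space n"
    and dual2: "\<And>s t. s < n \<Longrightarrow> t < n \<Longrightarrow> lin n (Y s) (E t) = (if s = t then 1 else 0)"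
    and dual1: "\<forall>i<n. \<forall>j<n. (\<Sum>s<n. Y s j * E s i) = (if i = j then 1 else 0)"
    and lev: "\<And>H. H \<in> vertical_images n \<pi> \<A> \<Longrightarrow> lev H < n"
    and eqn: "\<And>H. H \<in> vertical_images n \<pi> \<A> \<Longrightarrow>
        H = {x \<in> affine_space n. lin n (Y (lev H)) x = rhs n Y (lev H) (c H) (g H) x}"
  proof -
    note I = IH[unfolded adapted_def]
    note I2 = conjunct2[OF I] note I3 = conjunct2[OF I2] note I4 = conjunct2[OF I3]
    show "\<forall>s<n. E s \<in> affine_space n"
      "\<And>s t. s < n \<Longrightarrow> t < n \<Longrightarrow> lin n (Y s) (E t) = (if s = t then 1 else 0)"
      "\<forall>i<n. \<forall>j<n. (\<Sum>s<n. Y s j * E s i) = (if i = j then 1 else 0)"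
      "\<And>H. H \<in> vertical_images n \<pi> \<A> \<Longrightarrow> lev H < n"
      using conjunct1[OF I] conjunct1[OF I2] conjunct1[OF I3] conjunct1[OF I4] by simp_all
    show "H = {x \<in> affine_space n. lin n (Y (lev H)) x = rhs n Y (lev H) (c H) (g H) x}"
      if "H \<in> vertical_images n \<pi> \<A>" for H
      using bspec[OF conjunct1[OF I4] that] by (rule conjunct2)
  qed
  define Q where "Q K z = rhs n Y (lev K) (c K) (g K) z" for K z
  have sep: "\<exists>k. k \<noteq> 0 \<and> ((\<forall>x\<in>affine_space n. Q H x - Q H' x = k) \<or>
      (\<exists>K\<in>vertical_images n \<pi> \<A>. lev K < lev H \<and> (\<forall>x\<in>affine_space n.
         Q H x - Q H' x = k * (lin n (Y (lev K)) x - Q K x))))"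
    if "H \<in> vertical_images n \<pi> \<A>" "H' \<in> vertical_images n \<pi> \<A>" "H \<noteq> H'" "lev H = lev H'" for H H'
  proof -
    note I = IH[unfolded adapted_def]
    from bspec[OF bspec[OF conjunct2[OF conjunct2[OF conjunct2[OF conjunct2[OF I]]]] that(1)] that(2)]
    show ?thesis
      unfolding Q_def using that(3,4) by (elim impE)
  qed
  have proj: "linear_projection n \<pi> y"
    using fib by (simp add: linear_fibration_def)
  then have bij: "bij_betw (\<lambda>x. (\<pi> x, y x)) S (affine_space n \<times> UNIV)"
    by (simp add: linear_projection_def S_def)
  have \<pi>S: "\<pi> x \<in> affine_space n" if "x \<in> S" for x
    using bij_betwE[OF bij] that by auto
  have \<pi>_lin: "\<pi> (x + z) = \<pi> x + \<pi> z" "\<pi> (\<lambda>i. k * x i) = (\<lambda>i. k * \<pi> x i)"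
    and y_lin: "y (x + z) = y x + y z" "y (\<lambda>i. k * x i) = k * y x"
    if "x \<in> S" "z \<in> S" for x z k
    using proj that unfolding linear_projection_def linear_on_space_def S_def by blast+
  have \<pi>_coord: "\<pi> x p = lin (Suc n) (\<lambda>i. \<pi> (unit_vec i) p) x" if "x \<in> S" for x p
  proof (rule linear_functional_coords[where T = "\<lambda>x. \<pi> x p"])
    show "x \<in> affine_space (Suc n)" using that by (simp add: S_def)
  qed (simp_all only: S_def[symmetric] \<pi>_lin plus_fun_apply)
  have y_coord: "y x = lin (Suc n) (\<lambda>i. y (unit_vec i)) x" if "x \<in> S" for x
  proof (rule linear_functional_coords)
    show "x \<in> affine_space (Suc n)" using that by (simp add: S_def)
  qed (simp_all only: S_def[symmetric] y_lin)
  define Y' where "Y' t i = (if t < n then lin n (Y t) (\<pi> (unit_vec i)) else y (unit_vec i))" for t i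
  have Y'_low: "lin (Suc n) (Y' t) x = lin n (Y t) (\<pi> x)" if "t < n" "x \<in> S" for t x
  proof -
    have "lin n (Y t) (\<pi> x) = lin n (Y t) (\<lambda>p. \<Sum>i<Suc n. x i * \<pi> (unit_vec i) p)"
      by (rule arg_cong[where f = "lin n (Y t)"], rule ext)
         (use \<pi>_coord[OF that(2)] in \<open>simp add: lin_def mult.commute\<close>)
    also have "\<dots> = (\<Sum>i<Suc n. x i * lin n (Y t) (\<pi> (unit_vec i)))"
      by (simp only: lin_sum lin_scale)
    finally show ?thesis using that by (simp add: lin_def[of "Suc n"] Y'_def mult.commute)
  qed
  have Y'_top: "lin (Suc n) (Y' n) x = y x" if "x \<in> S" for x
    using y_coord[OF that] by (simp add: Y'_def[abs_def])
  have surj: "\<exists>e. e \<in> S \<and> \<pi> e = z \<and> y e = w" if "z \<in> affine_space n" for z w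
  proof -
    have "(z, w) \<in> (\<lambda>x. (\<pi> x, y x)) ` S"
      unfolding bij_betw_imp_surj_on[OF bij] using that by simp
    then show ?thesis by (auto simp: image_iff)
  qed
  \<comment> \<open>The dual vectors are the preimages of \<open>(E t, 0)\<close> and of
    \<open>(0, 1)\<close> under \<open>(\<pi>, y)\<close>.\<close>
  have "\<exists>e. t \<le> n \<longrightarrow> e \<in> S \<and> \<pi> e = (if t < n then E t else (\<lambda>_. 0)) \<and> y e = (if t < n then 0 else 1)" for t
  proof (cases "t < n")
    case True
    then show ?thesis using surj[of "E t" 0] E by auto
  next
    case False
    have "(\<lambda>_. 0) \<in> affine_space n" by (simp add: affine_space_def)
    from surj[OF this, of 1] show ?thesis using False by auto
  qed
  then obtain E' where E': "\<And>t. t \<le> n \<Longrightarrow> E' t \<in> S"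
      "\<And>t. t \<le> n \<Longrightarrow> \<pi> (E' t) = (if t < n then E t else (\<lambda>_. 0))"
      "\<And>t. t \<le> n \<Longrightarrow> y (E' t) = (if t < n then 0 else 1)"
    by metis
  have lin0: "lin n a (\<lambda>_. 0) = 0" for a :: "nat \<Rightarrow> 'k"
    by (simp add: lin_def)
  have dual2': "lin (Suc n) (Y' s) (E' t) = (if s = t then 1 else 0)" if "s < Suc n" "t < Suc n" for s t
  proof (cases "s < n")
    case True
    then show ?thesis
      using that Y'_low[OF True E'(1)[of t]] E'(2)[of t] by (auto simp: dual2 lin0)
  next
    case False
    then have "s = n" using that by simp
    then show ?thesis
      using that Y'_top[OF E'(1)[of t]] E'(3)[of t] by auto
  qed
  \<comment> \<open>The second duality comes from injectivity: the combination \<open>z\<close> has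
    the same image under \<open>(\<pi>, y)\<close> as the unit vector.\<close>
  have dual1': "(\<Sum>s<Suc n. Y' s j * E' s i) = (if i = j then 1 else 0)" if "i < Suc n" "j < Suc n" for i j
  proof -
    define z where "z = (\<lambda>i. \<Sum>s<Suc n. Y' s j * E' s i)"
    have eS: "unit_vec j \<in> S" unfolding S_def by (rule unit_vec_space[OF that(2)])
    have "E' s i = 0" if "s < Suc n" "i \<ge> Suc n" for s i
      using E'(1)[of s] that by (simp add: S_def affine_space_def)
    then have zS: "z \<in> S" by (simp add: z_def S_def affine_space_def)
    have lz: "lin (Suc n) a z = (\<Sum>s<Suc n. Y' s j * lin (Suc n) a (E' s))" for a
      unfolding z_def lin_sum lin_scale ..
    have "\<pi> z = (\<lambda>p. \<Sum>s<n. lin n (Y s) (\<pi> (unit_vec j)) * E s p)"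
    proof
      fix p
      have "\<pi> z p = (\<Sum>s<Suc n. Y' s j * \<pi> (E' s) p)"
        unfolding \<pi>_coord[OF zS] lz using \<pi>_coord[OF E'(1)] by simp
      then show "\<pi> z p = (\<Sum>s<n. lin n (Y s) (\<pi> (unit_vec j)) * E s p)"
        by (simp add: E'(2) Y'_def)
    qed
    also have "\<dots> = \<pi> (unit_vec j)"
      using frame_expansion[OF E dual1 \<pi>S[OF eS]] by simp
    finally have "\<pi> z = \<pi> (unit_vec j)" .
    moreover have "y z = (\<Sum>s<Suc n. Y' s j * y (E' s))"
      unfolding y_coord[OF zS] lz using y_coord[OF E'(1)] by simp
    then have "y z = y (unit_vec j)"
      by (simp add: E'(3) Y'_def)
    ultimately have "z = unit_vec j"
      using bij_betw_imp_inj_on[OF bij] zS eS by (simp add: inj_on_def)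
    then show ?thesis
      by (metis z_def unit_vec_def)
  qed
  obtain f where F: "\<forall>H\<in>{H \<in> \<A>. \<not> vertical n \<pi> H}. affine_linear n (f H) \<and>
             H = {x \<in> affine_space (Suc n). y x = eval_mpoly (\<pi> x) (f H)}"
      "\<forall>H\<in>{H \<in> \<A>. \<not> vertical n \<pi> H}. \<forall>H'\<in>{H \<in> \<A>. \<not> vertical n \<pi> H}. H \<noteq> H' \<longrightarrow>
             inverse (poly_rat (f H - f H')) \<in> complement_ring n (vertical_images n \<pi> \<A>)"
    using conjunct2[OF fib[unfolded linear_fibration_def]] by (elim exE conjE)
  have f: "affine_linear n (f H)" "H = {x \<in> S. y x = eval_mpoly (\<pi> x) (f H)}"
    if "H \<in> \<A>" "\<not> vertical n \<pi> H" for H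
    using bspec[OF F(1), of H] that by (simp_all only: S_def mem_Collect_eq simp_thms)
  have f_diff: "inverse (poly_rat (f H - f H')) \<in> complement_ring n (vertical_images n \<pi> \<A>)"
    if "H \<in> \<A>" "\<not> vertical n \<pi> H" "H' \<in> \<A>" "\<not> vertical n \<pi> H'" "H \<noteq> H'" for H H'
    using F(2) that by blast
  have "\<forall>H. \<exists>c a. H \<in> \<A> \<and> \<not> vertical n \<pi> H \<longrightarrow> f H = aff_poly n c a"
    using f(1) by (metis affine_linear_aff_poly)
  then obtain c1 a1 where ca: "\<And>H. H \<in> \<A> \<Longrightarrow> \<not> vertical n \<pi> H \<Longrightarrow> f H = aff_poly n (c1 H) (a1 H)"
    by metis
  define lev' where "lev' H = (if vertical n \<pi> H then lev (\<pi> ` H) else n)" for H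
  define c' where "c' H = (if vertical n \<pi> H then c (\<pi> ` H) else c1 H)" for H
  define g' where "g' H t = (if vertical n \<pi> H then g (\<pi> ` H) t else lin n (a1 H) (E t))" for H t
  define R where "R H x = rhs (Suc n) Y' (lev' H) (c' H) (g' H) x" for H x
  have ver_in: "\<pi> ` H \<in> vertical_images n \<pi> \<A>" if "H \<in> \<A>" "vertical n \<pi> H" for H
    using that by (auto simp: vertical_images_def)
  have R_ver: "R H x = rhs n Y (lev (\<pi> ` H)) (c (\<pi> ` H)) (g (\<pi> ` H)) (\<pi> x)"
    if "H \<in> \<A>" "vertical n \<pi> H" "x \<in> S" for H x
  proof -
    have "lev (\<pi> ` H) < n" using lev[OF ver_in[OF that(1,2)]] .
    then show ?thesis
      using that Y'_low[OF _ that(3)] by (simp add: R_def rhs_def lev'_def c'_def g'_def)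
  qed
  have R_hor: "R H x = c1 H + lin n (a1 H) (\<pi> x)"
    if "\<not> vertical n \<pi> H" "x \<in> S" for H x
  proof -
    have "lin n (a1 H) (\<pi> x) = lin n (a1 H) (\<lambda>p. \<Sum>s<n. lin n (Y s) (\<pi> x) * E s p)"
      using frame_expansion[OF E dual1 \<pi>S[OF that(2)]] by simp
    also have "\<dots> = (\<Sum>s<n. lin n (a1 H) (E s) * lin (Suc n) (Y' s) x)"
      unfolding lin_sum lin_scale using Y'_low that(2) by (simp add: mult.commute)
    finally show ?thesis
      using that by (simp add: R_def rhs_def lev'_def c'_def g'_def)
  qed
  have ver_char: "H = {x \<in> S. \<pi> x \<in> \<pi> ` H}" if "vertical n \<pi> H" for H
    using that unfolding vertical_def S_def by auto
  have eqn': "lev' H < Suc n \<and> H = {x \<in> S. lin (Suc n) (Y' (lev' H)) x = R H x}" if H: "H \<in> \<A>" for H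
  proof (cases "vertical n \<pi> H")
    case True
    have l: "lev (\<pi> ` H) < n" using lev[OF ver_in[OF H True]] .
    have "H = {x \<in> S. \<pi> x \<in> \<pi> ` H}" by (rule ver_char[OF True])
    also have "\<dots> = {x \<in> S. lin (Suc n) (Y' (lev' H)) x = R H x}"
      using eqn[OF ver_in[OF H True]] \<pi>S R_ver[OF H True] Y'_low[OF l] True
      by (auto simp: lev'_def)
    finally show ?thesis using l True by (simp add: lev'_def)
  next
    case False
    have "H = {x \<in> S. y x = eval_mpoly (\<pi> x) (f H)}" by (rule f(2)[OF H False])
    also have "\<dots> = {x \<in> S. lin (Suc n) (Y' (lev' H)) x = R H x}"
      using R_hor[OF False] Y'_top False ca[OF H False] by (auto simp: lev'_def eval_aff_poly)
    finally show ?thesis using False by (simp add: lev'_def)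
  qed
  have lower: "\<exists>H0\<in>\<A>. lev' H0 < n \<and> lev' H0 = lev K \<and> (\<forall>x\<in>S. lin (Suc n) (Y' (lev' H0)) x - R H0 x =
      lin n (Y (lev K)) (\<pi> x) - rhs n Y (lev K) (c K) (g K) (\<pi> x))"
    if K: "K \<in> vertical_images n \<pi> \<A>" for K
  proof -
    obtain H0 where H0: "H0 \<in> \<A>" "vertical n \<pi> H0" "K = \<pi> ` H0"
      using K unfolding vertical_images_def by blast
    have "lev' H0 = lev K" using H0 by (simp add: lev'_def)
    then show ?thesis
      using lev[OF K] R_ver[OF H0(1,2), folded H0(3)] Y'_low[OF lev[OF K]]
      by (intro bexI[of _ H0] conjI ballI H0(1)) simp_all
  qed
  have diff: "\<exists>k. k \<noteq> 0 \<and> ((\<forall>x\<in>S. R H x - R H' x = k) \<or>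
      (\<exists>H0\<in>\<A>. lev' H0 < lev' H \<and> (\<forall>x\<in>S. R H x - R H' x = k * (lin (Suc n) (Y' (lev' H0)) x - R H0 x))))"
    if H: "H \<in> \<A>" "H' \<in> \<A>" "H \<noteq> H'" "lev' H = lev' H'" for H H'
  proof (cases "vertical n \<pi> H")
    case True
    have "lev' H < n" using lev[OF ver_in[OF H(1) True]] True by (simp add: lev'_def)
    then have True': "vertical n \<pi> H'" using H(4) by (auto simp: lev'_def split: if_splits)
    have ne: "\<pi> ` H \<noteq> \<pi> ` H'"
      using ver_char[OF True] ver_char[OF True'] H(3) by metis
    have le: "lev (\<pi> ` H) = lev (\<pi> ` H')"
      using H(4) True True' by (simp add: lev'_def)
    obtain k where k: "k \<noteq> 0" "(\<forall>x\<in>affine_space n. Q (\<pi> ` H) x - Q (\<pi> ` H') x = k) \<or>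
       (\<exists>K\<in>vertical_images n \<pi> \<A>. lev K < lev (\<pi> ` H) \<and> (\<forall>x\<in>affine_space n.
          Q (\<pi> ` H) x - Q (\<pi> ` H') x = k * (lin n (Y (lev K)) x - Q K x)))"
      using sep[OF ver_in[OF H(1) True] ver_in[OF H(2) True'] ne le] by (elim exE conjE)
    from k(2) show ?thesis
    proof
      assume "\<forall>x\<in>affine_space n. Q (\<pi> ` H) x - Q (\<pi> ` H') x = k"
      then have "\<forall>x\<in>S. R H x - R H' x = k"
        using R_ver[OF H(1) True] R_ver[OF H(2) True'] \<pi>S by (simp add: Q_def)
      then show ?thesis using k(1) by blast
    next
      assume "\<exists>K\<in>vertical_images n \<pi> \<A>. lev K < lev (\<pi> ` H) \<and> (\<forall>x\<in>affine_space n.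
          Q (\<pi> ` H) x - Q (\<pi> ` H') x = k * (lin n (Y (lev K)) x - Q K x))"
      then obtain K where K: "K \<in> vertical_images n \<pi> \<A>" "lev K < lev (\<pi> ` H)"
        "\<And>x. x \<in> affine_space n \<Longrightarrow> Q (\<pi> ` H) x - Q (\<pi> ` H') x = k * (lin n (Y (lev K)) x - Q K x)"
        by blast
      obtain H0 where H0: "H0 \<in> \<A>" "lev' H0 = lev K"
        "\<And>x. x \<in> S \<Longrightarrow> lin (Suc n) (Y' (lev' H0)) x - R H0 x = lin n (Y (lev K)) (\<pi> x) - Q K (\<pi> x)"
        using lower[OF K(1)] unfolding Q_def by blast
      have "\<forall>x\<in>S. R H x - R H' x = k * (lin (Suc n) (Y' (lev' H0)) x - R H0 x)"
        using R_ver[OF H(1) True] R_ver[OF H(2) True'] \<pi>S K(3) H0(3) by (simp add: Q_def)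
      moreover have "lev' H0 < lev' H" using H0(2) K(2) True by (simp add: lev'_def)
      ultimately show ?thesis using k(1) H0(1) by blast
    qed
  next
    case False
    have False': "\<not> vertical n \<pi> H'"
      using H(4) False lev[OF ver_in[OF H(2)]] by (auto simp: lev'_def split: if_splits)
    define cc where "cc = c1 H - c1 H'"
    define aa where "aa i = a1 H i - a1 H' i" for i
    have RR: "R H x - R H' x = cc + lin n aa (\<pi> x)" if "x \<in> S" for x
      using R_hor[OF False that] R_hor[OF False' that]
      by (simp add: cc_def aa_def[abs_def] lin_diff_left)
    show ?thesis
    proof (cases "\<forall>i<n. aa i = 0")
      case True
      then have "lin n aa z = 0" for z by (simp add: lin_def)
      then have const: "\<forall>x\<in>S. R H x - R H' x = cc" using RR by simp
      have "cc \<noteq> 0"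
      proof
        assume "cc = 0"
        then have "\<forall>x\<in>S. R H x = R H' x" using const by simp
        then have "{x \<in> S. lin (Suc n) (Y' (lev' H)) x = R H x} =
            {x \<in> S. lin (Suc n) (Y' (lev' H')) x = R H' x}"
          using H(4) by auto
        then have "H = H'" using eqn'[OF H(1)] eqn'[OF H(2)] by simp
        with H(3) show False by simp
      qed
      then show ?thesis using const by blast
    next
      case nc: False
      then obtain j where j: "j < n" "aa j \<noteq> 0" by blast
      have "f H - f H' = aff_poly n cc aa"
        using ca[OF H(1) False] ca[OF H(2) False'] by (simp add: aff_poly_diff cc_def aa_def[abs_def])
      then have inv: "inverse (poly_rat (aff_poly n cc aa)) \<in>
          coord_ring n {\<alpha>. degree_one n \<alpha> \<and> zero_set n \<alpha> \<in> vertical_images n \<pi> \<A>}"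
        using f_diff[OF H(1) False H(2) False' H(3)] by (simp add: complement_ring_def)
      have "aff_poly n cc aa \<noteq> 0"
      proof
        assume "aff_poly n cc aa = 0"
        then have "cc + lin n aa x = 0 + lin n (\<lambda>_. 0) x" for x
          using eval_aff_poly[of x n cc aa] by (simp add: eval_mpoly_0 lin_def)
        from affine_eq_coeffs(2)[OF this j(1)] j(2) show False by simp
      qed
      from unit_divides_product[OF this inv] obtain ss q where
        ss: "set ss \<subseteq> {\<alpha>. degree_one n \<alpha> \<and> zero_set n \<alpha> \<in> vertical_images n \<pi> \<A>}"
        and prod: "prod_list ss = aff_poly n cc aa * q" by blast
      have "\<exists>h. \<forall>\<alpha>\<in>set ss. \<alpha> = aff_poly n (fst (h \<alpha>)) (snd (h \<alpha>))"
        by (rule bchoice) (use ss in \<open>force simp: degree_one_aff_poly\<close>)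
      then obtain h where h: "\<And>\<alpha>. \<alpha> \<in> set ss \<Longrightarrow> \<alpha> = aff_poly n (fst (h \<alpha>)) (snd (h \<alpha>))" by blast
      have ev: "eval_mpoly x \<alpha> = fst (h \<alpha>) + lin n (snd (h \<alpha>)) x" if "\<alpha> \<in> set ss" for \<alpha> x
        by (subst h[OF that]) (rule eval_aff_poly)
      \<comment> \<open>If no factor vanished on all of \<open>f H = f H'\<close>, this hyperplane
        would have a point where every factor is nonzero, although \<open>prod\<close> makes the
        product 0 there.\<close>
      have "\<exists>\<alpha>\<in>set ss. \<forall>x\<in>affine_space n. cc + lin n aa x = 0 \<longrightarrow> eval_mpoly x \<alpha> = 0"
      proof (rule ccontr)
        assume no: "\<not> ?thesis"
        have "\<exists>x\<in>affine_space n. cc + lin n aa x = 0 \<and>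
            (\<forall>(c', a')\<in>set (map h ss). c' + lin n a' x \<noteq> 0)"
        proof (rule hyperplane_avoids[of j n aa, OF j])
          fix c' a' assume "(c', a') \<in> set (map h ss)"
          then obtain \<alpha> where "\<alpha> \<in> set ss" "h \<alpha> = (c', a')" by force
          then show "\<exists>x\<in>affine_space n. cc + lin n aa x = 0 \<and> c' + lin n a' x \<noteq> 0"
            using no ev[of \<alpha>] by force
        qed
        then obtain x where x: "cc + lin n aa x = 0" "\<forall>(c', a')\<in>set (map h ss). c' + lin n a' x \<noteq> 0"
          by blast
        have "eval_mpoly x (prod_list ss) = 0"
          unfolding prod eval_mpoly_mult eval_aff_poly x(1) by simp
        then obtain \<alpha> where "\<alpha> \<in> set ss" "eval_mpoly x \<alpha> = 0"
          unfolding eval_prod_list by (auto simp: prod_list_zero_iff)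
        with ev[of \<alpha> x] x(2) show False by (auto simp: case_prod_beta)
      qed
      then obtain \<alpha> where \<alpha>: "\<alpha> \<in> set ss"
        "\<And>x. x \<in> affine_space n \<Longrightarrow> cc + lin n aa x = 0 \<Longrightarrow> eval_mpoly x \<alpha> = 0" by blast
      define K where "K = zero_set n \<alpha>"
      have K: "K \<in> vertical_images n \<pi> \<A>" using \<alpha>(1) ss by (auto simp: K_def)
      define r where "r = lev K"
      have r: "r < n" using lev[OF K] by (simp add: r_def)
      define b where "b i = Y r i - (\<Sum>t<r. g K t * Y t i)" for i
      have psi: "lin n (Y r) z - rhs n Y r (c K) (g K) z = - c K + lin n b z" for z
        unfolding rhs_affine b_def[abs_def] lin_diff_left by simp
      have "- c K + lin n b z = 0" if "z \<in> affine_space n" "cc + lin n aa z = 0" for z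
      proof -
        have "z \<in> K" using \<alpha>(2)[OF that] that(1) by (simp add: K_def zero_set_def)
        then have "lin n (Y r) z = rhs n Y r (c K) (g K) z"
          using eqn[OF K] unfolding r_def by blast
        then show ?thesis using psi[of z] by simp
      qed
      from affine_multiple[of j n aa cc "- c K" b, OF j this]
      have mult: "lin n (Y r) z - rhs n Y r (c K) (g K) z = b j / aa j * (cc + lin n aa z)"
        if "z \<in> affine_space n" for z
        using psi that by simp
      define k where "k = b j / aa j"
      \<comment> \<open>For \<open>k = 0\<close> the equation of \<open>K\<close> would hold
        everywhere; at \<open>E r\<close> it says \<open>c K = 1\<close>, at the origin
        \<open>c K = 0\<close>.\<close>
      have "k \<noteq> 0"
      proof
        assume k0: "k = 0"
        have z: "lin n (Y r) z = rhs n Y r (c K) (g K) z" if "z \<in> affine_space n" for z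
          using mult[OF that, folded k_def] k0 by simp
        have "lin n (Y r) (E r) = rhs n Y r (c K) (g K) (E r)"
          using z E r by blast
        then have "1 = c K" using r by (simp add: rhs_def dual2)
        moreover have "0 = c K"
          using z[of "\<lambda>_. 0"] by (simp add: lin0 rhs_def affine_space_def)
        ultimately show False by simp
      qed
      obtain H0 where H0: "H0 \<in> \<A>" "lev' H0 < n" "\<And>x. x \<in> S \<Longrightarrow>
          lin (Suc n) (Y' (lev' H0)) x - R H0 x = lin n (Y r) (\<pi> x) - rhs n Y r (c K) (g K) (\<pi> x)"
        using lower[OF K] unfolding r_def by blast
      \<comment> \<open>\<open>mult\<close> expresses the equation of \<open>K\<close> by the
        difference, hence the inverse of \<open>k\<close>.\<close>
      have "\<forall>x\<in>S. R H x - R H' x = inverse k * (lin (Suc n) (Y' (lev' H0)) x - R H0 x)"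
        using RR H0(3) mult[OF \<pi>S, folded k_def] \<open>k \<noteq> 0\<close> by simp
      moreover have "lev' H0 < lev' H" using H0(2) False by (simp add: lev'_def)
      ultimately show ?thesis using \<open>k \<noteq> 0\<close> H0(1)
        by (intro exI[of _ "inverse k"]) auto
    qed
  qed
  have "adapted (Suc n) \<A> Y' E' lev' c' g'"
    unfolding adapted_def R_def[symmetric] S_def[symmetric]
    using E'(1) dual2' dual1' eqn' diff by (intro conjI allI impI ballI) auto
  then show ?thesis by blast
qed

theorem fiber_type_adapted:
  "fiber_type n \<A> \<Longrightarrow> \<exists>Y E lev c g. adapted n \<A> Y E lev c g"
proof (induction rule: fiber_type.induct)
  case (line \<A>)
  then show ?case by (rule adapted_line)
next
  case (step n \<A> \<pi> y)
  then show ?case using adapted_step by blast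
qed

section \<open>Forms in coordinates\<close>

definition one_form :: "'k::field_char_0 form \<Rightarrow> bool" where
  "one_form \<theta> \<longleftrightarrow> (\<forall>T. (\<nexists>i. T = {i}) \<longrightarrow> \<theta> T = 0)"

lemma pderiv_rat_0 [simp]: "pderiv_rat i 0 = 0"
  using pderiv_const_rat[of i 0] by (simp add: const_rat_0)

lemma pderiv_rat_inverse: "pderiv_rat i (inverse u) = - pderiv_rat i u * inverse u ^ 2"
proof -
  interpret slice_derivation "pderiv_rat i" "poly_rat (Var i)"
    by standard (simp_all add: pderiv_rat_add pderiv_rat_mult pderiv_poly_rat pderiv_Var)
  show ?thesis by (rule d_inverse)
qed

lemma dlog_singleton: "dlog p {i} = pderiv_rat i (poly_rat p) * inverse (poly_rat p)"
proof -
  have e: "{j. j = i \<and> j < i} = {}" by auto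
  show ?thesis by (simp add: e dlog_def form_scale_def ext_deriv_def fun_form_def)
qed

lemma one_form_dlog: "one_form (dlog p)"
  unfolding one_form_def
proof (intro allI impI)
  fix T :: "nat set" assume T: "\<nexists>i. T = {i}"
  have "fun_form (poly_rat p) (T - {i}) = 0" if "i \<in> T" for i
    using T that by (auto simp: fun_form_def)
  then have "ext_deriv (fun_form (poly_rat p)) T = 0"
    unfolding ext_deriv_def by (intro sum.neutral) simp
  then show "dlog p T = 0" by (simp add: dlog_def form_scale_def)
qed

lemma wedge_infinite: "infinite T \<Longrightarrow> wedge \<eta> \<theta> T = 0"
  by (simp add: wedge_def)

text \<open>A 1-form can be nonzero only on singletons, so just the splittings of \<open>T\<close>
  into \<open>T - {t}\<close> and \<open>{t}\<close> contribute.\<close>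

lemma wedge_one_form:
  assumes \<theta>: "one_form \<theta>" and T: "finite T"
  shows "wedge \<eta> \<theta> T = (\<Sum>t\<in>T. (-1) ^ card {i \<in> T - {t}. t < i} * \<eta> (T - {t}) * \<theta> {t})"
proof -
  let ?h = "\<lambda>I. (-1) ^ card {(i, j). i \<in> I \<and> j \<in> T - I \<and> j < i} * \<eta> I * \<theta> (T - I)"
  have "wedge \<eta> \<theta> T = (\<Sum>I\<in>(\<lambda>t. T - {t}) ` T. ?h I)"
    unfolding wedge_def
  proof (rule sum.mono_neutral_right)
    show "\<forall>I\<in>Pow T - (\<lambda>t. T - {t}) ` T. ?h I = 0"
    proof
      fix I assume I: "I \<in> Pow T - (\<lambda>t. T - {t}) ` T"
      have "T - I \<noteq> {t}" for t
      proof
        assume "T - I = {t}"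
        then have "t \<in> T" "I = T - {t}" using I by auto
        with I show False by auto
      qed
      then show "?h I = 0" using \<theta> by (auto simp: one_form_def)
    qed
  qed (use T in auto)
  also have "\<dots> = (\<Sum>t\<in>T. ?h (T - {t}))"
    by (subst sum.reindex) (auto simp: inj_on_def)
  also have "\<dots> = (\<Sum>t\<in>T. (-1) ^ card {i \<in> T - {t}. t < i} * \<eta> (T - {t}) * \<theta> {t})"
  proof (rule sum.cong[OF refl])
    fix t assume t: "t \<in> T"
    have "{(i, j). i \<in> T - {t} \<and> j \<in> T - (T - {t}) \<and> j < i} = (\<lambda>i. (i, t)) ` {i \<in> T - {t}. t < i}"
      using t by auto
    then have "card {(i, j). i \<in> T - {t} \<and> j \<in> T - (T - {t}) \<and> j < i} = card {i \<in> T - {t}. t < i}"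
      by (simp add: card_image inj_on_def)
    moreover have "T - (T - {t}) = {t}" using t by auto
    ultimately show "?h (T - {t}) = (-1) ^ card {i \<in> T - {t}. t < i} * \<eta> (T - {t}) * \<theta> {t}" by simp
  qed
  finally show ?thesis .
qed

lemma wedge_one_forms:
  assumes "one_form \<eta>" "one_form \<theta>"
  shows "i < j \<Longrightarrow> wedge \<eta> \<theta> {i, j} = \<eta> {i} * \<theta> {j} - \<eta> {j} * \<theta> {i}"
    and "(\<nexists>i j. i < j \<and> T = {i, j}) \<Longrightarrow> wedge \<eta> \<theta> T = 0"
proof -
  show "wedge \<eta> \<theta> {i, j} = \<eta> {i} * \<theta> {j} - \<eta> {j} * \<theta> {i}" if "i < j"
  proof -
    have s: "{i, j} - {i} = {j}" "{i, j} - {j} = {i}" using that by auto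
    have e: "{k. (k = i \<or> k = j) \<and> k \<noteq> i \<and> i < k} = {j}"
      "{k. (k = i \<or> k = j) \<and> k \<noteq> j \<and> j < k} = {}" using that by auto
    show ?thesis
      using that by (simp add: wedge_one_form[OF assms(2)] s e)
  qed
  show "wedge \<eta> \<theta> T = 0" if no: "\<nexists>i j. i < j \<and> T = {i, j}"
  proof (cases "finite T")
    case True
    have "\<eta> (T - {t}) = 0" if t: "t \<in> T" for t
    proof (rule ccontr)
      assume "\<eta> (T - {t}) \<noteq> 0"
      then obtain s where s: "T - {t} = {s}" using assms(1) by (auto simp: one_form_def)
      then have "T = {s, t}" "s \<noteq> t" using t by auto
      then have "s < t \<and> T = {s, t} \<or> t < s \<and> T = {t, s}" by auto
      then show False using no by blast
    qed
    then show ?thesis by (simp add: wedge_one_form[OF assms(2) True])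
  qed (rule wedge_infinite)
qed

lemma sum_fun: "(\<Sum>a\<in>S. h a) x = (\<Sum>a\<in>S. h a x)"
  by (induction S rule: infinite_finite_induct) auto

text \<open>Change of frame for 2-forms through 2 by 2 minors, applied in both directions between
  the \<open>dx\<close> components and the adapted frame.\<close>

lemma alternating_sum_change:
  fixes x z :: "nat \<Rightarrow> nat \<Rightarrow> 'f::field"
  assumes "\<And>a. a < N \<Longrightarrow> x a i = (\<Sum>s<l. M s i * z a s)" "\<And>a. a < N \<Longrightarrow> x a j = (\<Sum>s<l. M s j * z a s)"
  shows "(\<Sum>a<N. \<Sum>b<N. C a b * (x a i * x b j - x a j * x b i)) =
    (\<Sum>s<l. \<Sum>t<l. M s i * M t j * (\<Sum>a<N. \<Sum>b<N. C a b * (z a s * z b t - z a t * z b s)))"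
proof -
  have "x a i * x b j - x a j * x b i = (\<Sum>s<l. \<Sum>t<l. M s i * M t j * (z a s * z b t - z a t * z b s))"
    if "a < N" "b < N" for a b
  proof -
    have "x a i * x b j = (\<Sum>s<l. \<Sum>t<l. M s i * M t j * (z a s * z b t))"
      using assms that by (simp add: sum_product ac_simps)
    moreover have "x a j * x b i = (\<Sum>t<l. \<Sum>s<l. (M t j * z a t) * (M s i * z b s))"
      unfolding sum_product[symmetric] using assms that by simp
    then have "x a j * x b i = (\<Sum>t<l. \<Sum>s<l. M s i * M t j * (z a t * z b s))"
      by (simp add: ac_simps)
    then have "x a j * x b i = (\<Sum>s<l. \<Sum>t<l. M s i * M t j * (z a t * z b s))"
      by (subst sum.swap)
    ultimately show ?thesis by (simp add: sum_subtractf right_diff_distrib)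
  qed
  then have "(\<Sum>a<N. \<Sum>b<N. C a b * (x a i * x b j - x a j * x b i)) =
    (\<Sum>a<N. \<Sum>b<N. \<Sum>s<l. \<Sum>t<l. M s i * M t j * (C a b * (z a s * z b t - z a t * z b s)))"
    by (simp add: sum_distrib_left mult.left_commute)
  also have "\<dots> = (\<Sum>s<l. \<Sum>t<l. \<Sum>a<N. \<Sum>b<N. M s i * M t j * (C a b * (z a s * z b t - z a t * z b s)))"
    by (simp only: sum.swap[of _ "{..<l}" "{..<N}"])
  finally show ?thesis by (simp add: sum_distrib_left)
qed

lemma poly_rat_aff_poly:
  "poly_rat (aff_poly n c a) = const_rat c + (\<Sum>i<n. const_rat (a i) * poly_rat (Var i))"
  by (simp add: aff_poly_def poly_rat_add poly_rat_sum poly_rat_mult const_rat_def)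

lemma poly_rat_diff: "poly_rat (p - q) = poly_rat p - poly_rat q"
  using poly_rat_add[of "p - q" q] by simp

lemma pderiv_aff: "pderiv_rat i (poly_rat (aff_poly n c a)) = (if i < n then const_rat (a i) else 0)"
proof -
  have "pderiv_mpoly i (aff_poly n c a) = (\<Sum>j<n. if i = j then Const (a i) else 0)"
    unfolding aff_poly_def pderiv_mpoly_add pderiv_mpoly_sum pderiv_mpoly_mult pderiv_Const pderiv_Var
      add_0_left by (rule sum.cong) auto
  then show ?thesis by (simp add: pderiv_poly_rat const_rat_def)
qed

lemma aff_poly_cong: "c = c' \<Longrightarrow> (\<And>i. i < n \<Longrightarrow> a i = a' i) \<Longrightarrow> aff_poly n c a = aff_poly n c' a'"
  by (simp add: aff_poly_def)

section \<open>The tower of a concrete arrangement\<close>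

locale adapted_arrangement =
  fixes l N :: nat and \<alpha> :: "nat \<Rightarrow> 'k::field_char_0 mpoly"
    and Y E :: "nat \<Rightarrow> nat \<Rightarrow> 'k" and lev0 :: "(nat \<Rightarrow> 'k) set \<Rightarrow> nat"
    and c0 :: "(nat \<Rightarrow> 'k) set \<Rightarrow> 'k" and g0 :: "(nat \<Rightarrow> 'k) set \<Rightarrow> nat \<Rightarrow> 'k"
  assumes deg: "i < N \<Longrightarrow> degree_one l (\<alpha> i)"
    and inj: "inj_on (\<lambda>i. zero_set l (\<alpha> i)) {..<N}"
    and adapted: "adapted l ((\<lambda>i. zero_set l (\<alpha> i)) ` {..<N}) Y E lev0 c0 g0"
begin

definition lv :: "nat \<Rightarrow> nat" where "lv a = lev0 (zero_set l (\<alpha> a))"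
definition ct :: "nat \<Rightarrow> 'k" where "ct a = c0 (zero_set l (\<alpha> a))"
definition cf :: "nat \<Rightarrow> nat \<Rightarrow> 'k" where "cf a = g0 (zero_set l (\<alpha> a))"
definition yK :: "nat \<Rightarrow> 'k ratfun" where "yK s = poly_rat (aff_poly l 0 (Y s))"
definition dl :: "nat \<Rightarrow> 'k ratfun \<Rightarrow> 'k ratfun" where
  "dl s u = (\<Sum>i<l. const_rat (E s i) * pderiv_rat i u)"
definition fK :: "nat \<Rightarrow> 'k ratfun" where
  "fK a = const_rat (ct a) + (\<Sum>t<lv a. const_rat (cf a t) * yK t)"
definition eq_coeff :: "nat \<Rightarrow> nat \<Rightarrow> 'k" where "eq_coeff a i = Y (lv a) i - (\<Sum>t<lv a. cf a t * Y t i)"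

lemma dual2: "s < l \<Longrightarrow> t < l \<Longrightarrow> lin l (Y s) (E t) = (if s = t then 1 else 0)"
  and dual1: "i < l \<Longrightarrow> j < l \<Longrightarrow> (\<Sum>s<l. Y s j * E s i) = (if i = j then 1 else 0)"
  and lv: "a < N \<Longrightarrow> lv a < l"
  and eqn: "a < N \<Longrightarrow> zero_set l (\<alpha> a) =
      {x \<in> affine_space l. lin l (Y (lv a)) x = rhs l Y (lv a) (ct a) (cf a) x}"
proof -
  note I = adapted[unfolded adapted_def]
  note I2 = conjunct2[OF I] note I3 = conjunct2[OF I2] note I4 = conjunct2[OF I3]
  show "s < l \<Longrightarrow> t < l \<Longrightarrow> lin l (Y s) (E t) = (if s = t then 1 else 0)"
    "i < l \<Longrightarrow> j < l \<Longrightarrow> (\<Sum>s<l. Y s j * E s i) = (if i = j then 1 else 0)"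
    using conjunct1[OF I2] conjunct1[OF I3] by simp_all
  assume "a < N"
  then have "zero_set l (\<alpha> a) \<in> (\<lambda>i. zero_set l (\<alpha> i)) ` {..<N}" by simp
  from bspec[OF conjunct1[OF I4] this]
  show "lv a < l" "zero_set l (\<alpha> a) =
      {x \<in> affine_space l. lin l (Y (lv a)) x = rhs l Y (lv a) (ct a) (cf a) x}"
    unfolding lv_def ct_def cf_def by (rule conjunct1, rule conjunct2)
qed

lemma fK_poly: "fK a = poly_rat (aff_poly l (ct a) (\<lambda>i. \<Sum>t<lv a. cf a t * Y t i))"
proof -
  have "(\<Sum>t<lv a. const_rat (cf a t) * yK t) =
      (\<Sum>t<lv a. \<Sum>i<l. const_rat (cf a t * Y t i) * poly_rat (Var i))"
    by (simp add: yK_def poly_rat_aff_poly const_rat_0 sum_distrib_left const_rat_mult mult.assoc)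
  also have "\<dots> = (\<Sum>i<l. const_rat (\<Sum>t<lv a. cf a t * Y t i) * poly_rat (Var i))"
    by (subst sum.swap) (simp add: const_rat_sum sum_distrib_right)
  finally show ?thesis by (simp add: fK_def poly_rat_aff_poly)
qed

lemma eqn_poly: "yK (lv a) - fK a = poly_rat (aff_poly l (- ct a) (eq_coeff a))"
  unfolding yK_def fK_poly poly_rat_diff[symmetric] aff_poly_diff eq_coeff_def[abs_def] by simp

lemma dl_add: "dl s (u + v) = dl s u + dl s v"
  and dl_mult: "dl s (u * v) = dl s u * v + u * dl s v"
  and dl_const: "dl s (const_rat c) = 0"
  by (simp_all add: dl_def pderiv_rat_add pderiv_rat_mult pderiv_const_rat distrib_left sum.distrib
      sum_distrib_left sum_distrib_right ac_simps)

lemma dl_yK: "s < l \<Longrightarrow> t < l \<Longrightarrow> dl s (yK t) = (if s = t then 1 else 0)"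
proof -
  assume st: "s < l" "t < l"
  have "dl s (yK t) = const_rat (lin l (Y t) (E s))"
    by (simp add: dl_def yK_def pderiv_aff lin_def const_rat_sum const_rat_mult mult.commute)
  then show ?thesis using st by (simp add: dual2 const_rat_0 const_rat_1)
qed

lemma aff_rat_eqI:
  assumes "\<And>x. x \<in> affine_space l \<Longrightarrow> c + lin l a x = c' + lin l a' x"
  shows "poly_rat (aff_poly l c a) = poly_rat (aff_poly l c' a')"
  using affine_eq_coeffs[OF assms] aff_poly_cong[of c c' l a a'] by simp

lemma const_aff: "const_rat k * poly_rat (aff_poly l c a) = poly_rat (aff_poly l (k * c) (\<lambda>i. k * a i))"
  by (simp add: poly_rat_aff_poly const_rat_mult distrib_left sum_distrib_left mult.assoc)

lemma same_level_rat:
  assumes "a < N" "a' < N" "a \<noteq> a'" "lv a = lv a'"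
  shows "\<exists>k. k \<noteq> 0 \<and> (fK a - fK a' = const_rat k \<or>
        (\<exists>h<N. lv h < lv a \<and> fK a - fK a' = const_rat k * (yK (lv h) - fK h)))"
proof -
  note I = adapted[unfolded adapted_def]
  note I5 = conjunct2[OF conjunct2[OF conjunct2[OF conjunct2[OF I]]]]
  have Z: "zero_set l (\<alpha> a) \<in> (\<lambda>i. zero_set l (\<alpha> i)) ` {..<N}"
      "zero_set l (\<alpha> a') \<in> (\<lambda>i. zero_set l (\<alpha> i)) ` {..<N}"
    using assms by auto
  have ne: "zero_set l (\<alpha> a) \<noteq> zero_set l (\<alpha> a')"
    using inj assms by (auto simp: inj_on_def)
  define R where "R a x = rhs l Y (lv a) (ct a) (cf a) x" for a x
  have R: "R a x = ct a + lin l (\<lambda>i. \<Sum>t<lv a. cf a t * Y t i) x" for a x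
    by (simp add: R_def rhs_affine)
  have fd: "fK a - fK a' = poly_rat (aff_poly l (ct a - ct a')
      (\<lambda>i. (\<Sum>t<lv a. cf a t * Y t i) - (\<Sum>t<lv a'. cf a' t * Y t i)))"
    unfolding fK_poly poly_rat_diff[symmetric] aff_poly_diff ..
  have fd_eval: "ct a - ct a' + lin l (\<lambda>i. (\<Sum>t<lv a. cf a t * Y t i) - (\<Sum>t<lv a'. cf a' t * Y t i)) x =
      R a x - R a' x" for x
    unfolding R lin_diff_left by simp
  from bspec[OF bspec[OF I5 Z(1)] Z(2)] ne assms(4)
  obtain k where k: "k \<noteq> 0" "(\<forall>x\<in>affine_space l. R a x - R a' x = k) \<or>
      (\<exists>H0\<in>(\<lambda>i. zero_set l (\<alpha> i)) ` {..<N}. lev0 H0 < lv a \<and> (\<forall>x\<in>affine_space l.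
         R a x - R a' x = k * (lin l (Y (lev0 H0)) x - rhs l Y (lev0 H0) (c0 H0) (g0 H0) x)))"
    unfolding R_def lv_def ct_def cf_def by (elim impE exE conjE)
  from k(2) show ?thesis
  proof
    assume const: "\<forall>x\<in>affine_space l. R a x - R a' x = k"
    have "fK a - fK a' = poly_rat (aff_poly l k (\<lambda>_. 0))"
      unfolding fd
    proof (rule aff_rat_eqI)
      fix x :: "nat \<Rightarrow> 'k" assume "x \<in> affine_space l"
      then show "ct a - ct a' + lin l (\<lambda>i. (\<Sum>t<lv a. cf a t * Y t i) - (\<Sum>t<lv a'. cf a' t * Y t i)) x =
          k + lin l (\<lambda>_. 0) x"
        unfolding fd_eval using const by (simp add: lin_def)
    qed
    then show ?thesis using k(1) by (auto simp: poly_rat_aff_poly const_rat_0)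
  next
    assume "\<exists>H0\<in>(\<lambda>i. zero_set l (\<alpha> i)) ` {..<N}. lev0 H0 < lv a \<and> (\<forall>x\<in>affine_space l.
         R a x - R a' x = k * (lin l (Y (lev0 H0)) x - rhs l Y (lev0 H0) (c0 H0) (g0 H0) x))"
    then obtain H0 where H0: "H0 \<in> (\<lambda>i. zero_set l (\<alpha> i)) ` {..<N}" "lev0 H0 < lv a"
      "\<And>x. x \<in> affine_space l \<Longrightarrow>
         R a x - R a' x = k * (lin l (Y (lev0 H0)) x - rhs l Y (lev0 H0) (c0 H0) (g0 H0) x)"
      by (elim bexE conjE) simp
    from H0(1) obtain h where h0: "h < N" "H0 = zero_set l (\<alpha> h)" by (elim imageE) simp
    have h: "h < N" "lv h < lv a"
      "\<And>x. x \<in> affine_space l \<Longrightarrow> R a x - R a' x = k * (lin l (Y (lv h)) x - R h x)"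
      using h0(1) H0(2) H0(3) unfolding R_def[of h] lv_def[of h] ct_def[of h] cf_def[of h] h0(2)
      by simp_all
    have "fK a - fK a' = const_rat k * (yK (lv h) - fK h)"
      unfolding fd eqn_poly const_aff
    proof (rule aff_rat_eqI)
      fix x :: "nat \<Rightarrow> 'k" assume "x \<in> affine_space l"
      then show "ct a - ct a' + lin l (\<lambda>i. (\<Sum>t<lv a. cf a t * Y t i) - (\<Sum>t<lv a'. cf a' t * Y t i)) x =
          k * - ct h + lin l (\<lambda>i. k * eq_coeff h i) x"
        unfolding fd_eval using h(3)
        by (simp add: R eq_coeff_def[abs_def] lin_diff_left algebra_simps lin_def sum_distrib_left sum_subtractf)
    qed
    then show ?thesis using k(1) h(1,2) by blast
  qed
qed

sublocale fiber_tower const_rat l N dl yK lv fK ct cf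
  by unfold_locales
    (rule const_rat_1 const_rat_add const_rat_mult dl_add dl_mult dl_const dl_yK lv fK_def same_level_rat;
      assumption?)+

declare vs.scale_scale [simp del] (* loops with const_rat_mult *)

abbreviation dlog_coeff :: "nat \<Rightarrow> nat \<Rightarrow> 'k ratfun" where "dlog_coeff a i \<equiv> dlog (\<alpha> a) {i}"

lemma lin_scale_left: "lin n (\<lambda>i. t * e i) z = t * lin n e z"
  by (simp add: lin_def sum_distrib_left mult.assoc)

text \<open>The given equation and the normalised one have the same zero set, hence are proportional
  by \<open>affine_multiple\<close>. So both have the same logarithmic derivative, and their
  inverses differ by a constant.\<close>

lemma equation_multiple:
  assumes a: "a < N"
  shows "\<exists>k. k \<noteq> 0 \<and> poly_rat (\<alpha> a) = const_rat k * A a"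
proof -
  obtain c e j where \<alpha>: "\<alpha> a = aff_poly l c e" and j: "j < l" "e j \<noteq> 0"
    using deg[OF a] by (auto simp: degree_one_aff_poly)
  have psi: "lin l (Y (lv a)) z - rhs l Y (lv a) (ct a) (cf a) z = - ct a + lin l (eq_coeff a) z" for z
    unfolding rhs_affine eq_coeff_def[abs_def] lin_diff_left by simp
  have "- ct a + lin l (eq_coeff a) z = 0" if "z \<in> affine_space l" "c + lin l e z = 0" for z
  proof -
    have "z \<in> zero_set l (\<alpha> a)" using that by (simp add: zero_set_def \<alpha> eval_aff_poly)
    then have "lin l (Y (lv a)) z = rhs l Y (lv a) (ct a) (cf a) z"
      unfolding eqn[OF a] by blast
    then show ?thesis using psi[of z] by simp
  qed
  from affine_multiple[of j l e c "- ct a" "eq_coeff a", OF j this]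
  have mult: "- ct a + lin l (eq_coeff a) z = eq_coeff a j / e j * c + lin l (\<lambda>i. eq_coeff a j / e j * e i) z"
    if "z \<in> affine_space l" for z
    using that by (simp only: distrib_left lin_scale_left)
  define k where "k = eq_coeff a j / e j"
  have "A a = poly_rat (aff_poly l (- ct a) (eq_coeff a))"
    unfolding A_def eqn_poly ..
  also have "\<dots> = const_rat k * poly_rat (\<alpha> a)"
    unfolding \<alpha> const_aff using mult unfolding k_def by (rule aff_rat_eqI)
  finally have *: "A a = const_rat k * poly_rat (\<alpha> a)" .
  then have "k \<noteq> 0" using A_nz[OF a] by auto
  then have "poly_rat (\<alpha> a) = const_rat (inverse k) * A a"
    unfolding * \<kappa>_inverse by simp
  then show ?thesis using \<open>k \<noteq> 0\<close> by (intro exI[of _ "inverse k"]) simp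
qed

lemma dlog_A: "a < N \<Longrightarrow> dlog_coeff a i = pderiv_rat i (A a) * inverse (A a)"
proof -
  assume a: "a < N"
  obtain k where k: "k \<noteq> 0" "poly_rat (\<alpha> a) = const_rat k * A a"
    using equation_multiple[OF a] by blast
  then have "const_rat k \<noteq> 0" by simp
  then show ?thesis
    unfolding dlog_singleton k(2) pderiv_rat_mult pderiv_const_rat
    by (simp add: mult.commute mult.left_commute)
qed

lemma om_dlog: "a < N \<Longrightarrow> om s a = (\<Sum>i<l. const_rat (E s i) * dlog_coeff a i)"
  by (simp add: om_def dl_def dlog_A sum_distrib_right mult.assoc)

lemma pderiv_frame:
  assumes "i < l"
  shows "(\<Sum>s<l. const_rat (Y s i) * dl s u) = pderiv_rat i u"
proof -
  have "(\<Sum>s<l. const_rat (Y s i) * dl s u) =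
      (\<Sum>s<l. \<Sum>j<l. const_rat (Y s i * E s j) * pderiv_rat j u)"
    by (simp add: dl_def sum_distrib_left const_rat_mult mult.assoc)
  also have "\<dots> = (\<Sum>j<l. \<Sum>s<l. const_rat (Y s i * E s j) * pderiv_rat j u)"
    by (rule sum.swap)
  also have "\<dots> = (\<Sum>j<l. const_rat (\<Sum>s<l. Y s i * E s j) * pderiv_rat j u)"
    by (simp only: const_rat_sum sum_distrib_right)
  also have "\<dots> = (\<Sum>j<l. if j = i then pderiv_rat i u else 0)"
    using assms by (intro sum.cong refl) (auto simp: dual1 const_rat_1 const_rat_0)
  finally show ?thesis using assms by simp
qed

lemma dlog_om: "a < N \<Longrightarrow> i < l \<Longrightarrow> dlog_coeff a i = (\<Sum>s<l. const_rat (Y s i) * om s a)"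
  by (simp add: om_def dlog_A pderiv_frame[symmetric] sum_distrib_right mult.assoc)

lemma A_poly: "A a = poly_rat (aff_poly l (- ct a) (eq_coeff a))"
  unfolding A_def eqn_poly ..

text \<open>\<open>ext_deriv\<close> and \<open>wedge\<close> admit indices beyond the coordinates.
  Together with \<open>pderiv_high\<close> this discards them when sums over index sets are compared
  with sums below \<open>l\<close>.\<close>

lemma dlog_high: "a < N \<Longrightarrow> l \<le> i \<Longrightarrow> dlog_coeff a i = 0"
  by (simp add: dlog_A A_poly pderiv_aff)

lemma pderiv_high: "u \<in> \<O> r \<Longrightarrow> l \<le> i \<Longrightarrow> pderiv_rat i u = 0"
  by (induction rule: \<O>.induct)
    (auto simp: pderiv_const_rat yK_def pderiv_aff A_poly pderiv_rat_inverse pderiv_rat_add pderiv_rat_mult)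

lemma coord_ring_eq: "coord_ring l (\<alpha> ` {..<N}) = \<O> l"
proof (intro equalityI subsetI)
  fix u assume "u \<in> coord_ring l (\<alpha> ` {..<N})"
  then show "u \<in> \<O> l"
  proof (induction rule: coord_ring.induct)
    case (var i)
    have "(\<Sum>s<l. const_rat (E s i) * yK s) =
        (\<Sum>s<l. \<Sum>j<l. const_rat (Y s j * E s i) * poly_rat (Var j))"
      by (simp add: yK_def poly_rat_aff_poly const_rat_0 sum_distrib_left const_rat_mult ac_simps)
    also have "\<dots> = (\<Sum>j<l. \<Sum>s<l. const_rat (Y s j * E s i) * poly_rat (Var j))"
      by (rule sum.swap)
    also have "\<dots> = (\<Sum>j<l. const_rat (\<Sum>s<l. Y s j * E s i) * poly_rat (Var j))"
      by (simp only: const_rat_sum sum_distrib_right)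
    also have "\<dots> = (\<Sum>j<l. if j = i then poly_rat (Var i) else 0)"
      using var by (intro sum.cong refl) (auto simp: dual1 const_rat_1 const_rat_0)
    also have "\<dots> = poly_rat (Var i)" using var by simp
    finally show ?case
      using \<O>_sum[of "{..<l}" "\<lambda>s. const_rat (E s i) * yK s" l] by (auto intro: \<O>.intros)
  next
    case (inv s)
    then obtain a where a: "a < N" "s = \<alpha> a" by blast
    obtain k where k: "k \<noteq> 0" "poly_rat (\<alpha> a) = const_rat k * A a"
      using equation_multiple[OF a(1)] by blast
    have "inverse (poly_rat s) = const_rat (inverse k) * inverse (A a)"
      using k by (simp add: a(2) \<kappa>_inverse)
    then show ?case using a(1) lv by (auto intro!: \<O>.mult \<O>.const \<O>.inv)
  qed (auto intro: \<O>.intros)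
next
  fix u assume "u \<in> \<O> l"
  then show "u \<in> coord_ring l (\<alpha> ` {..<N})"
  proof (induction rule: \<O>.induct)
    case (var t)
    have "(\<Sum>i<m. const_rat (Y t i) * poly_rat (Var i)) \<in> coord_ring l (\<alpha> ` {..<N})" if "m \<le> l" for m
      using that
    proof (induction m)
      case 0
      then show ?case using coord_ring.const[of 0 l "\<alpha> ` {..<N}"] by (simp add: const_rat_0)
    next
      case (Suc m)
      then show ?case
        by (simp add: coord_ring.add coord_ring.mult coord_ring.const coord_ring.var)
    qed
    then show ?case by (simp add: yK_def poly_rat_aff_poly const_rat_0)
  next
    case (inv a)
    obtain k where k: "k \<noteq> 0" "poly_rat (\<alpha> a) = const_rat k * A a"
      using equation_multiple[OF inv(1)] by blast
    then have "inverse (A a) = const_rat k * inverse (poly_rat (\<alpha> a))"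
      by simp
    then show ?case using inv(1) by (auto intro!: coord_ring.mult coord_ring.const coord_ring.inv)
  qed (auto intro: coord_ring.intros)
qed

text \<open>Both sides say that one 2-form vanishes, on the left in \<open>dx\<close> components, on
  the right in the adapted frame; the change of frame is invertible.\<close>

lemma quadratic_relation:
  "(\<Sum>a<N. \<Sum>b<N. form_scale (const_rat (C a b)) (wedge (dlog (\<alpha> a)) (dlog (\<alpha> b)))) = 0 \<longleftrightarrow>
    (\<forall>s<l. \<forall>t<l. (\<Sum>a<N. \<Sum>b<N. const_rat (C a b) * om2 s t a b) = 0)"
    (is "?F = 0 \<longleftrightarrow> ?R")
proof -
  define d2 where "d2 i j = (\<Sum>a<N. \<Sum>b<N. const_rat (C a b) * (dlog_coeff a i * dlog_coeff b j - dlog_coeff a j * dlog_coeff b i))" for i j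
  have F: "?F T = (\<Sum>a<N. \<Sum>b<N. const_rat (C a b) * wedge (dlog (\<alpha> a)) (dlog (\<alpha> b)) T)" for T
    by (simp add: sum_fun form_scale_def)
  have F2: "?F {i, j} = d2 i j" if "i < j" for i j
    unfolding F d2_def wedge_one_forms(1)[OF one_form_dlog one_form_dlog that] ..
  have anti: "d2 j i = - d2 i j" for i j
    by (simp add: d2_def sum_negf[symmetric] right_diff_distrib)
  have "?F = 0 \<longleftrightarrow> (\<forall>i j. d2 i j = 0)"
  proof
    assume z: "?F = 0"
    show "\<forall>i j. d2 i j = 0"
    proof (intro allI)
      fix i j :: nat
      consider "i < j" | "j < i" | "i = j" by linarith
      then show "d2 i j = 0"
      proof cases
        case 1
        then show ?thesis using F2[OF 1] unfolding z by simp
      next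
        case 2
        then show ?thesis using F2[OF 2] anti[of j i] unfolding z by simp
      next
        case 3
        then show ?thesis by (simp add: d2_def)
      qed
    qed
  next
    assume z: "\<forall>i j. d2 i j = 0"
    show "?F = 0"
    proof
      fix T
      show "?F T = 0 T"
      proof (cases "\<exists>i j. i < j \<and> T = {i, j}")
        case True
        then obtain i j where "i < j" "T = {i, j}" by blast
        then show ?thesis using F2[of i j] z by simp
      next
        case False
        then show ?thesis
          unfolding F
          by (simp add: wedge_one_forms(2)[OF one_form_dlog one_form_dlog False])
      qed
    qed
  qed
  also have "\<dots> \<longleftrightarrow> ?R"
  proof
    assume z: "\<forall>i j. d2 i j = 0"
    show ?R
    proof (intro allI impI)
      fix s t
      have "(\<Sum>a<N. \<Sum>b<N. const_rat (C a b) * om2 s t a b) =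
        (\<Sum>i<l. \<Sum>j<l. const_rat (E s i) * const_rat (E t j) * d2 i j)"
        unfolding om2_def d2_def
        by (rule alternating_sum_change[where x = "\<lambda>a s. om s a" and z = dlog_coeff and M = "\<lambda>i s. const_rat (E s i)"])
           (simp_all add: om_dlog)
      then show "(\<Sum>a<N. \<Sum>b<N. const_rat (C a b) * om2 s t a b) = 0"
        using z by simp
    qed
  next
    assume R: ?R
    show "\<forall>i j. d2 i j = 0"
    proof (intro allI)
      fix i j
      show "d2 i j = 0"
      proof (cases "i < l \<and> j < l")
        case True
        have "d2 i j = (\<Sum>s<l. \<Sum>t<l. const_rat (Y s i) * const_rat (Y t j) *
            (\<Sum>a<N. \<Sum>b<N. const_rat (C a b) * om2 s t a b))"
          unfolding om2_def d2_def
          by (rule alternating_sum_change[where x = dlog_coeff and z = "\<lambda>a s. om s a" and M = "\<lambda>s i. const_rat (Y s i)"])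
             (use True in \<open>simp_all add: dlog_om\<close>)
        then show ?thesis using R by simp
      next
        case False
        then show ?thesis
          unfolding d2_def by (intro sum.neutral ballI) (auto simp: dlog_high)
      qed
    qed
  qed
  finally show ?thesis .
qed

section \<open>Homogeneous and bounded words, tensors and forms\<close>

lemma bar_words_W: "c \<in> bar_words N \<alpha> m \<Longrightarrow> c \<in> W l m"
proof -
  assume c: "c \<in> bar_words N \<alpha> m"
  have "(\<Sum>a<N. \<Sum>b<N. const_rat (c (u @ [a, b] @ v)) * om2 s t a b) = 0"
    if "s < l" "t < l" for u v s t
  proof (cases "length u + 2 + length v = m")
    case True
    then show ?thesis
      using c that quadratic_relation[of "\<lambda>a b. c (u @ [a, b] @ v)"] by (simp add: bar_words_def)
  next
    case False
    then have "c (u @ [a, b] @ v) = 0" for a b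
      using c by (force simp: bar_words_def)
    then show ?thesis by (simp add: const_rat_0)
  qed
  moreover have "length w \<le> m \<and> (\<forall>a\<in>set w. a < N \<and> lv a < l)" if "c w \<noteq> 0" for w
  proof -
    have "length w = m" "set w \<subseteq> {..<N}" using c that by (auto simp: bar_words_def)
    then show ?thesis using lv by auto
  qed
  ultimately show ?thesis unfolding W_def by simp
qed

text \<open>Each integrability relation involves words of one length only, so it passes to
  homogeneous components.\<close>

lemma W_bar_words: "c \<in> W l m \<Longrightarrow> (\<lambda>w. if length w = j then c w else 0) \<in> bar_words N \<alpha> j"
proof -
  assume c: "c \<in> W l m"
  have "(\<Sum>a<N. \<Sum>b<N. form_scale (const_rat (c (u @ [a, b] @ v)))
          (wedge (dlog (\<alpha> a)) (dlog (\<alpha> b)))) = 0" for u v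
    unfolding quadratic_relation using W_integrable[OF c] by blast
  moreover have "set w \<subseteq> {..<N}" if "c w \<noteq> 0" for w
    using W_support[OF c that] by auto
  ultimately show ?thesis by (simp add: bar_words_def)
qed

lemma sum_concat: "(\<Sum>r<(m::nat) + n. h r) = (\<Sum>r<m. h r) + (\<Sum>r<n. h (m + r) :: 'z::comm_monoid_add)"
  by (induction n) (simp_all add: add.assoc)

definition tensor_sum :: "nat \<Rightarrow> (nat \<Rightarrow> 'k ratfun) \<Rightarrow> (nat \<Rightarrow> nat list \<Rightarrow> 'k) \<Rightarrow> nat list \<Rightarrow> 'k ratfun"
  where "tensor_sum R \<phi> c w = (\<Sum>r<R. \<phi> r * const_rat (c r w))"

lemma bar_decomposition:
  "F \<in> bar l \<Longrightarrow> \<exists>R \<phi> c. F = tensor_sum R \<phi> c \<and>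
     (\<forall>r<R. \<phi> r \<in> \<O> l \<and> c r \<in> (\<Union>m. bar_words N \<alpha> m))"
proof (induction rule: bar.induct)
  case (tensor \<phi> c m)
  have "\<phi> * const_rat (c w) = tensor_sum (Suc m) (\<lambda>_. \<phi>) (\<lambda>r w. if length w = r then c w else 0) w" for w
  proof -
    have "(\<Sum>r<Suc m. \<phi> * const_rat (if length w = r then c w else 0)) =
        (\<Sum>r<Suc m. if r = length w then \<phi> * const_rat (c w) else 0)"
      by (rule sum.cong) (auto simp: const_rat_0)
    then show ?thesis using W_support[OF tensor(2), of w] by (auto simp: const_rat_0 tensor_sum_def)
  qed
  then have "(\<lambda>w. \<phi> * const_rat (c w)) = tensor_sum (Suc m) (\<lambda>_. \<phi>) (\<lambda>r w. if length w = r then c w else 0)"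
    by blast
  moreover have "\<phi> \<in> \<O> l \<and> (\<lambda>w. if length w = r then c w else 0) \<in> (\<Union>m. bar_words N \<alpha> m)" for r
    using tensor(1) W_bar_words[OF tensor(2)] by blast
  ultimately show ?case by blast
next
  case (add F G)
  obtain R \<phi> c where F: "F = tensor_sum R \<phi> c"
      "\<forall>r<R. \<phi> r \<in> \<O> l \<and> c r \<in> (\<Union>m. bar_words N \<alpha> m)"
    using add.IH(1) by blast
  obtain R' \<phi>' c' where G: "G = tensor_sum R' \<phi>' c'"
      "\<forall>r<R'. \<phi>' r \<in> \<O> l \<and> c' r \<in> (\<Union>m. bar_words N \<alpha> m)"
    using add.IH(2) by blast
  note * = F G
  define \<phi>'' where "\<phi>'' r = (if r < R then \<phi> r else \<phi>' (r - R))" for r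
  define c'' where "c'' r = (if r < R then c r else c' (r - R))" for r
  have "(\<lambda>w. F w + G w) = tensor_sum (R + R') \<phi>'' c''"
    unfolding tensor_sum_def[abs_def] sum_concat *(1,3) by (simp add: \<phi>''_def c''_def)
  moreover have "\<phi>'' r \<in> \<O> l \<and> c'' r \<in> (\<Union>m. bar_words N \<alpha> m)" if "r < R + R'" for r
    using *(2,4) that by (auto simp: \<phi>''_def c''_def)
  ultimately show ?case by blast
qed

lemma bar_formsI:
  assumes "\<Phi> = (\<Sum>r<(R::nat). pure_tensor (\<phi> r) (c r))"
    and "\<And>r. r < R \<Longrightarrow> \<phi> r \<in> forms l (\<alpha> ` {..<N}) j \<and> c r \<in> (\<Union>m. bar_words N \<alpha> m)"
  shows "\<Phi> \<in> bar_forms l N \<alpha> j"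
  unfolding bar_forms_def
  by (rule CollectI, rule exI[of _ R], rule exI[of _ \<phi>], rule exI[of _ c]) (use assms in blast)

lemma bar_forms_add:
  assumes "\<Phi> \<in> bar_forms l N \<alpha> j" "\<Psi> \<in> bar_forms l N \<alpha> j"
  shows "\<Phi> + \<Psi> \<in> bar_forms l N \<alpha> j"
proof -
  obtain R \<phi> c R' \<phi>' c' where *: "\<Phi> = (\<Sum>r<(R::nat). pure_tensor (\<phi> r) (c r))"
      "\<forall>r<R. \<phi> r \<in> forms l (\<alpha> ` {..<N}) j \<and> c r \<in> (\<Union>m. bar_words N \<alpha> m)"
      "\<Psi> = (\<Sum>r<(R'::nat). pure_tensor (\<phi>' r) (c' r))"
      "\<forall>r<R'. \<phi>' r \<in> forms l (\<alpha> ` {..<N}) j \<and> c' r \<in> (\<Union>m. bar_words N \<alpha> m)"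
    using assms unfolding bar_forms_def by blast
  define \<phi>'' where "\<phi>'' r = (if r < R then \<phi> r else \<phi>' (r - R))" for r
  define c'' where "c'' r = (if r < R then c r else c' (r - R))" for r
  have "\<Phi> + \<Psi> = (\<Sum>r<R + R'. pure_tensor (\<phi>'' r) (c'' r))"
    unfolding sum_concat *(1,3) by (simp add: \<phi>''_def c''_def)
  moreover have "\<forall>r<R + R'. \<phi>'' r \<in> forms l (\<alpha> ` {..<N}) j \<and> c'' r \<in> (\<Union>m. bar_words N \<alpha> m)"
    using *(2,4) by (auto simp: \<phi>''_def c''_def)
  ultimately show ?thesis unfolding bar_forms_def by blast
qed

lemma bar_forms_zero: "0 \<in> bar_forms l N \<alpha> j"
  by (rule bar_formsI[of _ 0]) auto

lemma bar_forms_sum: "(\<And>T. T \<in> S \<Longrightarrow> \<Phi> T \<in> bar_forms l N \<alpha> j) \<Longrightarrow> sum \<Phi> S \<in> bar_forms l N \<alpha> j"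
  by (induction S rule: infinite_finite_induct) (auto simp: bar_forms_zero intro: bar_forms_add)

subsection \<open>The Koszul complex of the bar construction\<close>

interpretation K: koszul_tower "\<lambda>k F w. const_rat k * F w" l D bar Y E
proof unfold_locales
  show "(\<lambda>w. const_rat k * (F + G) w) = (\<lambda>w. const_rat k * F w) + (\<lambda>w. const_rat k * G w)"
    for k and F G :: "nat list \<Rightarrow> 'k ratfun"
    by (simp add: fun_eq_iff distrib_left)
  show "(\<lambda>w. const_rat (k + k') * F w) = (\<lambda>w. const_rat k * F w) + (\<lambda>w. const_rat k' * F w)"
    for k k' and F :: "nat list \<Rightarrow> 'k ratfun"
    by (simp add: fun_eq_iff const_rat_add distrib_right)
  show "(\<lambda>w. const_rat k * (const_rat k' * F w)) = (\<lambda>w. const_rat (k * k') * F w)"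
    for k k' and F :: "nat list \<Rightarrow> 'k ratfun"
    by (simp add: const_rat_mult mult.assoc)
  show "(\<lambda>w. const_rat 1 * F w) = F" for F :: "nat list \<Rightarrow> 'k ratfun"
    by (simp add: const_rat_1)
  show "D s (F + G) = D s F + D s G" for s F G
    using D_add[of s F G] by (simp add: plus_fun_def)
  show "D s (\<lambda>w. const_rat k * F w) = (\<lambda>w. const_rat k * D s F w)" for s k F
    by (rule D_scale)
  show "bar r \<subseteq> bar r'" if "r \<le> r'" for r r'
    using bar_mono[OF that] by blast
  show "D s F \<in> bar l" if "s < l" "F \<in> bar l" for s F
    using D_bar that by blast
  show "D s (D t F) = D t (D s F)" if "s < l" "t < l" "F \<in> bar l" for s t F
    using D_commute that by blast
  show "D s F = 0" if "F \<in> bar r" "r \<le> s" "s < l" for F r s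
    using that
  proof (induction rule: bar.induct)
    case (tensor \<phi> c m)
    have "const_rat (c (a # w)) * om s a = 0" if "a < N" for a w
      using W_support[OF tensor(2), of "a # w"] om_high[OF that tensor(4)] tensor(3)
      by (cases "c (a # w) = 0") (auto simp: const_rat_0)
    moreover have "dl s \<phi> = 0" using \<O>_subset_consts tensor by blast
    ultimately show ?case
      unfolding D_tensor by (auto simp: fun_eq_iff mult.assoc mult.commute[of "om _ _"] intro!: sum.neutral)
  next
    case (add F G)
    then show ?case by (simp add: D_add zero_fun_def)
  qed
  show "\<exists>G\<in>bar (Suc r). D r G = F" if "r < l" "F \<in> bar (Suc r)" for r F
    using bar_surjective that by blast
  show "F \<in> bar r" if "r < l" "F \<in> bar (Suc r)" "D r F = 0" for r F
    using bar_kernel[OF that(1,2)] that(3) by (simp add: zero_fun_def)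
  show "(\<Sum>s<l. Y s i * E s j) = (if i = j then 1 else 0)" if "i < l" "j < l" for i j
    using dual1[OF that(2,1)] by auto
  show "(\<Sum>i<l. Y s i * E t i) = (if s = t then 1 else 0)" if "s < l" "t < l" for s t
    using dual2[OF that] by (simp add: lin_def)
  show "module.subspace (\<lambda>k F w. const_rat k * F w) (bar r)" for r
  proof -
    interpret m: module "\<lambda>k F w. const_rat k * F w :: 'k ratfun"
      by unfold_locales (auto simp: fun_eq_iff distrib_left const_rat_add distrib_right const_rat_mult mult.assoc const_rat_1)
    show ?thesis
      unfolding m.subspace_def
      using bar_zero bar.add bar_scale by (auto simp: zero_fun_def plus_fun_def)
  qed
qed

text \<open>Exchanges the order of word and index set: on the Koszul side each index set has a bar
  element as coefficient. For the converse \<open>\<Phi>\<close> is split by index sets and each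
  coefficient into pure tensors.\<close>

lemma bar_forms_iff: "\<Phi> \<in> bar_forms l N \<alpha> j \<longleftrightarrow> (\<lambda>T w. \<Phi> w T) \<in> K.Forms l j"
proof
  assume "\<Phi> \<in> bar_forms l N \<alpha> j"
  then obtain R \<phi> c where \<Phi>: "\<Phi> = (\<Sum>r<(R::nat). pure_tensor (\<phi> r) (c r))"
      and *: "\<And>r. r < R \<Longrightarrow> \<phi> r \<in> forms l (\<alpha> ` {..<N}) j \<and> c r \<in> (\<Union>m. bar_words N \<alpha> m)"
    unfolding bar_forms_def by blast
  have \<Phi>T: "\<Phi> w T = (\<Sum>r<R. \<phi> r T * const_rat (c r w))" for w T
    by (simp add: \<Phi> sum_fun pure_tensor_def form_scale_def mult.commute)
  have "(\<lambda>w. \<Phi> w T) \<in> bar l" for T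
    unfolding \<Phi>T
  proof (rule bar_sum)
    fix r assume "r \<in> {..<R}"
    then obtain m where "\<phi> r T \<in> \<O> l" "c r \<in> bar_words N \<alpha> m"
      using *[of r] by (auto simp: forms_def coord_ring_eq)
    then show "(\<lambda>w. \<phi> r T * const_rat (c r w)) \<in> bar l"
      using bar_words_W bar.tensor by blast
  qed
  moreover have "T \<subseteq> {..<l} \<and> card T = j" if "(\<lambda>w. \<Phi> w T) \<noteq> 0" for T
  proof -
    have "\<exists>r<R. \<phi> r T \<noteq> 0"
    proof (rule ccontr)
      assume "\<not> ?thesis"
      then have "\<Phi> w T = 0" for w unfolding \<Phi>T by (intro sum.neutral) auto
      with that show False by (simp add: fun_eq_iff)
    qed
    then show ?thesis using * unfolding forms_def by blast
  qed
  ultimately show "(\<lambda>T w. \<Phi> w T) \<in> K.Forms l j" by (simp add: K.Forms_def)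
next
  assume F: "(\<lambda>T w. \<Phi> w T) \<in> K.Forms l j"
  define \<T> where "\<T> = {T. T \<subseteq> {..<l} \<and> card T = j}"
  have fin: "finite \<T>" unfolding \<T>_def by (rule finite_subset[of _ "Pow {..<l}"]) auto
  have zero: "\<Phi> w T = 0" if "T \<notin> \<T>" for w T
  proof -
    have "(\<lambda>w. \<Phi> w T) = 0" using F that unfolding K.Forms_def \<T>_def by blast
    then show ?thesis by (simp add: fun_eq_iff)
  qed
  define P where "P T = (\<lambda>w T'. if T' = T then \<Phi> w T else 0)" for T
  have "\<Phi> = (\<Sum>T\<in>\<T>. P T)"
  proof (intro ext)
    fix w T
    have "(\<Sum>T'\<in>\<T>. P T') w T = (\<Sum>T'\<in>\<T>. if T' = T then \<Phi> w T else 0)"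
      unfolding sum_fun P_def by (rule sum.cong) auto
    then show "\<Phi> w T = (\<Sum>T\<in>\<T>. P T) w T"
      using zero fin by simp
  qed
  also have "\<dots> \<in> bar_forms l N \<alpha> j"
  proof (rule bar_forms_sum)
    fix T assume T: "T \<in> \<T>"
    have "(\<lambda>w. \<Phi> w T) \<in> bar l" using F by (simp add: K.Forms_def)
    then obtain R \<phi> c where R: "(\<lambda>w. \<Phi> w T) = tensor_sum R \<phi> c"
      "\<And>r. r < R \<Longrightarrow> \<phi> r \<in> \<O> l \<and> c r \<in> (\<Union>m. bar_words N \<alpha> m)"
      using bar_decomposition[of "\<lambda>w. \<Phi> w T"] by blast
    have "P T = (\<Sum>r<R. pure_tensor (\<lambda>T'. if T' = T then \<phi> r else 0) (c r))"
    proof (intro ext)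
      fix w T'
      show "P T w T' = (\<Sum>r<R. pure_tensor (\<lambda>T'. if T' = T then \<phi> r else 0) (c r)) w T'"
        using fun_cong[OF R(1), of w]
        by (simp add: P_def tensor_sum_def sum_fun pure_tensor_def form_scale_def mult.commute)
    qed
    then show "P T \<in> bar_forms l N \<alpha> j"
    proof (rule bar_formsI)
      fix r assume r: "r < R"
      show "(\<lambda>T'. if T' = T then \<phi> r else 0) \<in> forms l (\<alpha> ` {..<N}) j \<and>
          c r \<in> (\<Union>m. bar_words N \<alpha> m)"
        using R(2)[OF r] T by (auto simp: forms_def coord_ring_eq \<T>_def)
    qed
  qed
  finally show "\<Phi> \<in> bar_forms l N \<alpha> j" .
qed

text \<open>The factor \<open>(-1)^j\<close> of the bar differential turns multiplication by
  \<open>dx_t\<close> from the right, whose sign counts the larger indices, into multiplication from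
  the left, whose sign counts the smaller ones.\<close>

lemma minus_one_power_split:
  fixes T :: "nat set"
  assumes "finite T" "card T = Suc j" "t \<in> T"
  shows "(-1 :: 'z::comm_ring_1) ^ j * (-1) ^ card {i \<in> T - {t}. t < i} = (-1) ^ card {i \<in> T. i < t}"
proof -
  define L where "L = {i \<in> T. i < t}"
  define G where "G = {i \<in> T - {t}. t < i}"
  have "T - {t} = L \<union> G" using assms(3) by (auto simp: L_def G_def)
  moreover have "card (L \<union> G) = card L + card G"
    by (rule card_Un_disjoint) (use assms(1) in \<open>auto simp: L_def G_def\<close>)
  moreover have "card (T - {t}) = j" using assms by simp
  ultimately have j: "j = card L + card G" by simp
  have "(-1 :: 'z) ^ (2 * card G) = 1" by (rule power_minus1_even)
  then have "(-1 :: 'z) ^ card G * (-1) ^ card G = 1"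
    by (simp only: mult_2 power_add)
  then show ?thesis unfolding L_def[symmetric] G_def[symmetric] j power_add mult.assoc by simp
qed

lemma sg_fun: "sg i T F w = (-1) ^ card {j \<in> T. j < i} * (F w :: 'k ratfun)"
  by (simp add: sg_def even_below_def uminus_power_if)

lemma bar_diff_dd:
  assumes "\<Phi> \<in> bar_forms l N \<alpha> j"
  shows "bar_diff N \<alpha> j \<Phi> w T = K.dd (\<lambda>T w. \<Phi> w T) T w"
proof -
  have F: "(\<lambda>T w. \<Phi> w T) \<in> K.Forms l j" using assms by (simp add: bar_forms_iff)
  have \<Phi>B: "(\<lambda>w. \<Phi> w T) \<in> bar l" for T using F by (simp add: K.Forms_def)
  have \<Phi>\<O>: "\<Phi> w T \<in> \<O> l" for w T using bar_bounds[OF \<Phi>B[of T]] by blast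
  have \<Phi>nz: "T \<subseteq> {..<l} \<and> card T = j" if "\<Phi> w T \<noteq> 0" for w T
  proof -
    have "(\<lambda>w. \<Phi> w T) \<noteq> 0" using that by (auto simp: fun_eq_iff)
    then show ?thesis using F unfolding K.Forms_def by blast
  qed
  \<comment> \<open>The covariant derivative along the \<open>i\<close>-th original
    coordinate.\<close>
  define nab where "nab i T = pderiv_rat i (\<Phi> w T) + (\<Sum>a<N. \<Phi> (a # w) T * dlog_coeff a i)" for i T
  have nab: "(\<Sum>s<l. (\<lambda>w. const_rat (Y s i) * D s (\<lambda>w. \<Phi> w T) w)) w = nab i T" if "i < l" for i T
  proof -
    have "(\<Sum>s<l. const_rat (Y s i) * D s (\<lambda>w. \<Phi> w T) w) =
        (\<Sum>s<l. const_rat (Y s i) * dl s (\<Phi> w T)) +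
        (\<Sum>s<l. \<Sum>a<N. \<Phi> (a # w) T * (const_rat (Y s i) * om s a))"
      by (simp add: D_def distrib_left sum.distrib sum_distrib_left mult.left_commute)
    also have "(\<Sum>s<l. \<Sum>a<N. \<Phi> (a # w) T * (const_rat (Y s i) * om s a)) =
        (\<Sum>a<N. \<Phi> (a # w) T * dlog_coeff a i)"
      by (subst sum.swap) (simp add: sum_distrib_left[symmetric] dlog_om that)
    finally show ?thesis by (simp add: sum_fun pderiv_frame[OF that] nab_def)
  qed
  have dd: "K.dd (\<lambda>T w. \<Phi> w T) T w =
      (\<Sum>i<l. if i \<in> T then (-1) ^ card {j \<in> T. j < i} * nab i (T - {i}) else 0)"
    unfolding K.dd_eq sum_fun wedge_dx_def
    by (rule sum.cong) (auto simp: sg_fun nab[unfolded sum_fun] sum_fun)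
  show ?thesis
  proof (cases "finite T")
    \<comment> \<open>Here \<open>ext_deriv\<close> and \<open>wedge\<close> are 0 as sums over
      infinite sets, whereas \<open>dd\<close> ranges over \<open>i < l\<close> and vanishes because
      \<open>\<Phi>\<close> does.\<close>
    case False
    have "\<Phi> w' (T - {i}) = 0" for w' i
    proof (rule ccontr)
      assume "\<Phi> w' (T - {i}) \<noteq> 0"
      then have "T - {i} \<subseteq> {..<l}" using \<Phi>nz by blast
      then have "finite (T - {i})" using finite_subset by blast
      with False show False by simp
    qed
    then have "nab i (T - {i}) = 0" for i by (simp add: nab_def)
    then have "K.dd (\<lambda>T w. \<Phi> w T) T w = 0"
      unfolding dd by (intro sum.neutral) auto
    then show ?thesis
      using False by (simp add: bar_diff_def ext_deriv_def sum_fun form_scale_def wedge_infinite)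
  next
    case fin: True
    have sgn: "(-1) ^ j * ((-1) ^ card {i \<in> T - {t}. t < i} * \<Phi> w' (T - {t})) =
        (-1) ^ card {i \<in> T. i < t} * \<Phi> w' (T - {t})" if t: "t \<in> T" for w' t
    proof (cases "\<Phi> w' (T - {t}) = 0")
      case False
      then have "card (T - {t}) = j" using \<Phi>nz by blast
      then have "card T = Suc j" using fin t by (metis card_Suc_Diff1)
      show ?thesis
        by (simp only: mult.assoc[symmetric] minus_one_power_split[OF fin \<open>card T = Suc j\<close> t])
    qed simp
    have "bar_diff N \<alpha> j \<Phi> w T = (\<Sum>t\<in>T. (-1) ^ card {i \<in> T. i < t} * pderiv_rat t (\<Phi> w (T - {t}))) +
        (\<Sum>a<N. \<Sum>t\<in>T. (-1) ^ j * ((-1) ^ card {i \<in> T - {t}. t < i} * \<Phi> (a # w) (T - {t})) * dlog_coeff a t)"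
      by (simp add: bar_diff_def ext_deriv_def sum_fun form_scale_def wedge_one_form[OF one_form_dlog fin]
          sum_distrib_left mult.assoc)
    also have "(\<Sum>a<N. \<Sum>t\<in>T. (-1) ^ j * ((-1) ^ card {i \<in> T - {t}. t < i} * \<Phi> (a # w) (T - {t})) * dlog_coeff a t) =
        (\<Sum>t\<in>T. \<Sum>a<N. (-1) ^ card {i \<in> T. i < t} * (\<Phi> (a # w) (T - {t}) * dlog_coeff a t))"
      by (subst sum.swap, intro sum.cong refl, subst sgn) (simp_all add: mult.assoc)
    finally have "bar_diff N \<alpha> j \<Phi> w T = (\<Sum>t\<in>T. (-1) ^ card {i \<in> T. i < t} * nab t (T - {t}))"
      by (simp add: nab_def distrib_left sum.distrib sum_distrib_left)
    also have "\<dots> = (\<Sum>t\<in>T \<inter> {..<l}. (-1) ^ card {i \<in> T. i < t} * nab t (T - {t}))"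
    proof (rule sum.mono_neutral_right[OF fin])
      have "nab t T' = 0" if "l \<le> t" for t T'
        using that by (simp add: nab_def pderiv_high[OF \<Phi>\<O>] dlog_high)
      then show "\<forall>t\<in>T - T \<inter> {..<l}. (-1) ^ card {i \<in> T. i < t} * nab t (T - {t}) = 0"
        by (simp add: not_less)
    qed simp
    also have "\<dots> = (\<Sum>i<l. if i \<in> T then (-1) ^ card {j \<in> T. j < i} * nab i (T - {i}) else 0)"
      by (subst Int_commute, rule sum.inter_restrict) simp
    finally show ?thesis unfolding dd .
  qed
qed

lemma bar_diff_eq_0:
  "\<Phi> \<in> bar_forms l N \<alpha> j \<Longrightarrow> bar_diff N \<alpha> j \<Phi> = 0 \<longleftrightarrow> (\<forall>T. K.dd (\<lambda>T w. \<Phi> w T) T = 0)"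
  by (auto simp: fun_eq_iff bar_diff_dd)

section \<open>The cohomology groups\<close>

lemma cocycle_is_coboundary:
  assumes "\<Phi> \<in> cocycles l N \<alpha> (Suc j)"
  shows "\<Phi> \<in> coboundaries l N \<alpha> (Suc j)"
proof -
  have \<Phi>: "\<Phi> \<in> bar_forms l N \<alpha> (Suc j)" "bar_diff N \<alpha> (Suc j) \<Phi> = 0"
    using assms by (auto simp: cocycles_def)
  have "(\<lambda>T w. \<Phi> w T) \<in> K.Forms l (Suc j)" "\<And>T. K.dd (\<lambda>T w. \<Phi> w T) T = 0"
    using \<Phi> bar_forms_iff bar_diff_eq_0 by blast+
  from K.poincare[OF this] obtain \<Psi> where \<Psi>: "\<Psi> \<in> K.Forms l j" "\<And>T. K.dd \<Psi> T = (\<lambda>w. \<Phi> w T)"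
    by blast
  define \<Psi>' where "\<Psi>' = (\<lambda>w T. \<Psi> T w)"
  have tr: "(\<lambda>T w. \<Psi>' w T) = \<Psi>" by (simp add: \<Psi>'_def)
  have b: "\<Psi>' \<in> bar_forms l N \<alpha> j" using \<Psi>(1) by (simp add: bar_forms_iff tr)
  have "\<Phi> = bar_diff N \<alpha> j \<Psi>'"
    by (intro ext) (simp add: bar_diff_dd[OF b] tr \<Psi>(2))
  then show ?thesis using b by (simp add: coboundaries_def)
qed

lemma coboundaries_add:
  assumes "\<Phi> \<in> coboundaries l N \<alpha> (Suc j)" "\<Psi> \<in> coboundaries l N \<alpha> (Suc j)"
  shows "\<Phi> + \<Psi> \<in> coboundaries l N \<alpha> (Suc j)"
proof -
  obtain \<Phi>' \<Psi>' where *: "\<Phi>' \<in> bar_forms l N \<alpha> j" "\<Phi> = bar_diff N \<alpha> j \<Phi>'"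
      "\<Psi>' \<in> bar_forms l N \<alpha> j" "\<Psi> = bar_diff N \<alpha> j \<Psi>'"
    using assms by (auto simp: coboundaries_def)
  have b: "\<Phi>' + \<Psi>' \<in> bar_forms l N \<alpha> j" using * bar_forms_add by blast
  have "(\<lambda>T w. (\<Phi>' + \<Psi>') w T) = (\<lambda>T. (\<lambda>w. \<Phi>' w T) + (\<lambda>w. \<Psi>' w T))"
    by (simp add: fun_eq_iff)
  then have "\<Phi> + \<Psi> = bar_diff N \<alpha> j (\<Phi>' + \<Psi>')"
    by (intro ext) (simp add: *(2,4) bar_diff_dd[OF b] bar_diff_dd[OF *(1)] bar_diff_dd[OF *(3)] K.dd_add)
  then show ?thesis using b by (simp add: coboundaries_def)
qed

lemma coboundaries_minus:
  assumes "\<Phi> \<in> coboundaries l N \<alpha> (Suc j)"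
  shows "- \<Phi> \<in> coboundaries l N \<alpha> (Suc j)"
proof -
  obtain \<Phi>' where *: "\<Phi>' \<in> bar_forms l N \<alpha> j" "\<Phi> = bar_diff N \<alpha> j \<Phi>'"
    using assms by (auto simp: coboundaries_def)
  have "- (\<lambda>w. \<Phi>' w T) \<in> bar l" for T
    using *(1) by (auto simp: bar_forms_iff K.Forms_def intro: K.B_minus)
  moreover have "(\<lambda>w. (- \<Phi>') w T) = - (\<lambda>w. \<Phi>' w T)" for T by (simp add: fun_eq_iff)
  ultimately have b: "- \<Phi>' \<in> bar_forms l N \<alpha> j"
    using *(1) by (auto simp: bar_forms_iff K.Forms_def)
  have e: "(\<lambda>T. (\<lambda>w. \<Phi>' w T) + (\<lambda>w. (- \<Phi>') w T)) = (\<lambda>_. 0)" by (simp add: fun_eq_iff)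
  have s: "K.dd (\<lambda>T w. \<Phi>' w T) T + K.dd (\<lambda>T w. (- \<Phi>') w T) T = 0" for T
    using K.dd_add[of "\<lambda>T w. \<Phi>' w T" "\<lambda>T w. (- \<Phi>') w T" T] unfolding e K.dd_zero by (rule sym)
  have "(- \<Phi>) w T = bar_diff N \<alpha> j (- \<Phi>') w T" for w T
  proof -
    have "K.dd (\<lambda>T w. \<Phi>' w T) T w + K.dd (\<lambda>T w. (- \<Phi>') w T) T w = 0"
      using fun_cong[OF s[of T], of w] by (simp only: plus_fun_apply zero_fun_apply)
    then have "- K.dd (\<lambda>T w. \<Phi>' w T) T w = K.dd (\<lambda>T w. (- \<Phi>') w T) T w"
      by (rule minus_unique)
    moreover have "(- \<Phi>) w T = - K.dd (\<lambda>T w. \<Phi>' w T) T w"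
      using bar_diff_dd[OF *(1), of w T] by (simp add: *(2))
    ultimately show ?thesis
      unfolding bar_diff_dd[OF b] by (rule trans[rotated])
  qed
  then have "- \<Phi> = bar_diff N \<alpha> j (- \<Phi>')"
    by (intro ext)
  then show ?thesis using b by (simp add: coboundaries_def)
qed

lemma higher_cohomology: "cohomology l N \<alpha> (Suc j) = {coboundaries l N \<alpha> (Suc j)}"
proof -
  let ?B = "coboundaries l N \<alpha> (Suc j)"
  have coset: "coset ?B z = ?B" if "z \<in> ?B" for z
  proof (intro equalityI subsetI)
    fix u assume "u \<in> coset ?B z"
    then show "u \<in> ?B" using that coboundaries_add by (auto simp: coset_def)
  next
    fix u assume "u \<in> ?B"
    then have "- z + u \<in> ?B" using that coboundaries_add coboundaries_minus by blast
    then have "z + (- z + u) \<in> coset ?B z" unfolding coset_def by blast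
    then show "u \<in> coset ?B z" by simp
  qed
  have "0 \<in> cocycles l N \<alpha> (Suc j)"
  proof -
    have "(\<lambda>T w. (0 :: 'k bar) w T) = (\<lambda>_. 0)" by (simp add: fun_eq_iff)
    then have "bar_diff N \<alpha> (Suc j) 0 = 0"
      using bar_diff_eq_0[OF bar_forms_zero, of "Suc j"] K.dd_zero by simp
    then show ?thesis by (simp add: cocycles_def bar_forms_zero)
  qed
  then show ?thesis
    unfolding cohomology_def using coset cocycle_is_coboundary by (auto simp: image_iff)
qed

definition const_cocycle :: "'k \<Rightarrow> 'k bar" where
  "const_cocycle k = (\<lambda>w T. if w = [] \<and> T = {} then const_rat k else 0)"

text \<open>By \<open>closed_functions\<close> a cocycle of degree 0 has its coefficient in
  \<open>bar 0\<close>, that is, a constant on the empty word.\<close>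

lemma cocycles_0: "cocycles l N \<alpha> 0 = range const_cocycle"
proof (intro equalityI subsetI)
  fix \<Phi> assume "\<Phi> \<in> cocycles l N \<alpha> 0"
  then have *: "(\<lambda>T w. \<Phi> w T) \<in> K.Forms l 0" "\<And>T. K.dd (\<lambda>T w. \<Phi> w T) T = 0"
    using bar_forms_iff bar_diff_eq_0 unfolding cocycles_def by blast+
  have "(\<lambda>w. \<Phi> w {}) \<in> bar 0" by (rule K.closed_functions[OF *])
  then obtain k where k: "(\<lambda>w. \<Phi> w {}) = (\<lambda>w. if w = [] then const_rat k else 0)"
    unfolding bar_0 by blast
  have zero: "\<Phi> w T = 0" if "T \<noteq> {}" for w T
  proof (rule ccontr)
    assume "\<Phi> w T \<noteq> 0"
    then have "(\<lambda>w. \<Phi> w T) \<noteq> 0" by (auto simp: fun_eq_iff)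
    then have "T \<subseteq> {..<l}" "card T = 0" using *(1) unfolding K.Forms_def by blast+
    then show False using that finite_subset[of T "{..<l}"] by simp
  qed
  have "\<Phi> w T = const_cocycle k w T" for w T
    using zero[of T w] fun_cong[OF k, of w] by (cases "T = {}") (simp_all add: const_cocycle_def)
  then have "\<Phi> = const_cocycle k"
    by (intro ext)
  then show "\<Phi> \<in> range const_cocycle" by blast
next
  fix \<Phi> :: "'k bar" assume "\<Phi> \<in> range const_cocycle"
  then obtain k where \<Phi>: "\<Phi> = const_cocycle k" by blast
  have tr: "(\<lambda>w. \<Phi> w T) = (if T = {} then (\<lambda>w. if w = [] then const_rat k else 0) else (\<lambda>_. 0))" for T
    by (auto simp: \<Phi> const_cocycle_def fun_eq_iff)
  have B0: "(\<lambda>w. \<Phi> w T) \<in> bar 0" for T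
    unfolding tr using bar_0 bar_zero by auto
  then have Bl: "(\<lambda>w. \<Phi> w T) \<in> bar l" for T
    using bar_mono[of 0 l] by blast
  have F: "(\<lambda>T w. \<Phi> w T) \<in> K.Forms l 0"
    unfolding K.Forms_def using Bl tr by (auto simp: zero_fun_def)
  have "D s (\<lambda>w. \<Phi> w T) = 0" if "s < l" for s T
    using K.D_const[OF B0 _ that] by simp
  \<comment> \<open>The empty instance of \<open>K.Ext_sum\<close> says that \<open>Ext s\<close> of
    the zero form is 0.\<close>
  then have "K.dd (\<lambda>T w. \<Phi> w T) T = 0" for T
    unfolding K.dd_def using K.Ext_sum[of _ "\<lambda>_ _. 0" "{}"] by (intro sum.neutral) simp
  then show "\<Phi> \<in> cocycles l N \<alpha> 0"
    using F bar_forms_iff bar_diff_eq_0 unfolding cocycles_def by blast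
qed

lemma cohomology_0: "cohomology_iso_field l N \<alpha> 0"
proof -
  \<comment> \<open>In degree 0 the coboundaries are \<open>{0}\<close>, so each class is a single
    cocycle.\<close>
  have coset0: "coset {0} z = {z}" for z :: "'k bar" by (simp add: coset_def)
  have inj_c: "const_cocycle a = const_cocycle a' \<longleftrightarrow> a = a'" for a a'
  proof
    assume "const_cocycle a = const_cocycle a'"
    then have "const_cocycle a [] {} = const_cocycle a' [] {}" by simp
    then have "const_rat (a - a') = 0" by (simp add: const_cocycle_def \<kappa>_diff)
    then show "a = a'" by simp
  qed simp
  let ?\<theta> = "\<lambda>a. {const_cocycle a}"
  have "cohomology l N \<alpha> 0 = range ?\<theta>"
    unfolding cohomology_def cocycles_0 coboundaries_def by (simp add: coset0 image_image)
  moreover have "inj ?\<theta>" by (auto simp: inj_on_def inj_c)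
  ultimately have "bij_betw ?\<theta> UNIV (cohomology l N \<alpha> 0)"
    by (simp add: bij_betw_def)
  moreover have "?\<theta> (a + a') = coset_add (?\<theta> a) (?\<theta> a')" for a a'
  proof -
    have "const_cocycle (a + a') = const_cocycle a + const_cocycle a'"
      by (simp add: const_cocycle_def const_rat_add fun_eq_iff)
    then show ?thesis by (simp add: coset_add_def)
  qed
  moreover have "?\<theta> (c * a) = coset_scale (coboundaries l N \<alpha> 0) c (?\<theta> a)" for c a
  proof -
    have "const_cocycle (c * a) = bar_scale c (const_cocycle a)"
      by (simp add: const_cocycle_def bar_scale_def form_scale_def const_rat_mult fun_eq_iff)
    then show ?thesis by (simp add: coset_scale_def coboundaries_def)
  qed
  ultimately show ?thesis unfolding cohomology_iso_field_def by blast
qed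

end

theorem corollary3p39:
  fixes \<alpha> :: "nat \<Rightarrow> 'k::field_char_0 mpoly" and l N :: nat
  assumes "\<And>i. i < N \<Longrightarrow> degree_one l (\<alpha> i)"
    and "inj_on (\<lambda>i. zero_set l (\<alpha> i)) {..<N}"
    and "fiber_type l ((\<lambda>i. zero_set l (\<alpha> i)) ` {..<N})"
  shows "cohomology_iso_field l N \<alpha> 0 \<and>
         (\<forall>i\<ge>1. cohomology l N \<alpha> i = {coboundaries l N \<alpha> i})"
proof -
  obtain Y E lev c g where "adapted l ((\<lambda>i. zero_set l (\<alpha> i)) ` {..<N}) Y E lev c g"
    using fiber_type_adapted[OF assms(3)] by blast
  then interpret adapted_arrangement l N \<alpha> Y E lev c g
    using assms by unfold_locales
  show ?thesis
    using cohomology_0 higher_cohomology by (metis not0_implies_Suc not_one_le_zero)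
qed

end
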